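(* Let $X$ be a closed semialgebraic set of dimension $k$. If $n\ge 2k+2$, then $X$ has a unique semialgebraic and bi-Lipschitz embedding into $\mathbb{R}^n$, up to a semialgebraic and bi-Lipschitz tame homeomorphism of $\mathbb{R}^n$. That is, there exists a semialgebraic and bi-Lipschitz embedding $X\to\mathbb{R}^n$, and for any two semialgebraic and bi-Lipschitz embeddings $f,g:X\to\mathbb{R}^n$ there is a semialgebraic and bi-Lipschitz tame homeomorphism $\Phi$ of $\mathbb{R}^n$ such that $g=\Phi\circ f$.
   Context: Here $X$ is a closed semialgebraic subset of some $\mathbb{R}^m$ with the outer metric, i.e. the restriction of the Euclidean distance. A semialgebraic and bi-Lipschitz embedding $f:X\to\mathbb{R}^n$ is a semialgebraic map whose image $f(X)$ is a closed subset of $\mathbb{R}^n$ and such that $f:X\to f(X)$ is a bijection with $f$ and $f^{-1}$ Lipschitz (and semialgebraic). A bi-Lipschitz homeomorphism of $\mathbb{R}^n$ is called tame if it is a composition of bi-Lipschitz homeomorphisms of the form $(x_1,\dots,x_n)\mapsto(x_1,\dots,x_{n-1},x_n+p(x_1,\dots,x_{n-1}))$ and linear mappings of $\mathbb{R}^n$ with determinant one. *)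

theory Defs
  imports "HOL-Analysis.Analysis"
begin

section \<open>Semialgebraic sets and maps\<close>

inductive semialgebraic :: "'a::euclidean_space set \<Rightarrow> bool" where
  zero_set: "real_polynomial_function p \<Longrightarrow> semialgebraic {x. p x = 0}"
| pos_set: "real_polynomial_function p \<Longrightarrow> semialgebraic {x. p x > 0}"
| Un: "semialgebraic A \<Longrightarrow> semialgebraic B \<Longrightarrow> semialgebraic (A \<union> B)"
| Int: "semialgebraic A \<Longrightarrow> semialgebraic B \<Longrightarrow> semialgebraic (A \<inter> B)"
| Compl: "semialgebraic A \<Longrightarrow> semialgebraic (- A)"

definition semialgebraic_map_on ::
    "'a::euclidean_space set \<Rightarrow> ('a \<Rightarrow> 'b::euclidean_space) \<Rightarrow> bool" where
  "semialgebraic_map_on S f \<longleftrightarrow> semialgebraic S \<and> semialgebraic {(x, f x) | x. x \<in> S}"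

section \<open>Dimension\<close>

text \<open>For \<open>B \<subseteq> Basis\<close>, this is the open cube \<open>(0,1)\<^sup>d\<close> with \<open>d = card B\<close>, realised in the
  coordinate subspace spanned by \<open>B\<close>.\<close>

definition open_unit_cube :: "'a::euclidean_space set \<Rightarrow> 'a set" where
  "open_unit_cube B =
     {x. (\<forall>b\<in>B. 0 < x \<bullet> b \<and> x \<bullet> b < 1) \<and> (\<forall>b\<in>Basis - B. x \<bullet> b = 0)}"

text \<open>The dimension of a semialgebraic set \<open>S\<close> is the largest \<open>d\<close> for which there is an
  injective semialgebraic map \<open>(0,1)\<^sup>d \<rightarrow> S\<close>, and the empty set has dimension \<open>-1\<close>
  (Basu, Pollack and Roy, Algorithms in Real Algebraic Geometry, Section 5.3).
  No such map exists when \<open>d\<close> exceeds the dimension of the ambient space, so it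
  suffices to consider the cubes \<open>(0,1)\<^sup>d\<close> that fit into it; the set under \<open>Max\<close> is then finite.\<close>

definition semialgebraic_dim :: "'a::euclidean_space set \<Rightarrow> int" where
  "semialgebraic_dim S =
     Max (insert (-1) {int (card B) | B. B \<subseteq> Basis \<and>
       (\<exists>\<phi> :: 'a \<Rightarrow> 'a. semialgebraic_map_on (open_unit_cube B) \<phi> \<and>
          inj_on \<phi> (open_unit_cube B) \<and> \<phi> ` open_unit_cube B \<subseteq> S)})"

section \<open>Bi-Lipschitz embeddings and tame homeomorphisms\<close>

definition semialgebraic_bilipschitz_embedding ::
    "'a::euclidean_space set \<Rightarrow> ('a \<Rightarrow> 'b::euclidean_space) \<Rightarrow> bool" where
  "semialgebraic_bilipschitz_embedding X f \<longleftrightarrow>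
     closed (f ` X) \<and> inj_on f X \<and>
     semialgebraic_map_on X f \<and> semialgebraic_map_on (f ` X) (inv_into X f) \<and>
     (\<exists>L. L-lipschitz_on X f) \<and> (\<exists>L. L-lipschitz_on (f ` X) (inv_into X f))"

definition bilipschitz_homeo :: "('a::metric_space \<Rightarrow> 'a) \<Rightarrow> bool" where
  "bilipschitz_homeo \<Phi> \<longleftrightarrow>
     bij \<Phi> \<and> (\<exists>L. L-lipschitz_on UNIV \<Phi>) \<and> (\<exists>L. L-lipschitz_on UNIV (inv \<Phi>))"

text \<open>The coordinates of \<open>\<real>\<^sup>n\<close> are indexed by a finite linearly ordered type with \<open>n\<close> elements,
  so that there is a last coordinate.\<close>

definition last_index :: "'n::{finite,linorder}" where
  "last_index = Max UNIV"

text \<open>The map \<open>(x\<^sub>1, \<dots>, x\<^sub>n) \<mapsto> (x\<^sub>1, \<dots>, x\<^sub>n\<^sub>-\<^sub>1, x\<^sub>n + p (x\<^sub>1, \<dots>, x\<^sub>n\<^sub>-\<^sub>1))\<close>. The function \<open>p\<close>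
  of \<open>n - 1\<close> variables is given as a function on \<open>\<real>\<^sup>n\<close> that does not depend on the last
  coordinate.\<close>

definition last_coordinate_shear ::
    "(real^'n::{finite,linorder} \<Rightarrow> real^'n::{finite,linorder}) \<Rightarrow> bool" where
  "last_coordinate_shear T \<longleftrightarrow>
     (\<exists>p :: real^'n::{finite,linorder} \<Rightarrow> real.
        (\<forall>x y. (\<forall>i. i \<noteq> last_index \<longrightarrow> x $ i = y $ i) \<longrightarrow> p x = p y) \<and>
        (\<forall>x. T x = (\<chi> i. if i = last_index then x $ i + p x else x $ i)))"

inductive tame :: "(real^'n::{finite,linorder} \<Rightarrow> real^'n::{finite,linorder}) \<Rightarrow> bool" where
  shear: "last_coordinate_shear T \<Longrightarrow> bilipschitz_homeo T \<Longrightarrow> tame T"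
| linear: "linear T \<Longrightarrow> det (matrix T) = 1 \<Longrightarrow> tame T"
| comp: "tame S \<Longrightarrow> tame T \<Longrightarrow> tame (S \<circ> T)"

end

theory Submission
  imports Defs "HOL-Computational_Algebra.Polynomial"
begin

text \<open>
  The graph of \<open>(f, g)\<close> is moved from \<open>f\<close> to \<open>g\<close> one coordinate at a time. After generic linear
  changes \<open>F = A f\<close> and \<open>G = B g\<close>, every mixed tuple \<open>(F\<^sub>1, \<dots>, F\<^sub>i\<^sub>-\<^sub>1, G\<^sub>i\<^sub>+\<^sub>1, \<dots>, G\<^sub>n)\<close> of \<open>n - 1\<close>
  functions is still bi-Lipschitz on \<open>X\<close>, so \<open>F\<^sub>i\<close> can be turned into \<open>G\<^sub>i\<close> by a shear whose \<open>p\<close> is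
  McShane's extension of a Lipschitz function. Genericity is a measure argument: the tuples of
  linear forms that all annihilate some secant of \<open>X\<close> form a null set as \<open>2k < n - 1\<close>, and a
  semialgebraic null set lies in a proper algebraic hypersurface. A tuple off this hypersurface has
  a neighbourhood of good tuples, and this makes the lower Lipschitz bound uniform without any
  closure of the secant set.

  The measure estimate needs \<open>X\<close> to be a countable union of Lipschitz graphs over \<open>k\<close> coordinates.
  More than \<open>k\<close> coordinates of \<open>X\<close> satisfy a polynomial equation, because otherwise a semialgebraic
  section would embed a larger cube in \<open>X\<close>, and where a partial derivative of the equation does not
  vanish that coordinate is a locally Lipschitz function of the others. Definability rests on the
  Tarski--Seidenberg theorem, for which the sign diagram of finitely many univariate polynomials is
  reconstructed, as in the Cohen--Hoermander algorithm, from those of a derivative and of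
  pseudo-remainders.
\<close>

text \<open>A shear can change coordinate i of the moving copy of X when the required change is a
  Lipschitz function of the other n - 1 coordinates, which is guaranteed if these alone embed X.
  Passing through the doubled map (f, g) would secure this but takes 2n coordinates; staying in R^n
  costs one dimension more than the 2k + 1 that suffice for existence. A mixed tuple uses two
  embeddings at once and so is not a projection of a single secant set. Hence the genericity
  statement allows a different map u_j for each linear form.

  The pair (A, B) has to satisfy n such conditions, and both determinants must be nonzero. Each
  condition is implied by the nonvanishing of a nonzero polynomial in the entries, and a finite
  product of nonzero polynomials is nonzero; this is a second benefit of passing from null sets to
  hypersurfaces. Rescaling one row then makes the determinants one without spoiling the estimates.
  As dimension is given by injective images of cubes alone, the Lipschitz graphs take the place of a
  stratification.\<close>

section \<open>Boolean operations and sign conditions\<close>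

lemma semialgebraic_UNIV [simp]: "semialgebraic UNIV"
proof -
  have "semialgebraic {x::'a. (\<lambda>x. 0::real) x = 0}"
    by (rule semialgebraic.zero_set) (rule real_polynomial_function.intros(2))
  then show ?thesis by simp
qed

lemma semialgebraic_empty [simp]: "semialgebraic {}"
  using semialgebraic.Compl[OF semialgebraic_UNIV] by simp

lemma semialgebraic_UN:
  assumes "finite I" "\<And>i. i \<in> I \<Longrightarrow> semialgebraic (A i)"
  shows "semialgebraic (\<Union>i\<in>I. A i)"
  using assms by (induction I rule: finite_induct) (auto intro: semialgebraic.Un)

lemma semialgebraic_INT:
  assumes "finite I" "\<And>i. i \<in> I \<Longrightarrow> semialgebraic (A i)"
  shows "semialgebraic (\<Inter>i\<in>I. A i)"
  using assms by (induction I rule: finite_induct) (auto intro: semialgebraic.Int)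

lemma semialgebraic_sgn_eq:
  assumes "real_polynomial_function p"
  shows "semialgebraic {x. sgn (p x) = sgn c}"
proof -
  have "semialgebraic {x. p x = 0}" "semialgebraic {x. p x > 0}" "semialgebraic {x. - p x > 0}"
    by (rule semialgebraic.zero_set semialgebraic.pos_set, use assms in blast)+
  moreover consider "c = 0" | "c > 0" | "c < 0" by linarith
  then have "{x. sgn (p x) = sgn c} = {x. p x = 0} \<or> {x. sgn (p x) = sgn c} = {x. p x > 0}
      \<or> {x. sgn (p x) = sgn c} = {x. - p x > 0}"
    by cases (auto simp: sgn_if split: if_splits)
  ultimately show ?thesis by metis
qed

text \<open>Quantifier elimination is checked in this form: no formula for a projection is ever
  written down, only a finite set of polynomials whose signs decide membership. For the converse, at
  most 3^(card C) sign vectors occur, so \<open>S\<close> is a finite union of sign classes.\<close>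

lemma semialgebraic_iff_signs:
  "semialgebraic S \<longleftrightarrow>
     (\<exists>C. finite C \<and> (\<forall>p\<in>C. real_polynomial_function p) \<and>
       (\<forall>x y. (\<forall>p\<in>C. sgn (p x) = sgn (p y)) \<longrightarrow> (x \<in> S \<longleftrightarrow> y \<in> S)))"
proof
  assume "semialgebraic S"
  then show "\<exists>C. finite C \<and> (\<forall>p\<in>C. real_polynomial_function p) \<and>
       (\<forall>x y. (\<forall>p\<in>C. sgn (p x) = sgn (p y)) \<longrightarrow> (x \<in> S \<longleftrightarrow> y \<in> S))"
  proof induction
    case (zero_set p)
    show ?case
    proof (intro exI conjI)
      show "finite {p}" by simp
      show "\<forall>x y. (\<forall>p\<in>{p}. sgn (p x) = sgn (p y)) \<longrightarrow> (x \<in> {x. p x = 0} \<longleftrightarrow> y \<in> {x. p x = 0})"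
        by (auto simp: sgn_if split: if_splits)
    qed (use zero_set in auto)
  next
    case (pos_set p)
    show ?case
    proof (intro exI conjI)
      show "finite {p}" by simp
      show "\<forall>x y. (\<forall>p\<in>{p}. sgn (p x) = sgn (p y)) \<longrightarrow> (x \<in> {x. p x > 0} \<longleftrightarrow> y \<in> {x. p x > 0})"
        by (auto simp: sgn_if split: if_splits)
    qed (use pos_set in auto)
  next
    case (Un A B)
    from Un.IH(1) obtain C where C: "finite C" "\<forall>p\<in>C. real_polynomial_function p"
      "\<And>x y. (\<forall>p\<in>C. sgn (p x) = sgn (p y)) \<Longrightarrow> (x \<in> A \<longleftrightarrow> y \<in> A)" by auto
    from Un.IH(2) obtain D where D: "finite D" "\<forall>p\<in>D. real_polynomial_function p"
      "\<And>x y. (\<forall>p\<in>D. sgn (p x) = sgn (p y)) \<Longrightarrow> (x \<in> B \<longleftrightarrow> y \<in> B)" by auto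
    show ?case
    proof (intro exI[of _ "C \<union> D"] conjI allI impI)
      fix x y assume "\<forall>p\<in>C \<union> D. sgn (p x) = sgn (p y)"
      then show "x \<in> A \<union> B \<longleftrightarrow> y \<in> A \<union> B" using C(3)[of x y] D(3)[of x y] by auto
    qed (use C D in auto)
  next
    case (Int A B)
    from Int.IH(1) obtain C where C: "finite C" "\<forall>p\<in>C. real_polynomial_function p"
      "\<And>x y. (\<forall>p\<in>C. sgn (p x) = sgn (p y)) \<Longrightarrow> (x \<in> A \<longleftrightarrow> y \<in> A)" by auto
    from Int.IH(2) obtain D where D: "finite D" "\<forall>p\<in>D. real_polynomial_function p"
      "\<And>x y. (\<forall>p\<in>D. sgn (p x) = sgn (p y)) \<Longrightarrow> (x \<in> B \<longleftrightarrow> y \<in> B)" by auto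
    show ?case
    proof (intro exI[of _ "C \<union> D"] conjI allI impI)
      fix x y assume "\<forall>p\<in>C \<union> D. sgn (p x) = sgn (p y)"
      then show "x \<in> A \<inter> B \<longleftrightarrow> y \<in> A \<inter> B" using C(3)[of x y] D(3)[of x y] by auto
    qed (use C D in auto)
  next
    case (Compl A)
    then obtain C where "finite C" "\<forall>p\<in>C. real_polynomial_function p"
      "\<forall>x y. (\<forall>p\<in>C. sgn (p x) = sgn (p y)) \<longrightarrow> (x \<in> A \<longleftrightarrow> y \<in> A)"
      by blast
    then show ?case by (intro exI[of _ C]) simp
  qed
next
  assume "\<exists>C. finite C \<and> (\<forall>p\<in>C. real_polynomial_function p) \<and>
       (\<forall>x y. (\<forall>p\<in>C. sgn (p x) = sgn (p y)) \<longrightarrow> (x \<in> S \<longleftrightarrow> y \<in> S))"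
  then obtain C where C: "finite C" "\<And>p. p \<in> C \<Longrightarrow> real_polynomial_function p"
    "\<And>x y. \<forall>p\<in>C. sgn (p x) = sgn (p y) \<Longrightarrow> x \<in> S \<longleftrightarrow> y \<in> S"
    by blast
  let ?cls = "\<lambda>x. \<Inter>p\<in>C. {y. sgn (p y) = sgn (p x)}"
  let ?\<F> = "?cls ` S"
  let ?sig = "\<lambda>x. restrict (\<lambda>p. sgn (p x)) C"
  have "finite ?\<F>"
  proof -
    have "?\<F> \<subseteq> (\<lambda>\<sigma>. \<Inter>p\<in>C. {y. sgn (p y) = \<sigma> p}) ` (C \<rightarrow>\<^sub>E {-1, 0, 1})"
    proof
      fix A assume "A \<in> ?\<F>"
      then obtain x where "A = ?cls x" by blast
      then have "A = (\<lambda>\<sigma>. \<Inter>p\<in>C. {y. sgn (p y) = \<sigma> p}) (?sig x)" by auto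
      moreover have "?sig x \<in> C \<rightarrow>\<^sub>E {-1, 0, 1}" by (auto simp: sgn_if)
      ultimately show "A \<in> (\<lambda>\<sigma>. \<Inter>p\<in>C. {y. sgn (p y) = \<sigma> p}) ` (C \<rightarrow>\<^sub>E {-1, 0, 1})" by blast
    qed
    then show ?thesis
      by (rule finite_subset) (intro finite_imageI finite_PiE C(1), auto)
  qed
  moreover have "semialgebraic A" if "A \<in> ?\<F>" for A
    using that C by (auto intro!: semialgebraic_INT semialgebraic_sgn_eq)
  ultimately have "semialgebraic (\<Union>A\<in>?\<F>. A)"
    by (intro semialgebraic_UN)
  moreover have "(\<Union>A\<in>?\<F>. A) = S"
    using C(3) by auto
  ultimately show "semialgebraic S" by simp
qed

section \<open>Sign diagrams of univariate polynomials\<close>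

text \<open>Two points matched by a strictly increasing \<open>h\<close> on a finite set \<open>Z\<close> lie in corresponding
  cells of the subdivisions of the line given by \<open>Z\<close> and \<open>h ` Z\<close>.\<close>

definition matched :: "real set \<Rightarrow> (real \<Rightarrow> real) \<Rightarrow> real \<Rightarrow> real \<Rightarrow> bool" where
  "matched Z h s t \<longleftrightarrow> (\<forall>z\<in>Z. sgn (s - z) = sgn (t - h z))"

lemma sgn_diff_eq_iff:
  fixes a b c d :: real
  shows "sgn (a - b) = sgn (c - d) \<longleftrightarrow> (a < b \<longleftrightarrow> c < d) \<and> (b < a \<longleftrightarrow> d < c)"
  by (auto simp: sgn_if)

lemma matched_iff: "matched Z h s t \<longleftrightarrow> (\<forall>z\<in>Z. (s < z \<longleftrightarrow> t < h z) \<and> (z < s \<longleftrightarrow> h z < t))"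
  by (simp add: matched_def sgn_diff_eq_iff)

lemma matched_self: "strict_mono_on Z h \<Longrightarrow> s \<in> Z \<Longrightarrow> matched Z h s (h s)"
  unfolding matched_iff by (metis linorder_less_linear order_less_asym strict_mono_onD)

text \<open>Empty \<open>A\<close> or \<open>B\<close> is allowed so that the two unbounded cells of
  a subdivision of the line are covered as well.\<close>

lemma separating_point:
  fixes A B :: "real set"
  assumes "finite A" "finite B" "\<And>a b. a \<in> A \<Longrightarrow> b \<in> B \<Longrightarrow> a < b"
  shows "\<exists>t. (\<forall>a\<in>A. a < t) \<and> (\<forall>b\<in>B. t < b)"
proof (cases "A = {}")
  case True
  have "\<exists>t. \<forall>b\<in>B. t < b"
  proof (cases "B = {}")
    case False
    then show ?thesis using assms(2) by (intro exI[of _ "Min B - 1"]) (fastforce dest: Min_le[rotated])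
  qed auto
  then show ?thesis using True by auto
next
  case A: False
  show ?thesis
  proof (cases "B = {}")
    case True
    then show ?thesis using assms(1) A by (intro exI[of _ "Max A + 1"]) (auto intro: le_less_trans[OF Max_ge])
  next
    case False
    then have "Max A < Min B" using A assms by simp
    then obtain t where "Max A < t" "t < Min B" using dense by blast
    then show ?thesis using assms A False by auto
  qed
qed

lemma matched_exists:
  assumes "finite Z" "strict_mono_on Z h"
  shows "\<exists>t. matched Z h s t"
proof (cases "s \<in> Z")
  case True
  then show ?thesis using matched_self assms by blast
next
  case False
  have "\<exists>t. (\<forall>a\<in>h ` {z\<in>Z. z < s}. a < t) \<and> (\<forall>b\<in>h ` {z\<in>Z. s < z}. t < b)"
    using assms(1) by (intro separating_point) (auto intro!: strict_mono_onD[OF assms(2)])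
  then obtain t where "\<And>z. z \<in> Z \<Longrightarrow> z < s \<Longrightarrow> h z < t" "\<And>z. z \<in> Z \<Longrightarrow> s < z \<Longrightarrow> t < h z"
    by auto
  then show ?thesis using False unfolding matched_iff
    by (metis linorder_less_linear order_less_asym)
qed

lemma matched_exists_left:
  assumes "finite Z" "strict_mono_on Z h"
  shows "\<exists>s. matched Z h s t"
proof (cases "t \<in> h ` Z")
  case True
  then show ?thesis using matched_self assms by blast
next
  case False
  have "\<exists>s. (\<forall>a\<in>{z\<in>Z. h z < t}. a < s) \<and> (\<forall>b\<in>{z\<in>Z. t < h z}. s < b)"
  proof (intro separating_point)
    fix a b assume "a \<in> {z \<in> Z. h z < t}" "b \<in> {z \<in> Z. t < h z}"
    then have "h a < h b" "a \<in> Z" "b \<in> Z" by auto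
    then show "a < b"
      by (metis assms(2) linorder_less_linear order_less_asym strict_mono_onD)
  qed (use assms(1) in auto)
  then obtain s where "\<And>z. z \<in> Z \<Longrightarrow> h z < t \<Longrightarrow> z < s" "\<And>z. z \<in> Z \<Longrightarrow> t < h z \<Longrightarrow> s < z"
    by auto
  then show ?thesis using False unfolding matched_iff
    by (metis image_eqI linorder_less_linear order_less_asym)
qed

text \<open>Because all pairs from corresponding cells are compared, this also forces both
  polynomials to have constant sign on every cell.\<close>

definition sign_match ::
    "real set \<Rightarrow> (real \<Rightarrow> real) \<Rightarrow> real poly \<Rightarrow> real poly \<Rightarrow> bool" where
  "sign_match Z h p q \<longleftrightarrow> (\<forall>s t. matched Z h s t \<longrightarrow> sgn (poly p s) = sgn (poly q t))"

lemma sign_matchD: "sign_match Z h p q \<Longrightarrow> matched Z h s t \<Longrightarrow> sgn (poly p s) = sgn (poly q t)"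
  by (simp add: sign_match_def)

lemma poly_same_sign:
  fixes p :: "real poly"
  assumes "\<And>r. min s t \<le> r \<Longrightarrow> r \<le> max s t \<Longrightarrow> poly p r \<noteq> 0"
  shows "sgn (poly p s) = sgn (poly p t)"
proof (rule ccontr)
  assume *: "sgn (poly p s) \<noteq> sgn (poly p t)"
  have nz: "poly p s \<noteq> 0" "poly p t \<noteq> 0" using assms[of s] assms[of t] by auto
  then have neg: "poly p s * poly p t < 0"
    using * by (auto simp: sgn_if mult_less_0_iff split: if_splits)
  then have "s \<noteq> t" by auto
  then consider "s < t" | "t < s" by linarith
  then show False
  proof cases
    case 1
    from poly_IVT[OF 1 neg] assms show False by (auto simp: min_def max_def split: if_splits)
  next
    case 2
    from poly_IVT[OF 2, of p] neg assms show False by (auto simp: min_def max_def mult.commute split: if_splits)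
  qed
qed

text \<open>If \<open>z\<close> were not in \<open>Z\<close>, its cell would be an open interval,
  all of whose points match the same \<open>t\<close>. Then \<open>p\<close> would vanish on the
  whole interval, although a nonzero polynomial has finitely many roots.\<close>

lemma sign_match_root_mem:
  assumes Z: "finite Z" "strict_mono_on Z h" and "sign_match Z h p q"
    and "p \<noteq> 0" "poly p z = 0"
  shows "z \<in> Z"
proof (rule ccontr)
  assume z: "z \<notin> Z"
  obtain t where t: "matched Z h z t" using matched_exists Z by blast
  have q0: "poly q t = 0" using sign_matchD[OF assms(3) t] assms(5) by (simp add: sgn_if split: if_splits)
  have "\<forall>\<^sub>F s in at z. \<forall>y\<in>Z. (s < y \<longleftrightarrow> z < y) \<and> (y < s \<longleftrightarrow> y < z)"
  proof (intro eventually_ball_finite Z(1) ballI)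
    fix y assume "y \<in> Z"
    then consider "z < y" | "y < z" using z by (metis linorder_less_linear)
    then show "\<forall>\<^sub>F s in at z. (s < y \<longleftrightarrow> z < y) \<and> (y < s \<longleftrightarrow> y < z)"
    proof cases
      case 1
      have "\<forall>\<^sub>F s in at z. s < y" using 1 by (intro order_tendstoD(2)[OF tendsto_ident_at])
      then show ?thesis using 1 by (auto elim!: eventually_mono)
    next
      case 2
      have "\<forall>\<^sub>F s in at z. y < s" using 2 by (intro order_tendstoD(1)[OF tendsto_ident_at])
      then show ?thesis using 2 by (auto elim!: eventually_mono)
    qed
  qed
  moreover have "poly p s = 0" if "\<forall>y\<in>Z. (s < y \<longleftrightarrow> z < y) \<and> (y < s \<longleftrightarrow> y < z)" for s
  proof -
    have "matched Z h s t" using that t by (auto simp: matched_iff)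
    then show ?thesis using sign_matchD[OF assms(3), of s t] q0 by (simp add: sgn_if split: if_splits)
  qed
  ultimately have ev: "\<forall>\<^sub>F s in at z. poly p s = 0" by (rule eventually_mono)
  have "\<forall>\<^sub>F s in at z. s \<notin> {s. poly p s = 0}"
    by (rule islimpt_finite[of "{s. poly p s = 0}" z, unfolded islimpt_iff_eventually not_not])
      (use poly_roots_finite[OF \<open>p \<noteq> 0\<close>] in auto)
  with ev have "\<forall>\<^sub>F s in at z. False" by eventually_elim simp
  then show False by simp
qed

text \<open>When a further polynomial is added to the diagram, its signs are known only at roots of
  the old ones. Division points that are no such roots therefore have to be discarded, and the
  coarser subdivision must still be a diagram.\<close>

lemma sign_match_restrict_roots:
  assumes Z: "finite Z" "strict_mono_on Z h"
    and sm: "\<And>i. i \<in> F \<Longrightarrow> sign_match Z h (P i) (Q i)"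
  defines "Z0 \<equiv> {z. \<exists>i\<in>F. P i \<noteq> 0 \<and> poly (P i) z = 0}"
  shows "Z0 \<subseteq> Z" and "\<And>i. i \<in> F \<Longrightarrow> sign_match Z0 h (P i) (Q i)"
proof -
  show sub: "Z0 \<subseteq> Z" using sign_match_root_mem[OF Z sm] by (auto simp: Z0_def)
  fix i assume i: "i \<in> F"
  show "sign_match Z0 h (P i) (Q i)"
    unfolding sign_match_def
  proof (intro allI impI)
    fix s t assume st: "matched Z0 h s t"
    obtain u where u: "matched Z h s u" using matched_exists Z by blast
    show "sgn (poly (P i) s) = sgn (poly (Q i) t)"
    proof (cases "P i = 0")
      case True
      obtain s' where "matched Z h s' t" using matched_exists_left Z by blast
      then show ?thesis using sign_matchD[OF sm[OF i]] True by auto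
    next
      case False
      \<comment> \<open>Both \<open>u\<close> and \<open>t\<close> correspond to \<open>s\<close> in
        the coarse subdivision. A root of \<open>Q i\<close> between them would match a root of
        \<open>P i\<close>, which was retained, so its image would separate two points of the same
        coarse cell.\<close>
      have "sgn (poly (Q i) u) = sgn (poly (Q i) t)"
      proof (cases "u = t")
        case ut: False
        show ?thesis
        proof (rule poly_same_sign)
          fix r assume r: "min u t \<le> r" "r \<le> max u t"
          show "poly (Q i) r \<noteq> 0"
          proof
            assume *: "poly (Q i) r = 0"
            obtain r' where r': "matched Z h r' r" using matched_exists_left Z by blast
            then have "poly (P i) r' = 0"
              using sign_matchD[OF sm[OF i]] * by (metis sgn_0 sgn_0_0)
            then have "r' \<in> Z0" using False i by (auto simp: Z0_def)
            moreover from this have "r = h r'" using r' sub unfolding matched_iff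
              by (meson linorder_less_linear order_less_irrefl subsetD)
            ultimately show False using r ut st u sub unfolding matched_iff
              by (auto simp: min_def max_def split: if_splits) (smt (verit) subsetD)+
          qed
        qed
      qed simp
      then show ?thesis using sign_matchD[OF sm[OF i] u] by simp
    qed
  qed
qed

lemma eventually_sgn_poly_at_top:
  fixes p :: "real poly"
  assumes "degree p > 0"
  shows "\<exists>M. \<forall>x\<ge>M. sgn (poly p x) = sgn (lead_coeff p)"
proof -
  have pos: "\<exists>M. \<forall>x\<ge>M. sgn (poly p x) = 1" if "lead_coeff p > 0" for p :: "real poly"
    using poly_pinfty_gt_lc[OF that] that by (auto simp: sgn_if) (smt (verit))
  have "lead_coeff p \<noteq> 0" using assms by auto
  then consider "lead_coeff p > 0" | "lead_coeff (- p) > 0" by fastforce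
  then show ?thesis
  proof cases
    case 1
    then show ?thesis using pos[of p] by simp
  next
    case 2
    then show ?thesis using pos[of "- p"] by (auto simp: sgn_if split: if_splits) (smt (verit))
  qed
qed

lemma sgn_poly_at_bot:
  fixes p :: "real poly"
  assumes "degree p > 0"
  shows "\<exists>M. \<forall>x\<le>M. sgn (poly p x) = sgn ((-1) ^ degree p * lead_coeff p)"
proof -
  let ?p = "pcompose p [:0, -1:]"
  have "degree ?p = degree p" by (simp add: degree_pcompose)
  moreover have "lead_coeff ?p = (-1) ^ degree p * lead_coeff p"
    by (subst lead_coeff_comp) auto
  ultimately obtain M where M: "\<forall>x\<ge>M. sgn (poly ?p x) = sgn ((-1) ^ degree p * lead_coeff p)"
    using eventually_sgn_poly_at_top[of ?p] assms by auto
  have "sgn (poly p x) = sgn ((-1) ^ degree p * lead_coeff p)" if "x \<le> - M" for x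
    using M[rule_format, of "-x"] that by (simp add: poly_pcompose)
  then show ?thesis by blast
qed

lemma poly_strict_mono_between:
  fixes p :: "real poly"
  assumes "\<And>x. a < x \<Longrightarrow> x < b \<Longrightarrow> poly (pderiv p) x > 0" "a \<le> x" "x < y" "y \<le> b"
  shows "poly p x < poly p y"
  using poly_MVT[OF assms(3), of p] assms
  by (metis diff_gt_0_iff_gt dual_order.strict_trans1 dual_order.strict_trans2 mult_pos_pos)

text \<open>Both polynomials increase strictly on their intervals. The signs at the end points
  therefore decide whether there is a root inside, the root is unique, and the side of it on which a
  point lies gives the sign there.\<close>

lemma interval_sign_transfer_pos:
  fixes p q :: "real poly"
  assumes ab: "a < s" "s < b" "a' < t" "t < b'"
    and ends: "sgn (poly p a) = sgn (poly q a')" "sgn (poly p b) = sgn (poly q b')"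
    and p': "\<And>x. a < x \<Longrightarrow> x < b \<Longrightarrow> poly (pderiv p) x > 0"
    and q': "\<And>x. a' < x \<Longrightarrow> x < b' \<Longrightarrow> poly (pderiv q) x > 0"
  shows "(\<exists>z. a < z \<and> z < b \<and> poly p z = 0) \<longrightarrow> (\<exists>w. a' < w \<and> w < b' \<and> poly q w = 0)"
    and "(\<And>z. a < z \<Longrightarrow> z < b \<Longrightarrow> poly p z = 0 \<Longrightarrow>
        \<exists>w. a' < w \<and> w < b' \<and> poly q w = 0 \<and> sgn (s - z) = sgn (t - w))
      \<Longrightarrow> sgn (poly p s) = sgn (poly q t)"
proof -
  note mp = poly_strict_mono_between[where p = p and a = a and b = b, OF p']
    and mq = poly_strict_mono_between[where p = q and a = a' and b = b', OF q']
  have ab': "a < b" "a' < b'" using ab by auto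
  have root: "\<exists>w. a' < w \<and> w < b' \<and> poly q w = 0" if "poly p a < 0" "poly p b > 0"
    using poly_IVT_pos[OF ab'(2), of q] that ends by (auto simp: sgn_if split: if_splits)
  show "(\<exists>z. a < z \<and> z < b \<and> poly p z = 0) \<longrightarrow> (\<exists>w. a' < w \<and> w < b' \<and> poly q w = 0)"
  proof (intro impI)
    assume "\<exists>z. a < z \<and> z < b \<and> poly p z = 0"
    then obtain z where z: "a < z" "z < b" "poly p z = 0" by blast
    have "poly p a < 0" "poly p b > 0" using mp[of a z] mp[of z b] z by auto
    then show "\<exists>w. a' < w \<and> w < b' \<and> poly q w = 0" by (rule root)
  qed
  assume w: "\<And>z. a < z \<Longrightarrow> z < b \<Longrightarrow> poly p z = 0 \<Longrightarrow>
        \<exists>w. a' < w \<and> w < b' \<and> poly q w = 0 \<and> sgn (s - z) = sgn (t - w)"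
  consider "poly p a \<ge> 0" | "poly p b \<le> 0" | "poly p a < 0" "poly p b > 0" by linarith
  then show "sgn (poly p s) = sgn (poly q t)"
  proof cases
    case 1
    then have "poly q a' \<ge> 0" using ends by (auto simp: sgn_if split: if_splits)
    then have "poly q t > 0" "poly p s > 0" using 1 mp[of a s] mq[of a' t] ab by auto
    then show ?thesis by simp
  next
    case 2
    then have "poly q b' \<le> 0" using ends by (auto simp: sgn_if split: if_splits)
    then have "poly q t < 0" "poly p s < 0" using 2 mp[of s b] mq[of t b'] ab by auto
    then show ?thesis by simp
  next
    case 3
    then obtain z where z: "a < z" "z < b" "poly p z = 0" using poly_IVT_pos[OF ab'(1), of p] by auto
    then obtain w where w: "a' < w" "w < b'" "poly q w = 0" "sgn (s - z) = sgn (t - w)"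
      using w by blast
    consider "s < z" "t < w" | "s = z" "t = w" | "z < s" "w < t"
      using w(4) unfolding sgn_diff_eq_iff by linarith
    then show ?thesis
    proof cases
      case 1
      then show ?thesis using mp[of s z] mq[of t w] z w ab by simp
    next
      case 2
      then show ?thesis using z w by simp
    next
      case 3
      then show ?thesis using mp[of z s] mq[of w t] z w ab by simp
    qed
  qed
qed

lemma interval_sign_transfer:
  fixes p q :: "real poly"
  assumes ab: "a < s" "s < b" "a' < t" "t < b'"
    and ends: "sgn (poly p a) = sgn (poly q a')" "sgn (poly p b) = sgn (poly q b')"
    and e: "\<epsilon> \<noteq> 0"
    and p': "\<And>x. a < x \<Longrightarrow> x < b \<Longrightarrow> sgn (poly (pderiv p) x) = \<epsilon>"
    and q': "\<And>x. a' < x \<Longrightarrow> x < b' \<Longrightarrow> sgn (poly (pderiv q) x) = \<epsilon>"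
  shows "(\<exists>z. a < z \<and> z < b \<and> poly p z = 0) \<Longrightarrow> (\<exists>w. a' < w \<and> w < b' \<and> poly q w = 0)"
    and "(\<And>z. a < z \<Longrightarrow> z < b \<Longrightarrow> poly p z = 0 \<Longrightarrow>
        \<exists>w. a' < w \<and> w < b' \<and> poly q w = 0 \<and> sgn (s - z) = sgn (t - w))
      \<Longrightarrow> sgn (poly p s) = sgn (poly q t)"
proof -
  have "\<epsilon> = 1 \<or> \<epsilon> = -1" using p'[OF ab(1,2)] e by (auto simp: sgn_if split: if_splits)
  then consider "\<epsilon> = 1" | "\<epsilon> = -1" by blast
  then have "((\<exists>z. a < z \<and> z < b \<and> poly p z = 0) \<longrightarrow> (\<exists>w. a' < w \<and> w < b' \<and> poly q w = 0)) \<and>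
    ((\<forall>z. a < z \<and> z < b \<and> poly p z = 0 \<longrightarrow>
        (\<exists>w. a' < w \<and> w < b' \<and> poly q w = 0 \<and> sgn (s - z) = sgn (t - w)))
      \<longrightarrow> sgn (poly p s) = sgn (poly q t))"
  proof cases
    case 1
    have "\<And>x. a < x \<Longrightarrow> x < b \<Longrightarrow> poly (pderiv p) x > 0"
      "\<And>x. a' < x \<Longrightarrow> x < b' \<Longrightarrow> poly (pderiv q) x > 0"
      using p' q' 1 by (auto simp: sgn_1_pos)
    from interval_sign_transfer_pos[OF ab ends this] show ?thesis by blast
  next
    case 2
    have "\<And>x. a < x \<Longrightarrow> x < b \<Longrightarrow> poly (pderiv (-p)) x > 0"
      "\<And>x. a' < x \<Longrightarrow> x < b' \<Longrightarrow> poly (pderiv (-q)) x > 0"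
      using p' q' 2 by (auto simp: sgn_1_neg pderiv_minus)
    moreover have "sgn (poly (-p) a) = sgn (poly (-q) a')" "sgn (poly (-p) b) = sgn (poly (-q) b')"
      using ends by (auto simp: sgn_minus)
    ultimately show ?thesis
      using interval_sign_transfer_pos[OF ab, of "-p" "-q"] by (simp add: sgn_minus)
  qed
  then show "(\<exists>z. a < z \<and> z < b \<and> poly p z = 0) \<Longrightarrow> (\<exists>w. a' < w \<and> w < b' \<and> poly q w = 0)"
   "(\<And>z. a < z \<Longrightarrow> z < b \<Longrightarrow> poly p z = 0 \<Longrightarrow>
        \<exists>w. a' < w \<and> w < b' \<and> poly q w = 0 \<and> sgn (s - z) = sgn (t - w))
      \<Longrightarrow> sgn (poly p s) = sgn (poly q t)" by blast+
qed

text \<open>Between consecutive roots of the old family the derivative has constant sign, so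
  \<open>p\<close> is monotone there. Its signs at the ends of the cells come from
  \<open>roots\<close>, which is where the pseudo-remainders enter, and at infinity from the degree
  and the leading coefficient. This fixes which cells contain a root of \<open>p\<close>, and the
  same cells contain one of \<open>q\<close>.\<close>

lemma sign_match_extend:
  fixes P Q :: "'i \<Rightarrow> real poly"
  assumes F: "finite F" "i0 \<in> F" "P i0 = pderiv p" "Q i0 = pderiv q"
    and Z: "finite Z" "strict_mono_on Z h"
    and sm: "\<And>i. i \<in> F \<Longrightarrow> sign_match Z h (P i) (Q i)"
    and deg: "degree p = degree q" "degree p > 0" "sgn (lead_coeff p) = sgn (lead_coeff q)"
    and roots: "\<And>s t i. matched Z h s t \<Longrightarrow> i \<in> F \<Longrightarrow> P i \<noteq> 0 \<Longrightarrow> poly (P i) s = 0 \<Longrightarrow>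
      sgn (poly p s) = sgn (poly q t)"
  shows "\<exists>Z' h'. finite Z' \<and> strict_mono_on Z' h' \<and>
    (\<forall>i\<in>F. sign_match Z' h' (P i) (Q i)) \<and> sign_match Z' h' p q"
proof -
  define Z0 where "Z0 = {z. \<exists>i\<in>F. P i \<noteq> 0 \<and> poly (P i) z = 0}"
  have Z0: "Z0 \<subseteq> Z"
    unfolding Z0_def using Z sm by (rule sign_match_restrict_roots(1))
  have sm0: "\<And>i. i \<in> F \<Longrightarrow> sign_match Z0 h (P i) (Q i)"
    unfolding Z0_def by (rule sign_match_restrict_roots(2)[OF Z sm])
  have fin0: "finite Z0" using Z0 Z(1) finite_subset by blast
  have mono0: "strict_mono_on Z0 h" using Z(2) Z0 by (metis monotone_on_subset)
  have at_Z0: "sgn (poly p z) = sgn (poly q (h z))" if "z \<in> Z0" for z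
  proof -
    have "matched Z h z (h z)" using matched_self Z(2) Z0 that by blast
    then show ?thesis using that roots unfolding Z0_def by blast
  qed
  have p'0: "pderiv p \<noteq> 0" using deg(2) by (simp add: pderiv_eq_0_iff)
  have p'_match: "sgn (poly (pderiv p) s) = sgn (poly (pderiv q) t)" if "matched Z0 h s t" for s t
    using sign_matchD[OF sm0[OF F(2)] that] F(3,4) by simp
  have p'_nz: "poly (pderiv p) s \<noteq> 0" if "s \<notin> Z0" for s
    using that F(2,3) p'0 unfolding Z0_def by auto
  \<comment> \<open>The lower end of a cell is the nearest retained point. If there is none, a point
    so far to the left is taken that both polynomials already have their signs at minus infinity
    there; these agree by the hypotheses on degrees and leading coefficients.\<close>
  have left: "\<exists>a a'. a < s \<and> a' < t \<and> sgn (poly p a) = sgn (poly q a') \<and>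
      (\<forall>z\<in>Z0. z < s \<longrightarrow> z \<le> a) \<and> (\<forall>z\<in>Z0. h z < t \<longrightarrow> h z \<le> a')" if st: "matched Z0 h s t" for s t
  proof (cases "{z\<in>Z0. z < s} = {}")
    case True
    obtain M M' where M: "\<And>x. x \<le> M \<Longrightarrow> sgn (poly p x) = sgn ((-1) ^ degree p * lead_coeff p)"
      "\<And>x. x \<le> M' \<Longrightarrow> sgn (poly q x) = sgn ((-1) ^ degree q * lead_coeff q)"
      using sgn_poly_at_bot[of p] sgn_poly_at_bot[of q] deg by metis
    have "\<forall>z\<in>Z0. \<not> h z < t" using True st unfolding matched_iff by blast
    then show ?thesis using True M(1)[of "min M (s - 1)"] M(2)[of "min M' (t - 1)"] deg
      by (intro exI[of _ "min M (s - 1)"] exI[of _ "min M' (t - 1)"]) (auto simp: sgn_mult)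
  next
    case False
    define a where "a = Max {z\<in>Z0. z < s}"
    have a: "a \<in> Z0" "a < s" using Max_in[OF _ False] fin0 unfolding a_def by auto
    have le: "z \<le> a" if "z \<in> Z0" "z < s" for z using that fin0 unfolding a_def by simp
    have "h z \<le> h a" if "z \<in> Z0" "h z < t" for z
    proof -
      have "z \<le> a" using le st that unfolding matched_iff by blast
      then show ?thesis using strict_mono_on_leD[OF mono0] that a by blast
    qed
    moreover have "h a < t" using st a unfolding matched_iff by blast
    ultimately show ?thesis using a at_Z0 le by blast
  qed
  have right: "\<exists>b b'. s < b \<and> t < b' \<and> sgn (poly p b) = sgn (poly q b') \<and>
      (\<forall>z\<in>Z0. s < z \<longrightarrow> b \<le> z) \<and> (\<forall>z\<in>Z0. t < h z \<longrightarrow> b' \<le> h z)" if st: "matched Z0 h s t" for s t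
  proof (cases "{z\<in>Z0. s < z} = {}")
    case True
    obtain M M' where M: "\<And>x. x \<ge> M \<Longrightarrow> sgn (poly p x) = sgn (lead_coeff p)"
      "\<And>x. x \<ge> M' \<Longrightarrow> sgn (poly q x) = sgn (lead_coeff q)"
      using eventually_sgn_poly_at_top[of p] eventually_sgn_poly_at_top[of q] deg by metis
    have "\<forall>z\<in>Z0. \<not> t < h z" using True st unfolding matched_iff by blast
    then show ?thesis using True M(1)[of "max M (s + 1)"] M(2)[of "max M' (t + 1)"] deg
      by (intro exI[of _ "max M (s + 1)"] exI[of _ "max M' (t + 1)"]) auto
  next
    case False
    define b where "b = Min {z\<in>Z0. s < z}"
    have b: "b \<in> Z0" "s < b" using Min_in[OF _ False] fin0 unfolding b_def by auto
    have le: "b \<le> z" if "z \<in> Z0" "s < z" for z using that fin0 unfolding b_def by simp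
    have "h b \<le> h z" if "z \<in> Z0" "t < h z" for z
    proof -
      have "b \<le> z" using le st that unfolding matched_iff by blast
      then show ?thesis using strict_mono_on_leD[OF mono0] that b by blast
    qed
    moreover have "t < h b" using st b unfolding matched_iff by blast
    ultimately show ?thesis using b at_Z0 le by blast
  qed
  have cell: "\<exists>a b a' b' \<epsilon>. a < s \<and> s < b \<and> a' < t \<and> t < b' \<and>
      sgn (poly p a) = sgn (poly q a') \<and> sgn (poly p b) = sgn (poly q b') \<and> \<epsilon> \<noteq> 0 \<and>
      (\<forall>x. a < x \<longrightarrow> x < b \<longrightarrow> sgn (poly (pderiv p) x) = \<epsilon>) \<and>
      (\<forall>x. a' < x \<longrightarrow> x < b' \<longrightarrow> sgn (poly (pderiv q) x) = \<epsilon>) \<and>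
      (\<forall>x w. a < x \<longrightarrow> x < b \<longrightarrow> a' < w \<longrightarrow> w < b' \<longrightarrow> matched Z0 h x w)"
    if st: "matched Z0 h s t" and s: "s \<notin> Z0" for s t
  proof -
    obtain a a' where a: "a < s" "a' < t" "sgn (poly p a) = sgn (poly q a')"
      "\<And>z. z \<in> Z0 \<Longrightarrow> z < s \<Longrightarrow> z \<le> a" "\<And>z. z \<in> Z0 \<Longrightarrow> h z < t \<Longrightarrow> h z \<le> a'"
      using left[OF st] by blast
    obtain b b' where b: "s < b" "t < b'" "sgn (poly p b) = sgn (poly q b')"
      "\<And>z. z \<in> Z0 \<Longrightarrow> s < z \<Longrightarrow> b \<le> z" "\<And>z. z \<in> Z0 \<Longrightarrow> t < h z \<Longrightarrow> b' \<le> h z"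
      using right[OF st] by blast
    have m: "matched Z0 h x w" if "a < x" "x < b" "a' < w" "w < b'" for x w
      unfolding matched_iff
    proof
      fix z assume z: "z \<in> Z0"
      then consider "z < s" "h z < t" | "s < z" "t < h z"
        using s st unfolding matched_iff by (metis linorder_less_linear)
      then show "(x < z \<longleftrightarrow> w < h z) \<and> (z < x \<longleftrightarrow> h z < w)"
        by cases (use z a b that in fastforce)+
    qed
    show ?thesis
    proof (intro exI conjI allI impI)
      show "sgn (poly (pderiv p) s) \<noteq> 0" using p'_nz[OF s] by (simp add: sgn_0_0)
      fix x w
      show "a < x \<Longrightarrow> x < b \<Longrightarrow> sgn (poly (pderiv p) x) = sgn (poly (pderiv p) s)"
        using p'_match[OF m[of x t]] p'_match[OF st] a b by simp
      show "a' < x \<Longrightarrow> x < b' \<Longrightarrow> sgn (poly (pderiv q) x) = sgn (poly (pderiv p) s)"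
        using p'_match[OF m[of s x]] a b by simp
    qed (use a b m in auto)
  qed
  define Z1 where "Z1 = Z0 \<union> {z. poly p z = 0}"
  \<comment> \<open>A new root of \<open>p\<close> goes to a root of \<open>q\<close> in the
    corresponding cell. Its existence is shown in \<open>new\<close>, and its uniqueness is a
    consequence of Rolle's theorem.\<close>
  define h1 where "h1 z = (if z \<in> Z0 then h z else SOME w. matched Z0 h z w \<and> poly q w = 0)" for z
  have new: "matched Z0 h z (h1 z) \<and> poly q (h1 z) = 0" if z: "z \<notin> Z0" "poly p z = 0" for z
  proof -
    obtain t where t: "matched Z0 h z t" using matched_exists[OF fin0 mono0] by blast
    obtain a b a' b' \<epsilon> where c: "a < z" "z < b" "a' < t" "t < b'"
      "sgn (poly p a) = sgn (poly q a')" "sgn (poly p b) = sgn (poly q b')" "\<epsilon> \<noteq> 0"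
      "\<And>x. a < x \<Longrightarrow> x < b \<Longrightarrow> sgn (poly (pderiv p) x) = \<epsilon>"
      "\<And>x. a' < x \<Longrightarrow> x < b' \<Longrightarrow> sgn (poly (pderiv q) x) = \<epsilon>"
      and m: "\<And>x w. a < x \<Longrightarrow> x < b \<Longrightarrow> a' < w \<Longrightarrow> w < b' \<Longrightarrow> matched Z0 h x w"
      using cell[OF t z(1)] by blast
    obtain w where "a' < w" "w < b'" "poly q w = 0"
      using interval_sign_transfer(1)[OF c] z(2) c(1,2) by blast
    then have "matched Z0 h z w \<and> poly q w = 0" using m[of z w] c by blast
    then have "matched Z0 h z (SOME w. matched Z0 h z w \<and> poly q w = 0) \<and>
        poly q (SOME w. matched Z0 h z w \<and> poly q w = 0) = 0" by (rule someI)
    then show ?thesis using z(1) by (simp add: h1_def)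
  qed
  have h1_0: "h1 z = h z" if "z \<in> Z0" for z using that by (simp add: h1_def)
  have m1: "matched Z0 h z (h1 z)" if "z \<in> Z1" for z
    using that new[of z] matched_self[OF mono0, of z] by (cases "z \<in> Z0") (auto simp: h1_def Z1_def)
  have fin1: "finite Z1" unfolding Z1_def using fin0 deg(2) by (auto intro!: poly_roots_finite)
  have mono1: "strict_mono_on Z1 h1"
  proof (rule strict_mono_onI)
    fix y z assume yz: "y \<in> Z1" "z \<in> Z1" "y < z"
    \<comment> \<open>By Rolle's theorem two new roots are separated by a root of the derivative,
      which belongs to \<open>Z0\<close>. Comparison with the image of that point shows that
      \<open>h1\<close> keeps the order.\<close>
    have "\<exists>x\<in>Z0. y \<le> x \<and> x \<le> z"
    proof (cases "y \<in> Z0 \<or> z \<in> Z0")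
      case False
      then have "poly p y = 0" "poly p z = 0" using yz by (auto simp: Z1_def)
      then obtain x where "y < x" "x < z" "poly (pderiv p) x = 0"
        using poly_MVT[OF yz(3), of p] yz(3) by auto
      then have "x \<in> Z0" using p'_nz by blast
      then show ?thesis using \<open>y < x\<close> \<open>x < z\<close> by (intro bexI[of _ x]) auto
    next
      case True
      then show ?thesis using yz(3) by (metis order_refl less_imp_le)
    qed
    then obtain x where x: "x \<in> Z0" "y \<le> x" "x \<le> z" by blast
    then have "h1 y \<le> h x" "h x \<le> h1 z" "h1 y < h x \<or> h x < h1 z"
      using m1[OF yz(1)] m1[OF yz(2)] yz(3) unfolding matched_iff by force+
    then show "h1 y < h1 z" by linarith
  qed
  have sub: "matched Z0 h s t" if "matched Z1 h1 s t" for s t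
    using that h1_0 unfolding matched_def Z1_def by auto
  have "sign_match Z1 h1 p q"
    unfolding sign_match_def
  proof (intro allI impI)
    fix s t assume st1: "matched Z1 h1 s t"
    then have st: "matched Z0 h s t" by (rule sub)
    show "sgn (poly p s) = sgn (poly q t)"
    proof (cases "s \<in> Z0")
      case True
      then have "\<not> t < h s" "\<not> h s < t" using st unfolding matched_iff by auto
      then have "t = h s" by simp
      then show ?thesis using at_Z0 True by simp
    next
      case False
      obtain a b a' b' \<epsilon> where c: "a < s" "s < b" "a' < t" "t < b'"
        "sgn (poly p a) = sgn (poly q a')" "sgn (poly p b) = sgn (poly q b')" "\<epsilon> \<noteq> 0"
        "\<And>x. a < x \<Longrightarrow> x < b \<Longrightarrow> sgn (poly (pderiv p) x) = \<epsilon>"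
        "\<And>x. a' < x \<Longrightarrow> x < b' \<Longrightarrow> sgn (poly (pderiv q) x) = \<epsilon>"
        and m: "\<And>x w. a < x \<Longrightarrow> x < b \<Longrightarrow> a' < w \<Longrightarrow> w < b' \<Longrightarrow> matched Z0 h x w"
        using cell[OF st False] by blast
      show ?thesis
      proof (rule interval_sign_transfer(2)[OF c])
        fix z assume z: "a < z" "z < b" "poly p z = 0"
        have zZ: "z \<notin> Z0"
        proof
          assume "z \<in> Z0"
          then have "t = h z" "s = z"
            using m[OF z(1,2) c(3,4)] st m[OF z(1,2) c(3,4)] unfolding matched_iff
            by (metis linorder_less_linear order_less_irrefl)+
          then show False using False \<open>z \<in> Z0\<close> by simp
        qed
        note w = new[OF zZ z(3)]
        have zw: "sgn (s - z) = sgn (t - h1 z)" using st1 z(3) by (simp add: matched_def Z1_def)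
        obtain w where w': "a' < w" "w < b'" "poly q w = 0"
          using interval_sign_transfer(1)[OF c] z by blast
        \<comment> \<open>Two different roots of \<open>q\<close> in one cell would enclose a root
          \<open>r\<close> of its derivative. The point matching \<open>r\<close> is a root of the
          derivative of \<open>p\<close>, hence in \<open>Z0\<close>, and its image \<open>r\<close>
          would split the cell.\<close>
        have "w = h1 z"
        proof (rule ccontr)
          assume ne: "w \<noteq> h1 z"
          define l u where "l = min w (h1 z)" and "u = max w (h1 z)"
          have "l < u" "poly q l = 0" "poly q u = 0" using ne w w' by (auto simp: l_def u_def min_def max_def)
          then obtain r where r: "l < r" "r < u" "poly (pderiv q) r = 0"
            using poly_MVT[of l u q] by auto
          obtain y where y: "matched Z0 h y r" using matched_exists_left[OF fin0 mono0] by blast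
          then have "poly (pderiv p) y = 0" using p'_match[OF y] r(3) by (simp add: sgn_0_0)
          then have "y \<in> Z0" using p'_nz by blast
          then have "h y = r" using y unfolding matched_iff by (metis linorder_less_linear order_less_irrefl)
          moreover have "matched Z0 h z w" using m z w' by blast
          ultimately have "w < r \<longleftrightarrow> h1 z < r" "r < w \<longleftrightarrow> r < h1 z"
            using \<open>y \<in> Z0\<close> w unfolding matched_iff by blast+
          then show False using r unfolding l_def u_def by (auto simp: min_def max_def split: if_splits)
        qed
        then show "\<exists>w. a' < w \<and> w < b' \<and> poly q w = 0 \<and> sgn (s - z) = sgn (t - w)"
          using w' zw by blast
      qed
    qed
  qed
  moreover have "\<forall>i\<in>F. sign_match Z1 h1 (P i) (Q i)"
    using sm0 sub unfolding sign_match_def by blast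
  ultimately show ?thesis using fin1 mono1 by blast
qed

section \<open>The Tarski--Seidenberg theorem\<close>

text \<open>A polynomial in one variable whose coefficients are polynomials in the parameter
  \<open>x\<close>. The bound \<open>d\<close> is a formal degree: the true degree may drop at
  particular \<open>x\<close>, so leading coefficients need a case distinction later.\<close>

definition poly_family :: "nat \<Rightarrow> ('a::euclidean_space \<Rightarrow> real poly) \<Rightarrow> bool" where
  "poly_family d p \<longleftrightarrow> (\<forall>x. degree (p x) \<le> d) \<and> (\<forall>i. real_polynomial_function (\<lambda>x. coeff (p x) i))"

definition same_diagram :: "('a \<Rightarrow> real poly) set \<Rightarrow> 'a \<Rightarrow> 'a \<Rightarrow> bool" where
  "same_diagram F x y \<longleftrightarrow>
     (\<exists>Z h. finite Z \<and> strict_mono_on Z h \<and> (\<forall>p\<in>F. sign_match Z h (p x) (p y)))"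

text \<open>Elimination of one variable, in the form that is proved by induction: finitely many
  polynomials in the parameter alone have signs that fix the whole diagram along the line.\<close>

definition sign_determined :: "('a::euclidean_space \<Rightarrow> real poly) set \<Rightarrow> bool" where
  "sign_determined F \<longleftrightarrow>
     (\<exists>C. finite C \<and> (\<forall>c\<in>C. real_polynomial_function c) \<and>
       (\<forall>x y. (\<forall>c\<in>C. sgn (c x) = sgn (c y)) \<longrightarrow> same_diagram F x y))"

lemma same_diagram_mono: "same_diagram G x y \<Longrightarrow> F \<subseteq> G \<Longrightarrow> same_diagram F x y"
  unfolding same_diagram_def by blast

lemma real_polynomial_function_const [simp, intro]: "real_polynomial_function (\<lambda>x. c)"
  by (rule real_polynomial_function.intros(2))

lemma poly_family_pderiv: "poly_family (Suc d) p \<Longrightarrow> poly_family d (\<lambda>x. pderiv (p x))"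
  unfolding poly_family_def coeff_pderiv by (auto simp: degree_pderiv le_diff_conv)

lemma poly_family_cutoff:
  assumes "poly_family n p"
  shows "poly_family d (\<lambda>x. poly_cutoff (Suc d) (p x))"
  unfolding poly_family_def
proof (intro conjI allI)
  show "degree (poly_cutoff (Suc d) (p x)) \<le> d" for x
    by (rule degree_le) (simp add: coeff_poly_cutoff)
  show "real_polynomial_function (\<lambda>x. coeff (poly_cutoff (Suc d) (p x)) i)" for i
    using assms unfolding poly_family_def coeff_poly_cutoff by (cases "i < Suc d") simp_all
qed

lemma poly_cutoff_eq_self: "degree p < n \<Longrightarrow> poly_cutoff n p = p"
  by (rule poly_eqI) (auto simp: coeff_poly_cutoff coeff_eq_0)

text \<open>One step of pseudo-division of \<open>p\<close> (of formal degree \<open>d\<close>) by the part of \<open>q\<close> of degree at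
  most \<open>e\<close>: the leading terms cancel.\<close>

definition poly_reduct :: "nat \<Rightarrow> nat \<Rightarrow> ('a \<Rightarrow> real poly) \<Rightarrow> ('a \<Rightarrow> real poly) \<Rightarrow> 'a \<Rightarrow> real poly" where
  "poly_reduct d e p q x =
     smult (coeff (q x) e) (p x) - monom (coeff (p x) d) (d - e) * poly_cutoff (Suc e) (q x)"

lemma poly_family_reduct:
  assumes "poly_family (Suc d) p" "poly_family n q" "e \<le> Suc d"
  shows "poly_family d (poly_reduct (Suc d) e p q)"
proof -
  have c: "coeff (poly_reduct (Suc d) e p q x) i = coeff (q x) e * coeff (p x) i -
      (if Suc d - e \<le> i \<and> i - (Suc d - e) \<le> e then coeff (p x) (Suc d) * coeff (q x) (i - (Suc d - e)) else 0)" for x i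
    by (auto simp: poly_reduct_def coeff_monom_mult coeff_poly_cutoff)
  have "degree (poly_reduct (Suc d) e p q x) \<le> d" for x
  proof (rule degree_le, intro allI impI)
    fix i assume "d < i"
    then consider "i = Suc d" | "Suc d < i" by linarith
    then show "coeff (poly_reduct (Suc d) e p q x) i = 0"
    proof cases
      case 1
      then show ?thesis using assms(3) by (simp add: c)
    next
      case 2
      then have "coeff (p x) i = 0"
        using assms(1) unfolding poly_family_def by (metis coeff_eq_0 le_less_trans)
      then show ?thesis using 2 assms(3) by (auto simp: c)
    qed
  qed
  moreover have "real_polynomial_function (\<lambda>x. coeff (poly_reduct (Suc d) e p q x) i)" for i
    using assms unfolding c poly_family_def
    by (cases "Suc d - e \<le> i \<and> i - (Suc d - e) \<le> e")
      (auto intro!: real_polynomial_function_diff real_polynomial_function.intros(4))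
  ultimately show ?thesis unfolding poly_family_def by blast
qed

text \<open>At a root of \<open>q\<close> the subtracted multiple of \<open>q\<close> vanishes, so
  the reduct takes the value of \<open>p\<close> times the leading coefficient of \<open>q\<close>.
  A nonzero sign is its own inverse, which moves that factor to the other side.\<close>

lemma sgn_at_root_via_reduct:
  assumes "q x \<noteq> 0" "poly (q x) s = 0" "degree (q x) = e"
  shows "sgn (poly (p x) s) = sgn (coeff (q x) e) * sgn (poly (poly_reduct d e p q x) s)"
proof -
  have "poly (poly_reduct d e p q x) s = coeff (q x) e * poly (p x) s"
    using assms by (simp add: poly_reduct_def poly_cutoff_eq_self)
  then have "sgn (poly (poly_reduct d e p q x) s) = sgn (coeff (q x) e) * sgn (poly (p x) s)"
    by (simp add: sgn_mult)
  moreover have "coeff (q x) e \<noteq> 0" using assms by auto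
  ultimately show ?thesis by (auto simp: sgn_if)
qed

lemma same_diagram_extend:
  fixes p :: "'a::euclidean_space \<Rightarrow> real poly"
  assumes F: "finite F" "\<And>q. q \<in> F \<Longrightarrow> poly_family (Suc d) q" "(\<lambda>x. pderiv (p x)) \<in> F"
    and p: "poly_family (Suc d) p"
    and diag: "same_diagram (F \<union> {poly_reduct (Suc d) e p q | e q. e \<le> Suc d \<and> q \<in> F}) x y"
    and nz: "coeff (p x) (Suc d) \<noteq> 0"
    and sgns: "\<And>q i. q \<in> insert p F \<Longrightarrow> i \<le> Suc d \<Longrightarrow> sgn (coeff (q x) i) = sgn (coeff (q y) i)"
  shows "same_diagram (insert p F) x y"
proof -
  obtain Z h where Z: "finite Z" "strict_mono_on Z h" and
    sm: "\<And>q. q \<in> F \<Longrightarrow> sign_match Z h (q x) (q y)" and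
    smr: "\<And>q e. q \<in> F \<Longrightarrow> e \<le> Suc d \<Longrightarrow>
      sign_match Z h (poly_reduct (Suc d) e p q x) (poly_reduct (Suc d) e p q y)"
    using diag unfolding same_diagram_def by blast
  \<comment> \<open>Coefficients with equal signs vanish simultaneously, so the true degrees at
    \<open>x\<close> and at \<open>y\<close> agree. Hence the same \<open>e\<close>, and so the same
    reduct, computes the sign of \<open>p\<close> at the roots on both sides.\<close>
  have degeq: "degree (q x) = degree (q y)" if "q \<in> insert p F" for q
  proof -
    have 1: "degree (q z) \<le> Suc d" for z using that F(2) p unfolding poly_family_def by blast
    have 2: "coeff (q x) i = 0 \<longleftrightarrow> coeff (q y) i = 0" for i
    proof (cases "i \<le> Suc d")
      case True
      then show ?thesis using sgns[OF that True] by (metis sgn_0_0)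
    next
      case False
      then show ?thesis using 1 by (metis coeff_eq_0 le_less_trans not_le)
    qed
    show ?thesis
    proof (rule antisym)
      show "degree (q x) \<le> degree (q y)"
        by (rule degree_le) (use 2 coeff_eq_0 in blast)
      show "degree (q y) \<le> degree (q x)"
        by (rule degree_le) (use 2 coeff_eq_0 in blast)
    qed
  qed
  have degp: "degree (p x) = Suc d"
    using nz p unfolding poly_family_def by (metis antisym le_degree)
  have degp': "degree (p y) = Suc d" using degeq[of p] degp by simp
  have "\<exists>Z' h'. finite Z' \<and> strict_mono_on Z' h' \<and>
    (\<forall>q\<in>F. sign_match Z' h' (q x) (q y)) \<and> sign_match Z' h' (p x) (p y)"
  proof (rule sign_match_extend[OF F(1,3) _ _ Z])
    fix s t q assume *: "matched Z h s t" "q \<in> F" "q x \<noteq> 0" "poly (q x) s = 0"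
    define e where "e = degree (q x)"
    have e: "e \<le> Suc d" using F(2)[OF *(2)] unfolding e_def poly_family_def by blast
    have e': "degree (q y) = e" using degeq *(2) e_def by auto
    have se: "sgn (coeff (q x) e) = sgn (coeff (q y) e)" using sgns *(2) e by blast
    have "poly (q y) t = 0" using sign_matchD[OF sm[OF *(2)] *(1)] *(4) by (metis sgn_0 sgn_0_0)
    moreover have "q y \<noteq> 0"
      using se *(3) e_def by (metis coeff_0 leading_coeff_0_iff sgn_0 sgn_0_0)
    ultimately show "sgn (poly (p x) s) = sgn (poly (p y) t)"
      using sgn_at_root_via_reduct[where q = q and p = p and d = "Suc d", OF *(3,4)]
        sgn_at_root_via_reduct[where q = q and p = p and d = "Suc d" and x = y]
        e_def e' se sign_matchD[OF smr[OF *(2) e] *(1)] by metis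
  next
    show "degree (p x) = degree (p y)" "0 < degree (p x)" using degp degp' by auto
    show "sgn (lead_coeff (p x)) = sgn (lead_coeff (p y))" using sgns[of p "Suc d"] degp degp' by simp
  qed (use sm in auto)
  then show ?thesis unfolding same_diagram_def by blast
qed

text \<open>Where the top coefficient of \<open>p\<close> vanishes, \<open>p\<close> equals its
  cutoff, of smaller formal degree. Elsewhere the diagram of the derivative and of the reducts
  determines that of \<open>p\<close>. The set \<open>K\<close> of coefficients tells the two cases
  apart and fixes the true degrees.\<close>

lemma sign_determined_insert:
  fixes p :: "'a::euclidean_space \<Rightarrow> real poly"
  assumes F: "finite F" "\<And>q. q \<in> F \<Longrightarrow> poly_family (Suc d) q" "(\<lambda>x. pderiv (p x)) \<in> F"
    and p: "poly_family (Suc d) p"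
    and 1: "sign_determined (insert (\<lambda>x. poly_cutoff (Suc d) (p x)) F)"
    and 2: "sign_determined (F \<union> {poly_reduct (Suc d) e p q | e q. e \<le> Suc d \<and> q \<in> F})"
  shows "sign_determined (insert p F)"
proof -
  obtain C where C: "finite C" "\<forall>c\<in>C. real_polynomial_function c"
    "\<And>x y. \<forall>c\<in>C. sgn (c x) = sgn (c y) \<Longrightarrow> same_diagram (insert (\<lambda>x. poly_cutoff (Suc d) (p x)) F) x y"
    using 1 unfolding sign_determined_def by blast
  obtain D where D: "finite D" "\<forall>c\<in>D. real_polynomial_function c"
    "\<And>x y. \<forall>c\<in>D. sgn (c x) = sgn (c y) \<Longrightarrow>
       same_diagram (F \<union> {poly_reduct (Suc d) e p q | e q. e \<le> Suc d \<and> q \<in> F}) x y"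
    using 2 unfolding sign_determined_def by blast
  define K where "K = (\<lambda>(q, i) x. coeff (q x) i) ` (insert p F \<times> {..Suc d})"
  have "finite K" unfolding K_def using F(1) by blast
  moreover have "\<forall>c\<in>K. real_polynomial_function c"
    unfolding K_def using F(2) p by (auto simp: poly_family_def)
  moreover have "same_diagram (insert p F) x y" if *: "\<forall>c\<in>C \<union> D \<union> K. sgn (c x) = sgn (c y)" for x y
  proof -
    have sgns: "sgn (coeff (q x) i) = sgn (coeff (q y) i)" if "q \<in> insert p F" "i \<le> Suc d" for q i
    proof -
      have "(\<lambda>x. coeff (q x) i) \<in> K" unfolding K_def using that
        by (intro image_eqI[of _ _ "(q, i)"]) auto
      then show ?thesis using *[rule_format, of "\<lambda>x. coeff (q x) i"] by blast
    qed
    show ?thesis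
    proof (cases "coeff (p x) (Suc d) = 0")
      case True
      then have "coeff (p y) (Suc d) = 0" using sgns[of p "Suc d"] by (simp add: sgn_0_0)
      then have "poly_cutoff (Suc d) (p x) = p x" "poly_cutoff (Suc d) (p y) = p y"
        using True p unfolding poly_family_def
        by (intro poly_cutoff_eq_self; metis eq_zero_or_degree_less less_Suc_eq_0_disj le_less
            leading_coeff_0_iff degree_0 zero_less_Suc)+
      moreover have "same_diagram (insert (\<lambda>x. poly_cutoff (Suc d) (p x)) F) x y"
        using C(3) * by blast
      ultimately show ?thesis unfolding same_diagram_def by auto
    next
      case False
      show ?thesis
      proof (rule same_diagram_extend[where d = d])
        show "same_diagram (F \<union> {poly_reduct (Suc d) e p q | e q. e \<le> Suc d \<and> q \<in> F}) x y"
          using D(3) * by blast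
      qed (use F p False sgns in auto)
    qed
  qed
  ultimately show ?thesis unfolding sign_determined_def
    using C(1,2) D(1,2) by (intro exI[of _ "C \<union> D \<union> K"]) auto
qed

lemma sign_determined_mono: "sign_determined G \<Longrightarrow> F \<subseteq> G \<Longrightarrow> sign_determined F"
  unfolding sign_determined_def using same_diagram_mono by meson

lemma poly_family_mono: "poly_family d p \<Longrightarrow> d \<le> e \<Longrightarrow> poly_family e p"
  unfolding poly_family_def using order_trans by blast

lemma sign_determined_finite:
  fixes F :: "('a::euclidean_space \<Rightarrow> real poly) set"
  assumes "finite F" "\<And>p. p \<in> F \<Longrightarrow> poly_family d p"
  shows "sign_determined F"
  using assms
proof (induction d arbitrary: F)
  case 0
  have "same_diagram F x y" if *: "\<forall>c\<in>(\<lambda>p x. coeff (p x) 0) ` F. sgn (c x) = sgn (c y)" for x y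
  proof -
    have "sign_match {} id (p x) (p y)" if "p \<in> F" for p
    proof -
      have "p z = [:coeff (p z) 0:]" for z
        using 0(2)[OF that] unfolding poly_family_def by (metis degree_0_id le_zero_eq)
      then have "poly (p z) s = coeff (p z) 0" for z s by (metis mult_zero_right poly_0 poly_pCons add.right_neutral)
      then show ?thesis using * that by (auto simp: sign_match_def)
    qed
    then show ?thesis unfolding same_diagram_def
      by (intro exI[of _ "{}"] exI[of _ id]) (auto intro: strict_mono_onI)
  qed
  then show ?case unfolding sign_determined_def using 0
    by (intro exI[of _ "(\<lambda>p x. coeff (p x) 0) ` F"]) (auto simp: poly_family_def)
next
  case (Suc d)
  \<comment> \<open>The inner induction is on the number of members of full formal degree
    \<open>Suc d\<close>. Treating one of them, \<open>p\<close>, replaces it by its derivative, its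
    cutoff and its reducts, all of formal degree \<open>d\<close>. These join \<open>G\<close>,
    which is why \<open>G\<close> is arbitrary.\<close>
  have "sign_determined (G \<union> F)" if "finite F" "finite G" "\<And>p. p \<in> F \<Longrightarrow> poly_family (Suc d) p"
    "\<And>p. p \<in> G \<Longrightarrow> poly_family d p" for F G :: "('a \<Rightarrow> real poly) set"
    using that
  proof (induction F arbitrary: G rule: finite_induct)
    case empty
    then show ?case using Suc.IH by simp
  next
    case (insert p F)
    have p: "poly_family (Suc d) p" using insert by blast
    define H where "H = insert (\<lambda>x. pderiv (p x)) (G \<union> F)"
    have H: "poly_family (Suc d) q" if "q \<in> H" for q
      using that insert.prems poly_family_pderiv[OF p] poly_family_mono[of d _ "Suc d"]
      unfolding H_def by auto
    have "sign_determined (insert p H)"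
    proof (rule sign_determined_insert[OF _ H _ p])
      show "finite H" "(\<lambda>x. pderiv (p x)) \<in> H" using insert unfolding H_def by auto
      have "sign_determined (insert (\<lambda>x. pderiv (p x)) (insert (\<lambda>x. poly_cutoff (Suc d) (p x)) G) \<union> F)"
        using insert.prems poly_family_pderiv[OF p] poly_family_cutoff[OF p]
        by (intro insert.IH) auto
      then show "sign_determined (insert (\<lambda>x. poly_cutoff (Suc d) (p x)) H)"
        unfolding H_def by (simp add: insert_commute)
      let ?R = "{poly_reduct (Suc d) e p q | e q. e \<le> Suc d \<and> q \<in> H}"
      have "?R = (\<lambda>(e, q). poly_reduct (Suc d) e p q) ` ({..Suc d} \<times> H)" by auto
      then have "finite ?R" using \<open>finite H\<close> by simp
      moreover have "poly_family d r" if "r \<in> ?R" for r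
        using that poly_family_reduct[OF p H] by blast
      ultimately have "sign_determined (insert (\<lambda>x. pderiv (p x)) (G \<union> ?R) \<union> F)"
        using insert.prems poly_family_pderiv[OF p]
        by (intro insert.IH) auto
      then show "sign_determined (H \<union> ?R)"
        unfolding H_def by (rule sign_determined_mono) auto
    qed
    then show ?case by (rule sign_determined_mono) (auto simp: H_def)
  qed
  from this[of F "{}"] Suc.prems show ?case by simp
qed

lemma real_polynomial_function_as_family:
  fixes p :: "'a::euclidean_space \<times> real \<Rightarrow> real"
  assumes "real_polynomial_function p"
  shows "\<exists>d P. poly_family d P \<and> (\<forall>x t. poly (P x) t = p (x, t))"
  using assms
proof induction
  case (linear f)
  interpret bounded_linear f by fact
  have f: "f (x, t) = f (x, 0) + t * f (0, 1)" for x t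
  proof -
    have "f (x, t) = f ((x, 0) + t *\<^sub>R (0, 1))" by simp
    also have "\<dots> = f (x, 0) + t * f (0, 1)" by (simp only: add scaleR real_scaleR_def)
    finally show ?thesis .
  qed
  have "real_polynomial_function (\<lambda>x. coeff [:f (x, 0), f (0, 1):] i)" for i
  proof -
    have "bounded_linear (\<lambda>x. f (x, 0))"
      by (rule bounded_linear_compose[OF bounded_linear_axioms
          bounded_linear_Pair[OF bounded_linear_ident bounded_linear_zero]])
    then have "real_polynomial_function (\<lambda>x. f (x, 0))" by (rule real_polynomial_function.intros(1))
    moreover have "i = 0 \<or> i = Suc 0 \<or> (\<exists>j. i = Suc (Suc j))"
      by (metis not0_implies_Suc)
    ultimately show ?thesis by auto
  qed
  then have "poly_family 1 (\<lambda>x. [:f (x, 0), f (0, 1):])"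
    unfolding poly_family_def by (auto simp: degree_pCons_le)
  moreover have "poly [:f (x, 0), f (0, 1):] t = f (x, t)" for x t using f[of x t] by simp
  ultimately show ?case by blast
next
  case (const c)
  have "poly_family 0 (\<lambda>x. [:c:])"
    unfolding poly_family_def by (auto simp: coeff_pCons split: nat.split)
  then show ?case by (intro exI[of _ 0] exI[of _ "\<lambda>x. [:c:]"]) auto
next
  case (add f g)
  then obtain d P e Q where *: "poly_family d P" "\<forall>x t. poly (P x) t = f (x, t)"
    "poly_family e Q" "\<forall>x t. poly (Q x) t = g (x, t)" by blast
  have "poly_family (max d e) (\<lambda>x. P x + Q x)"
    using *(1,3) unfolding poly_family_def
    by (auto intro!: degree_add_le real_polynomial_function.intros(3) intro: le_max_iff_disj[THEN iffD2])
  then show ?case using * by (intro exI[of _ "max d e"] exI[of _ "\<lambda>x. P x + Q x"]) auto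
next
  case (mult f g)
  then obtain d P e Q where *: "poly_family d P" "\<forall>x t. poly (P x) t = f (x, t)"
    "poly_family e Q" "\<forall>x t. poly (Q x) t = g (x, t)" by blast
  have "poly_family (d + e) (\<lambda>x. P x * Q x)"
    using *(1,3) unfolding poly_family_def coeff_mult
    by (auto intro!: order_trans[OF degree_mult_le] add_mono real_polynomial_function.intros(4)
        real_polynomial_function_sum)
  then show ?case using * by (intro exI[of _ "d + e"] exI[of _ "\<lambda>x. P x * Q x"]) auto
qed

text \<open>Equal diagrams over \<open>x\<close> and \<open>y\<close> turn a witness
  \<open>s\<close> over \<open>x\<close> into a matched \<open>t\<close> over \<open>y\<close> at
  which all defining polynomials have the same signs. Membership in the projection therefore depends
  only on the signs of the polynomials in \<open>D\<close>.\<close>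

theorem semialgebraic_projection_real:
  fixes S :: "('a::euclidean_space \<times> real) set"
  assumes "semialgebraic S"
  shows "semialgebraic {x. \<exists>t. (x, t) \<in> S}"
proof -
  obtain C where C: "finite C" "\<And>p. p \<in> C \<Longrightarrow> real_polynomial_function p"
    "\<And>u v. \<forall>p\<in>C. sgn (p u) = sgn (p v) \<Longrightarrow> (u \<in> S \<longleftrightarrow> v \<in> S)"
    using assms unfolding semialgebraic_iff_signs by blast
  have "\<forall>p\<in>C. \<exists>d P. poly_family d P \<and> (\<forall>x t. poly (P x) t = p (x, t))"
    using C(2) real_polynomial_function_as_family by blast
  then obtain d P where P: "\<And>p. p \<in> C \<Longrightarrow> poly_family (d p) (P p)"
    "\<And>p x t. p \<in> C \<Longrightarrow> poly (P p x) t = p (x, t)" by metis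
  define m where "m = Max (d ` C)"
  have "sign_determined (P ` C)"
    using C(1) P(1) by (intro sign_determined_finite[of _ m]) (auto simp: m_def intro!: poly_family_mono[OF P(1)])
  then obtain D where D: "finite D" "\<forall>c\<in>D. real_polynomial_function c"
    "\<And>x y. \<forall>c\<in>D. sgn (c x) = sgn (c y) \<Longrightarrow> same_diagram (P ` C) x y"
    unfolding sign_determined_def by blast
  have imp: "\<exists>t. (y, t) \<in> S" if xy: "\<forall>c\<in>D. sgn (c x) = sgn (c y)" and "(x, s) \<in> S" for x y s
  proof -
    obtain Z h where Z: "finite Z" "strict_mono_on Z h" "\<And>p. p \<in> C \<Longrightarrow> sign_match Z h (P p x) (P p y)"
      using D(3)[OF xy] unfolding same_diagram_def by auto
    obtain t where "matched Z h s t" using matched_exists[OF Z(1,2)] by blast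
    then have "\<forall>p\<in>C. sgn (p (x, s)) = sgn (p (y, t))"
      using sign_matchD[OF Z(3)] P(2) by metis
    then show ?thesis using C(3) that(2) by blast
  qed
  show ?thesis
    unfolding semialgebraic_iff_signs
    using D(1,2) imp by (intro exI[of _ D]) (auto, metis+)
qed

section \<open>Definability\<close>

lemma polynomial_function_fst: "polynomial_function f \<Longrightarrow> polynomial_function (\<lambda>x. fst (f x))"
  using polynomial_function_compose[of f fst] polynomial_function_bounded_linear[OF bounded_linear_fst]
  by (simp add: o_def)

lemma polynomial_function_snd: "polynomial_function f \<Longrightarrow> polynomial_function (\<lambda>x. snd (f x))"
  using polynomial_function_compose[of f snd] polynomial_function_bounded_linear[OF bounded_linear_snd]
  by (simp add: o_def)

lemma polynomial_function_Pair:
  assumes "polynomial_function f" "polynomial_function g"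
  shows "polynomial_function (\<lambda>x. (f x, g x))"
proof -
  have "polynomial_function (\<lambda>y. (y, 0))" "polynomial_function (\<lambda>y. (0, y))"
    by (intro polynomial_function_bounded_linear bounded_linear_Pair bounded_linear_ident
        bounded_linear_zero)+
  then have "polynomial_function (\<lambda>x. (f x, 0) + (0, g x))"
    using polynomial_function_compose[OF assms(1), of "\<lambda>y. (y, 0)"]
      polynomial_function_compose[OF assms(2), of "\<lambda>y. (0, y)"]
    by (intro polynomial_function_add) (auto simp: o_def)
  then show ?thesis by simp
qed

lemma polynomial_function_vec_nth:
  assumes "polynomial_function (f :: _ \<Rightarrow> 'b::real_normed_vector ^ 'n)"
  shows "polynomial_function (\<lambda>x. f x $ i)"
  using polynomial_function_compose[OF assms
      polynomial_function_bounded_linear[OF bounded_linear_vec_nth[of i]]]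
  by (simp add: o_def)

lemma polynomial_function_times:
  fixes f g :: "_ \<Rightarrow> real"
  shows "polynomial_function f \<Longrightarrow> polynomial_function g \<Longrightarrow> polynomial_function (\<lambda>x. f x * g x)"
  using polynomial_function_mult[of f g] by simp

lemma polynomial_function_dot:
  fixes f g :: "_ \<Rightarrow> 'b::euclidean_space"
  assumes "polynomial_function f" "polynomial_function g"
  shows "polynomial_function (\<lambda>x. f x \<bullet> g x)"
proof -
  have "polynomial_function (\<lambda>x. f x \<bullet> b)" "polynomial_function (\<lambda>x. g x \<bullet> b)" for b
    using assms polynomial_function_inner by blast+
  then have "polynomial_function (\<lambda>x. \<Sum>b\<in>Basis. (f x \<bullet> b) * (g x \<bullet> b))"
    by (intro polynomial_function_sum polynomial_function_times) auto
  then show ?thesis by (simp add: euclidean_inner[symmetric])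
qed

lemmas polynomial_intros =
  polynomial_function_const polynomial_function_id polynomial_function_add polynomial_function_diff
  polynomial_function_minus polynomial_function_mult polynomial_function_fst polynomial_function_snd
  polynomial_function_Pair polynomial_function_vec_nth polynomial_function_times
  polynomial_function_dot

lemma semialgebraic_mem:
  assumes "semialgebraic S" "polynomial_function f"
  shows "semialgebraic {x. f x \<in> S}"
  using assms(1)
proof induction
  case (zero_set p)
  then have "semialgebraic {x. (p \<circ> f) x = 0}"
    by (intro semialgebraic.zero_set real_polynomial_function_compose assms)
  then show ?case by simp
next
  case (pos_set p)
  then have "semialgebraic {x. (p \<circ> f) x > 0}"
    by (intro semialgebraic.pos_set real_polynomial_function_compose assms)
  then show ?case by simp
next
  case (Un A B)
  have "{x. f x \<in> A \<union> B} = {x. f x \<in> A} \<union> {x. f x \<in> B}" by auto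
  then show ?case using Un.IH by (simp only: semialgebraic.Un)
next
  case (Int A B)
  have "{x. f x \<in> A \<inter> B} = {x. f x \<in> A} \<inter> {x. f x \<in> B}" by auto
  then show ?case using Int.IH by (simp only: semialgebraic.Int)
next
  case (Compl A)
  have "{x. f x \<in> - A} = - {x. f x \<in> A}" by auto
  then show ?case using Compl.IH by (simp only: semialgebraic.Compl)
qed

lemma semialgebraic_projection:
  fixes S :: "('a::euclidean_space \<times> 'b::euclidean_space) set"
  assumes S: "semialgebraic S"
  shows "semialgebraic {x. \<exists>y. (x, y) \<in> S}"
proof -
  \<comment> \<open>The type of the second factor stays fixed while its basis directions are
    quantified one by one: after the directions in \<open>B\<close>, the second component still
    serves as a base point. It is set to 0 once all directions are used.\<close>
  have step: "semialgebraic {z. \<exists>c::'b \<Rightarrow> real. (fst z, snd z + (\<Sum>b\<in>B. c b *\<^sub>R b)) \<in> S}"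
    if "finite B" for B
    using that
  proof induction
    case empty
    then show ?case using S by simp
  next
    case (insert e B)
    let ?T = "{z. \<exists>c::'b \<Rightarrow> real. (fst z, snd z + (\<Sum>b\<in>B. c b *\<^sub>R b)) \<in> S}"
    have "semialgebraic {u. (fst (fst u), snd (fst u) + snd u *\<^sub>R e) \<in> ?T}"
      by (rule semialgebraic_mem[OF insert.IH]) (intro polynomial_intros)
    from semialgebraic_projection_real[OF this]
    have "semialgebraic {z. \<exists>t. (fst z, snd z + t *\<^sub>R e) \<in> ?T}" by simp
    also have "{z. \<exists>t. (fst z, snd z + t *\<^sub>R e) \<in> ?T} =
      {z. \<exists>c::'b \<Rightarrow> real. (fst z, snd z + (\<Sum>b\<in>insert e B. c b *\<^sub>R b)) \<in> S}"
    proof (intro Collect_cong iffI)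
      fix z assume "\<exists>t. (fst z, snd z + t *\<^sub>R e) \<in> ?T"
      then obtain t c where "(fst z, snd z + t *\<^sub>R e + (\<Sum>b\<in>B. c b *\<^sub>R b)) \<in> S" by auto
      moreover have "(\<Sum>b\<in>insert e B. (c(e := t)) b *\<^sub>R b) = t *\<^sub>R e + (\<Sum>b\<in>B. c b *\<^sub>R b)"
        using insert.hyps by (simp add: sum.insert) (rule sum.cong, auto)
      ultimately show "\<exists>c::'b \<Rightarrow> real. (fst z, snd z + (\<Sum>b\<in>insert e B. c b *\<^sub>R b)) \<in> S"
        by (metis add.assoc)
    next
      fix z assume "\<exists>c::'b \<Rightarrow> real. (fst z, snd z + (\<Sum>b\<in>insert e B. c b *\<^sub>R b)) \<in> S"
      then show "\<exists>t. (fst z, snd z + t *\<^sub>R e) \<in> ?T"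
        using insert.hyps by (auto simp: add.assoc)
    qed
    finally show ?case .
  qed
  have "semialgebraic {x. (x, 0) \<in> {z. \<exists>c::'b \<Rightarrow> real. (fst z, snd z + (\<Sum>b\<in>Basis. c b *\<^sub>R b)) \<in> S}}"
    by (rule semialgebraic_mem[OF step]) (auto intro!: polynomial_intros)
  also have "{x. (x, 0) \<in> {z. \<exists>c::'b \<Rightarrow> real. (fst z, snd z + (\<Sum>b\<in>Basis. c b *\<^sub>R b)) \<in> S}} =
      {x. \<exists>y. (x, y) \<in> S}"
  proof (intro Collect_cong iffI)
    fix x assume "\<exists>y. (x, y) \<in> S"
    then obtain y where "(x, y) \<in> S" by blast
    then have "(x, 0 + (\<Sum>b\<in>Basis. (y \<bullet> b) *\<^sub>R b)) \<in> S" by (simp add: euclidean_representation)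
    then show "(x, 0) \<in> {z. \<exists>c::'b \<Rightarrow> real. (fst z, snd z + (\<Sum>b\<in>Basis. c b *\<^sub>R b)) \<in> S}"
      by (auto intro: exI[of _ "\<lambda>b. y \<bullet> b"])
  qed auto
  finally show ?thesis .
qed

section \<open>First-order formulas define semialgebraic sets\<close>

lemma semialgebraic_ex:
  assumes "semialgebraic {z. P (fst z) (snd z)}"
  shows "semialgebraic {x. \<exists>y. P x y}"
  using semialgebraic_projection[OF assms] by simp

lemma semialgebraic_not: "semialgebraic {x. P x} \<Longrightarrow> semialgebraic {x. \<not> P x}"
  using semialgebraic.Compl[of "{x. P x}"] by (simp add: Collect_neg_eq)

lemma semialgebraic_all:
  assumes "semialgebraic {z. P (fst z) (snd z)}"
  shows "semialgebraic {x. \<forall>y. P x y}"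
  using semialgebraic_not[OF semialgebraic_ex[OF semialgebraic_not[OF assms]]] by simp

lemma semialgebraic_conj:
  "semialgebraic {x. P x} \<Longrightarrow> semialgebraic {x. Q x} \<Longrightarrow> semialgebraic {x. P x \<and> Q x}"
  by (simp add: Collect_conj_eq semialgebraic.Int)

lemma semialgebraic_disj:
  "semialgebraic {x. P x} \<Longrightarrow> semialgebraic {x. Q x} \<Longrightarrow> semialgebraic {x. P x \<or> Q x}"
  by (simp add: Collect_disj_eq semialgebraic.Un)

lemma semialgebraic_imp:
  "semialgebraic {x. P x} \<Longrightarrow> semialgebraic {x. Q x} \<Longrightarrow> semialgebraic {x. P x \<longrightarrow> Q x}"
  unfolding imp_conv_disj by (intro semialgebraic_disj semialgebraic_not)

lemma semialgebraic_finite_ball: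
  "finite I \<Longrightarrow> (\<And>i. i \<in> I \<Longrightarrow> semialgebraic {x. P i x}) \<Longrightarrow> semialgebraic {x. \<forall>i\<in>I. P i x}"
  using semialgebraic_INT[of I "\<lambda>i. {x. P i x}"] by (simp add: Collect_ball_eq)

lemma semialgebraic_less:
  fixes f g :: "_ \<Rightarrow> real"
  assumes "polynomial_function f" "polynomial_function g"
  shows "semialgebraic {x. f x < g x}"
  using semialgebraic.pos_set[of "\<lambda>x. g x - f x"] polynomial_function_diff[OF assms(2,1)]
  by (simp add: real_polynomial_function_eq)

lemma semialgebraic_le:
  fixes f g :: "_ \<Rightarrow> real"
  assumes "polynomial_function f" "polynomial_function g"
  shows "semialgebraic {x. f x \<le> g x}"
  unfolding not_less[symmetric] by (intro semialgebraic_not semialgebraic_less assms)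

lemma semialgebraic_eq:
  fixes f g :: "_ \<Rightarrow> 'b::euclidean_space"
  assumes "polynomial_function f" "polynomial_function g"
  shows "semialgebraic {x. f x = g x}"
proof -
  have "polynomial_function (\<lambda>x. (f x - g x) \<bullet> (f x - g x))" by (intro polynomial_intros assms)
  then have "semialgebraic {x. (f x - g x) \<bullet> (f x - g x) = 0}"
    by (intro semialgebraic.zero_set) (simp add: real_polynomial_function_eq)
  then show ?thesis by simp
qed

lemmas semialgebraic_intros =
  semialgebraic_ex semialgebraic_all semialgebraic_not semialgebraic_conj semialgebraic_disj
  semialgebraic_imp semialgebraic_finite_ball semialgebraic_less semialgebraic_le semialgebraic_eq
  polynomial_intros

section \<open>Semialgebraic maps\<close>

abbreviation graph_on :: "'a set \<Rightarrow> ('a \<Rightarrow> 'b) \<Rightarrow> ('a \<times> 'b) set" where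
  "graph_on S f \<equiv> {(x, f x) | x. x \<in> S}"

lemma semialgebraic_map_on_image:
  assumes "semialgebraic_map_on S f"
  shows "semialgebraic (f ` S)"
proof -
  have G: "semialgebraic (graph_on S f)" using assms by (simp add: semialgebraic_map_on_def)
  have "semialgebraic {y. \<exists>x. (x, y) \<in> graph_on S f}"
    by (intro semialgebraic_intros semialgebraic_mem[OF G])
  then show ?thesis by (rule back_subst[of semialgebraic]) auto
qed

lemma semialgebraic_map_on_inv_into:
  assumes "semialgebraic_map_on S f" "inj_on f S"
  shows "semialgebraic_map_on (f ` S) (inv_into S f)"
  unfolding semialgebraic_map_on_def
proof
  have G: "semialgebraic (graph_on S f)" using assms by (simp add: semialgebraic_map_on_def)
  have "semialgebraic {z. (snd z, fst z) \<in> graph_on S f}"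
    by (intro semialgebraic_intros semialgebraic_mem[OF G])
  moreover have "{z. (snd z, fst z) \<in> graph_on S f} = graph_on (f ` S) (inv_into S f)"
    using assms(2) by force
  ultimately show "semialgebraic (graph_on (f ` S) (inv_into S f))" by simp
qed (rule semialgebraic_map_on_image[OF assms(1)])

lemma semialgebraic_map_on_compose:
  assumes "semialgebraic_map_on S f" "semialgebraic_map_on T g" "f ` S \<subseteq> T"
  shows "semialgebraic_map_on S (g \<circ> f)"
  unfolding semialgebraic_map_on_def
proof
  have F: "semialgebraic (graph_on S f)" and G: "semialgebraic (graph_on T g)"
    using assms by (simp_all add: semialgebraic_map_on_def)
  have "semialgebraic {z. \<exists>y. (fst z, y) \<in> graph_on S f \<and> (y, snd z) \<in> graph_on T g}"
    by (intro semialgebraic_intros semialgebraic_mem[OF F] semialgebraic_mem[OF G])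
  then show "semialgebraic (graph_on S (g \<circ> f))"
    by (rule back_subst[of semialgebraic]) (use assms(3) in \<open>auto simp: image_subset_iff\<close>)
qed (use assms in \<open>simp add: semialgebraic_map_on_def\<close>)

lemma semialgebraic_map_on_polynomial:
  assumes "semialgebraic S" "polynomial_function f"
  shows "semialgebraic_map_on S f"
  unfolding semialgebraic_map_on_def
proof
  have "polynomial_function (\<lambda>z. f (fst z))"
    using polynomial_function_compose[OF polynomial_function_fst[OF polynomial_function_id] assms(2)]
    by (simp add: o_def)
  then have "semialgebraic {z. fst z \<in> S \<and> snd z = f (fst z)}"
    by (intro semialgebraic_intros semialgebraic_mem[OF assms(1)])
  then show "semialgebraic (graph_on S f)"
    by (rule back_subst[of semialgebraic]) auto
qed (rule assms)

section \<open>Semialgebraic sets with empty interior\<close>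

lemma real_polynomial_function_on_line:
  assumes "real_polynomial_function p"
  shows "\<exists>q. \<forall>t. p (x + t *\<^sub>R v) = poly q t"
  using assms
proof induction
  case (linear f)
  interpret bounded_linear f by fact
  show ?case by (rule exI[of _ "[:f x, f v:]"]) (simp add: add scaleR)
next
  case (const c)
  show ?case by (rule exI[of _ "[:c:]"]) simp
next
  case (add f g)
  then obtain q r where "\<forall>t. f (x + t *\<^sub>R v) = poly q t" "\<forall>t. g (x + t *\<^sub>R v) = poly r t" by blast
  then show ?case by (intro exI[of _ "q + r"]) simp
next
  case (mult f g)
  then obtain q r where "\<forall>t. f (x + t *\<^sub>R v) = poly q t" "\<forall>t. g (x + t *\<^sub>R v) = poly r t" by blast
  then show ?case by (intro exI[of _ "q * r"]) simp
qed

text \<open>On the line from a point of \<open>U\<close> to \<open>y\<close> the polynomial becomes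
  univariate and has infinitely many roots near the start, so it is zero at the end as well.\<close>

lemma real_polynomial_function_eq_0_if_open:
  fixes p :: "'a::euclidean_space \<Rightarrow> real"
  assumes p: "real_polynomial_function p" and U: "open U" "U \<noteq> {}" "\<And>x. x \<in> U \<Longrightarrow> p x = 0"
  shows "p y = 0"
proof -
  obtain x where "x \<in> U" using U by blast
  then obtain e where e: "e > 0" "ball x e \<subseteq> U" using U(1) open_contains_ball by blast
  obtain q where q: "\<And>t. p (x + t *\<^sub>R (y - x)) = poly q t"
    using real_polynomial_function_on_line[OF p] by blast
  have "q = 0"
  proof (rule ccontr)
    assume "q \<noteq> 0"
    define d where "d = e / (norm (y - x) + 1)"
    have "d > 0" using e by (simp add: d_def add_nonneg_pos)
    have "{0<..<d} \<subseteq> {t. poly q t = 0}"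
    proof
      fix t assume t: "t \<in> {0<..<d}"
      have "t * norm (y - x) \<le> t * (norm (y - x) + 1)" using t by (intro mult_left_mono) auto
      also have "\<dots> < d * (norm (y - x) + 1)" using t by (intro mult_strict_right_mono) (auto simp: add_nonneg_pos)
      also have "\<dots> = e" unfolding d_def by (simp add: add_nonneg_eq_0_iff)
      finally have "x + t *\<^sub>R (y - x) \<in> U" using e(2) t by (auto simp: dist_norm subset_iff)
      then show "t \<in> {t. poly q t = 0}" using U(3) q by (metis mem_Collect_eq)
    qed
    then show False
      using poly_roots_finite[OF \<open>q \<noteq> 0\<close>] infinite_Ioo[OF \<open>d > 0\<close>] finite_subset by blast
  qed
  then show ?thesis using q[of 1] by simp
qed

lemma open_real_polynomial_nonzero:
  "real_polynomial_function (p :: 'a::euclidean_space \<Rightarrow> real) \<Longrightarrow> open {x. p x \<noteq> 0}"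
  using continuous_real_polymonial_function by (intro open_Collect_neq)
    (auto intro: continuous_at_imp_continuous_on)

text \<open>This lets finitely many generic conditions be met at once: the set where the earlier
  polynomials are nonzero is open and nonempty, so the next one cannot vanish on all of it.\<close>

lemma real_polynomial_functions_nonzero_prod:
  fixes P :: "'i \<Rightarrow> 'a::euclidean_space \<Rightarrow> real"
  assumes "finite I" "\<And>i. i \<in> I \<Longrightarrow> real_polynomial_function (P i)" "\<And>i. i \<in> I \<Longrightarrow> \<exists>x. P i x \<noteq> 0"
  shows "\<exists>x. \<forall>i\<in>I. P i x \<noteq> 0"
  using assms
proof (induction I rule: finite_induct)
  case (insert j I)
  let ?Q = "\<lambda>x. \<Prod>i\<in>I. P i x"
  have Q: "real_polynomial_function ?Q" using insert by (intro real_polynomial_function_prod) auto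
  have "\<exists>x. \<forall>i\<in>I. P i x \<noteq> 0" using insert by auto
  then have "{x. ?Q x \<noteq> 0} \<noteq> {}" using insert(1) by auto
  then obtain x where "?Q x \<noteq> 0" "P j x \<noteq> 0"
    using real_polynomial_function_eq_0_if_open[of "P j" "{x. ?Q x \<noteq> 0}"]
      open_real_polynomial_nonzero[OF Q] insert.prems by blast
  then show ?case using insert(1) by auto
qed auto

text \<open>Off the zero set of a nonzero polynomial \<open>p\<close> the sign of \<open>p\<close>
  is locally constant. Conjunctions multiply the polynomials involved, and a condition on an
  identically vanishing polynomial holds everywhere or nowhere, so it contributes the factor
  1.\<close>

lemma semialgebraic_locally_constant:
  fixes A :: "'a::euclidean_space set"
  assumes "semialgebraic A"
  shows "\<exists>P. real_polynomial_function P \<and> (\<exists>x. P x \<noteq> 0) \<and>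
    open {x\<in>A. P x \<noteq> 0} \<and> open {x\<in>-A. P x \<noteq> 0}"
proof -
  have sets: "\<exists>P. real_polynomial_function P \<and> (\<exists>x. P x \<noteq> 0) \<and>
      open {x\<in>A \<inter> B. P x \<noteq> 0} \<and> open {x\<in>-(A \<inter> B). P x \<noteq> 0}"
    if A: "\<exists>P. real_polynomial_function P \<and> (\<exists>x. P x \<noteq> 0) \<and>
        open {x\<in>A. P x \<noteq> 0} \<and> open {x\<in>-A. P x \<noteq> 0}"
      and B: "\<exists>P. real_polynomial_function P \<and> (\<exists>x. P x \<noteq> 0) \<and>
        open {x\<in>B. P x \<noteq> 0} \<and> open {x\<in>-B. P x \<noteq> 0}" for A B :: "'a set"
  proof -
    obtain P where P: "real_polynomial_function P" "\<exists>x. P x \<noteq> 0"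
      "open {x\<in>A. P x \<noteq> 0}" "open {x\<in>-A. P x \<noteq> 0}" using A by blast
    obtain Q where Q: "real_polynomial_function Q" "\<exists>x. Q x \<noteq> 0"
      "open {x\<in>B. Q x \<noteq> 0}" "open {x\<in>-B. Q x \<noteq> 0}" using B by blast
    have "\<exists>x. \<forall>i\<in>{True, False}. (if i then P else Q) x \<noteq> 0"
      using P Q by (intro real_polynomial_functions_nonzero_prod) auto
    then have nz: "\<exists>x. P x * Q x \<noteq> 0" by auto
    have "{x\<in>A \<inter> B. P x * Q x \<noteq> 0} = {x\<in>A. P x \<noteq> 0} \<inter> {x\<in>B. Q x \<noteq> 0}"
      "{x\<in>-(A \<inter> B). P x * Q x \<noteq> 0} =
        {x\<in>-A. P x \<noteq> 0} \<inter> {x. Q x \<noteq> 0} \<union> {x\<in>-B. Q x \<noteq> 0} \<inter> {x. P x \<noteq> 0}" by auto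
    moreover have "open \<dots>" by (intro open_Un open_Int P Q open_real_polynomial_nonzero)
    ultimately have "open {x\<in>A \<inter> B. P x * Q x \<noteq> 0}" "open {x\<in>-(A \<inter> B). P x * Q x \<noteq> 0}"
      using P Q by auto
    then show ?thesis using nz P(1) Q(1)
      by (intro exI[of _ "\<lambda>x. P x * Q x"]) (auto intro: real_polynomial_function.intros(4))
  qed
  have compl: "\<exists>P. real_polynomial_function P \<and> (\<exists>x. P x \<noteq> 0) \<and>
      open {x\<in>-A. P x \<noteq> 0} \<and> open {x\<in>-(-A). P x \<noteq> 0}"
    if A: "\<exists>P. real_polynomial_function P \<and> (\<exists>x. P x \<noteq> 0) \<and>
        open {x\<in>A. P x \<noteq> 0} \<and> open {x\<in>-A. P x \<noteq> 0}" for A :: "'a set"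
    using that unfolding double_complement by blast
  have atom: "\<exists>P. real_polynomial_function P \<and> (\<exists>x. P x \<noteq> 0) \<and>
      open {x\<in>{x. Q (p x)}. P x \<noteq> 0} \<and> open {x\<in>-{x. Q (p x)}. P x \<noteq> 0}"
    if p: "real_polynomial_function p" and Q: "open {t. Q t \<and> t \<noteq> 0}" "open {t. \<not> Q t \<and> t \<noteq> 0}"
    for p :: "'a \<Rightarrow> real" and Q :: "real \<Rightarrow> bool"
  proof (cases "\<exists>x. p x \<noteq> 0")
    case True
    have c: "continuous_on UNIV p"
      using continuous_real_polymonial_function[OF p] by (auto intro: continuous_at_imp_continuous_on)
    have "open (p -` {t. Q t \<and> t \<noteq> 0})" "open (p -` {t. \<not> Q t \<and> t \<noteq> 0})"
      by (intro open_vimage Q c)+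
    moreover have "p -` {t. Q t \<and> t \<noteq> 0} = {x\<in>{x. Q (p x)}. p x \<noteq> 0}"
      "p -` {t. \<not> Q t \<and> t \<noteq> 0} = {x\<in>-{x. Q (p x)}. p x \<noteq> 0}" by auto
    ultimately show ?thesis using True p by (intro exI[of _ p]) simp
  next
    case False
    then show ?thesis by (intro exI[of _ "\<lambda>x. 1"]) auto
  qed
  show ?thesis
    using assms
  proof induction
    case (zero_set p)
    have "{t::real. t \<noteq> 0 \<and> t \<noteq> 0} = - {0}" "{t::real. t = 0 \<and> t \<noteq> 0} = {}" by auto
    then show ?case by (intro atom[OF zero_set]) (simp_all add: open_Compl)
  next
    case (pos_set p)
    have "{t::real. t > 0 \<and> t \<noteq> 0} = {0<..}" "{t::real. \<not> t > 0 \<and> t \<noteq> 0} = {..<0}" by auto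
    then show ?case by (intro atom[OF pos_set]) simp_all
  next
    case (Int A B)
    show ?case by (rule sets[OF Int.IH])
  next
    case (Compl A)
    show ?case by (rule compl[OF Compl.IH])
  next
    case (Un A B)
    have "A \<union> B = -(-A \<inter> -B)" by auto
    then show ?case using compl[OF sets[OF compl[OF Un.IH(1)] compl[OF Un.IH(2)]]] by (simp only:)
  qed
qed

lemma semialgebraic_empty_interior:
  fixes A :: "'a::euclidean_space set"
  assumes "semialgebraic A" "interior A = {}"
  shows "\<exists>P. real_polynomial_function P \<and> (\<exists>x. P x \<noteq> 0) \<and> (\<forall>x\<in>A. P x = 0)"
proof -
  obtain P where P: "real_polynomial_function P" "\<exists>x. P x \<noteq> 0" "open {x\<in>A. P x \<noteq> 0}"
    using semialgebraic_locally_constant[OF assms(1)] by blast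
  have "{x\<in>A. P x \<noteq> 0} \<subseteq> interior A" using P(3) by (intro interior_maximal) auto
  then show ?thesis using P assms(2) by blast
qed

section \<open>Definable selection and dimension\<close>

text \<open>The points of least norm in a closed fibre form a nonempty compact set. Minimising one
  coordinate after another on it then attains each minimum and leaves a single point, and every
  stage is given by a first-order formula.\<close>

lemma semialgebraic_selection:
  fixes S :: "('a::euclidean_space \<times> 'b::euclidean_space) set"
  assumes S: "semialgebraic S"
    and fib: "\<And>x. x \<in> D \<Longrightarrow> closed {y. (x, y) \<in> S} \<and> {y. (x, y) \<in> S} \<noteq> {}"
  shows "\<exists>S'. semialgebraic S' \<and> S' \<subseteq> S \<and> (\<forall>x\<in>D. \<exists>!y. (x, y) \<in> S')"
proof -
  define S0 where "S0 = {z. z \<in> S \<and> (\<forall>y. (fst z, y) \<in> S \<longrightarrow> snd z \<bullet> snd z \<le> y \<bullet> y)}"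
  have S0: "semialgebraic S0" unfolding S0_def
    by (intro semialgebraic_intros semialgebraic_mem[OF S])
  have fib0: "compact {y. (x, y) \<in> S0} \<and> {y. (x, y) \<in> S0} \<noteq> {}" if "x \<in> D" for x
  proof -
    let ?F = "{y. (x, y) \<in> S}"
    obtain y where y: "y \<in> ?F" "\<And>z. z \<in> ?F \<Longrightarrow> norm y \<le> norm z"
    proof (rule distance_attains_inf[of ?F 0])
      fix y assume "y \<in> ?F" "\<And>z. z \<in> ?F \<Longrightarrow> dist 0 y \<le> dist 0 z"
      then show thesis by (intro that) auto
    qed (use fib[OF \<open>x \<in> D\<close>] in auto)
    have "{y. (x, y) \<in> S0} = ?F \<inter> cball 0 (norm y)"
      using y by (auto simp: S0_def norm_le[symmetric] intro: order_trans)
    moreover have "compact \<dots>" using fib[OF that] by (intro closed_Int_compact) auto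
    moreover have "y \<in> ?F \<inter> cball 0 (norm y)" using y by auto
    ultimately show ?thesis by auto
  qed
  have "\<exists>S'. semialgebraic S' \<and> S' \<subseteq> S \<and>
      (\<forall>x\<in>D. compact {y. (x, y) \<in> S'} \<and> {y. (x, y) \<in> S'} \<noteq> {}) \<and>
      (\<forall>x y z. (x, y) \<in> S' \<longrightarrow> (x, z) \<in> S' \<longrightarrow> (\<forall>b\<in>B. y \<bullet> b = z \<bullet> b))" if "finite B" for B
    using that
  proof induction
    case empty
    have "S0 \<subseteq> S" by (auto simp: S0_def)
    then show ?case using S0 fib0 by (intro exI[of _ S0]) simp
  next
    case (insert e B)
    from insert.IH obtain S' where S': "semialgebraic S'" "S' \<subseteq> S"
      and c: "\<forall>x\<in>D. compact {y. (x, y) \<in> S'} \<and> {y. (x, y) \<in> S'} \<noteq> {}"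
      and u: "\<forall>x y z. (x, y) \<in> S' \<longrightarrow> (x, z) \<in> S' \<longrightarrow> (\<forall>b\<in>B. y \<bullet> b = z \<bullet> b)" by metis
    define T where "T = {z. z \<in> S' \<and> (\<forall>y. (fst z, y) \<in> S' \<longrightarrow> snd z \<bullet> e \<le> y \<bullet> e)}"
    have "semialgebraic T" unfolding T_def
      by (intro semialgebraic_intros semialgebraic_mem[OF S'(1)])
    moreover have "compact {y. (x, y) \<in> T} \<and> {y. (x, y) \<in> T} \<noteq> {}" if "x \<in> D" for x
    proof -
      let ?F = "{y. (x, y) \<in> S'}"
      have F: "compact ?F" "?F \<noteq> {}" using c that by blast+
      have "continuous_on ?F (\<lambda>y. y \<bullet> e)" by (intro continuous_intros)
      then obtain y where y: "y \<in> ?F" "\<And>z. z \<in> ?F \<Longrightarrow> y \<bullet> e \<le> z \<bullet> e"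
        using continuous_attains_inf[OF F] by blast
      have "{y. (x, y) \<in> T} = ?F \<inter> {z. z \<bullet> e \<le> y \<bullet> e}"
        using y by (auto simp: T_def intro: order_trans)
      moreover have "compact \<dots>"
        by (intro compact_Int_closed closed_Collect_le continuous_intros F)
      moreover have "y \<in> ?F \<inter> {z. z \<bullet> e \<le> y \<bullet> e}" using y by auto
      ultimately show ?thesis by auto
    qed
    moreover have "y \<bullet> b = z \<bullet> b" if "(x, y) \<in> T" "(x, z) \<in> T" "b \<in> insert e B" for x y z b
    proof (cases "b = e")
      case True
      then show ?thesis using that unfolding T_def by (auto intro: antisym)
    next
      case False
      then show ?thesis using that u unfolding T_def by auto
    qed
    moreover have "T \<subseteq> S" using S'(2) by (auto simp: T_def)
    ultimately show ?case by (intro exI[of _ T] conjI allI impI ballI) blast+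
  qed
  from this[OF finite_Basis] obtain S' where S': "semialgebraic S'" "S' \<subseteq> S"
    and ne: "\<forall>x\<in>D. compact {y. (x, y) \<in> S'} \<and> {y. (x, y) \<in> S'} \<noteq> {}"
    and u: "\<forall>x y z. (x, y) \<in> S' \<longrightarrow> (x, z) \<in> S' \<longrightarrow> (\<forall>b\<in>Basis. y \<bullet> b = z \<bullet> b)"
    by (elim exE conjE) (rule that)
  have "\<exists>!y. (x, y) \<in> S'" if "x \<in> D" for x
  proof -
    have "{y. (x, y) \<in> S'} \<noteq> {}" using ne that by simp
    then obtain y where y: "(x, y) \<in> S'" by blast
    moreover have "z = y" if "(x, z) \<in> S'" for z
      using u[rule_format, OF that y] by (simp add: euclidean_eq_iff[of z y])
    ultimately show ?thesis by blast
  qed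
  then show ?thesis using S'(1,2) by blast
qed

section \<open>Dimension and coordinate projections\<close>

lemma finite_semialgebraic_dim_set:
  fixes S :: "'a::euclidean_space set"
  shows "finite {int (card B) | B. B \<subseteq> Basis \<and> (\<exists>\<phi> :: 'a \<Rightarrow> 'a.
    semialgebraic_map_on (open_unit_cube B) \<phi> \<and> inj_on \<phi> (open_unit_cube B) \<and>
    \<phi> ` open_unit_cube B \<subseteq> S)}" (is "finite ?D")
proof -
  have "?D \<subseteq> (int \<circ> card) ` Pow (Basis :: 'a set)" by auto
  then show ?thesis by (rule finite_subset) simp
qed

lemma card_le_semialgebraic_dim:
  fixes \<phi> :: "'a::euclidean_space \<Rightarrow> 'a"
  assumes "B \<subseteq> Basis" "semialgebraic_map_on (open_unit_cube B) \<phi>"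
    "inj_on \<phi> (open_unit_cube B)" "\<phi> ` open_unit_cube B \<subseteq> S"
  shows "int (card B) \<le> semialgebraic_dim S"
  unfolding semialgebraic_dim_def
  by (rule Max_ge) (use finite_semialgebraic_dim_set[of S] assms in auto)

lemma semialgebraic_open_unit_cube: "semialgebraic (open_unit_cube (B :: 'a::euclidean_space set))"
  if "B \<subseteq> Basis"
proof -
  have "finite B" using that finite_Basis finite_subset by blast
  then show ?thesis
    unfolding open_unit_cube_def by (intro semialgebraic_intros finite_Diff) auto
qed

lemma semialgebraic_dim_nonneg:
  assumes "X \<noteq> {}"
  shows "semialgebraic_dim X \<ge> 0"
proof -
  obtain a where "a \<in> X" using assms by blast
  have "open_unit_cube {} = {0::'a}"
    unfolding open_unit_cube_def by (auto simp: euclidean_eq_iff[where 'a = 'a])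
  then have "int (card ({} :: 'a set)) \<le> semialgebraic_dim X"
    using semialgebraic_open_unit_cube[of "{} :: 'a set"] \<open>a \<in> X\<close>
    by (intro card_le_semialgebraic_dim[where \<phi> = "\<lambda>x. a"])
      (auto intro!: semialgebraic_map_on_polynomial)
  then show ?thesis by simp
qed

text \<open>The set in question is the cylinder over the projection of \<open>X\<close> to the
  coordinates in \<open>B\<close>. If it contained a ball, a definable section over a small cube in
  the ball would map into \<open>X\<close>. It is injective because the \<open>B\<close>-coordinates
  of the value give the parameter back, and so the cube would be too large for the dimension of
  \<open>X\<close>.\<close>

lemma coordinate_projection_empty_interior:
  fixes X :: "'a::euclidean_space set"
  assumes X: "closed X" "semialgebraic X"
    and B: "B \<subseteq> Basis" "int (card B) > semialgebraic_dim X"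
  shows "interior {x. \<exists>y\<in>X. \<forall>b\<in>B. x \<bullet> b = y \<bullet> b} = {}"
proof (rule ccontr)
  let ?W = "{x. \<exists>y\<in>X. \<forall>b\<in>B. x \<bullet> b = y \<bullet> b}"
  assume "interior ?W \<noteq> {}"
  then obtain a where "a \<in> interior ?W" by blast
  then obtain e where e: "e > 0" "cball a e \<subseteq> ?W" unfolding mem_interior_cball by blast
  \<comment> \<open>Points of the unit cube have norm at most \<open>DIM('a)\<close>, so scaling by
    \<open>d\<close> keeps the translated cube inside the ball of radius \<open>e\<close>.\<close>
  define d where "d = e / DIM('a)"
  have d: "d > 0" using e by (simp add: d_def)
  have finB: "finite B" using B(1) finite_Basis finite_subset by blast
  define S where "S = {z. snd z \<in> X \<and> (\<forall>b\<in>B. snd z \<bullet> b = a \<bullet> b + d * (fst z \<bullet> b))}"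
  have S: "semialgebraic S" unfolding S_def
    by (intro semialgebraic_intros semialgebraic_mem[OF X(2)] finB)
  have "closed {y. (t, y) \<in> S} \<and> {y. (t, y) \<in> S} \<noteq> {}" if "t \<in> open_unit_cube B" for t
  proof
    have "{y. (t, y) \<in> S} = X \<inter> (\<Inter>b\<in>B. {y. y \<bullet> b = a \<bullet> b + d * (t \<bullet> b)})"
      by (auto simp: S_def)
    also have "closed \<dots>"
      by (intro closed_Int X closed_INT ballI closed_Collect_eq continuous_intros)
    finally show "closed {y. (t, y) \<in> S}" .
    have "norm t \<le> (\<Sum>b\<in>Basis. \<bar>t \<bullet> b\<bar>)" by (rule norm_le_l1)
    also have "\<dots> \<le> (\<Sum>b\<in>(Basis::'a set). 1)"
    proof (intro sum_mono)
      fix b :: 'a assume "b \<in> Basis"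
      then show "\<bar>t \<bullet> b\<bar> \<le> 1" using that unfolding open_unit_cube_def by (cases "b \<in> B") auto
    qed
    finally have "d * norm t \<le> d * DIM('a)" using d by simp
    also have "\<dots> = e" by (simp add: d_def)
    finally have "a + d *\<^sub>R t \<in> cball a e" using d by (simp add: dist_norm)
    then obtain y where "y \<in> X" "\<forall>b\<in>B. (a + d *\<^sub>R t) \<bullet> b = y \<bullet> b" using e(2) by blast
    then show "{y. (t, y) \<in> S} \<noteq> {}" by (auto simp: S_def inner_add_left)
  qed
  then obtain S' where S': "semialgebraic S'" "S' \<subseteq> S" "\<And>t. t \<in> open_unit_cube B \<Longrightarrow> \<exists>!y. (t, y) \<in> S'"
    using semialgebraic_selection[OF S] by metis
  define \<phi> where "\<phi> t = (THE y. (t, y) \<in> S')" for t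
  have \<phi>: "(t, y) \<in> S' \<longleftrightarrow> y = \<phi> t" if "t \<in> open_unit_cube B" for t y
    using theI'[OF S'(3)[OF that]] S'(3)[OF that] unfolding \<phi>_def by blast
  have \<phi>S: "(t, \<phi> t) \<in> S" if "t \<in> open_unit_cube B" for t using \<phi> that S'(2) by blast
  have "semialgebraic {z. fst z \<in> open_unit_cube B \<and> z \<in> S'}"
    by (intro semialgebraic_intros semialgebraic_mem[OF S'(1)]
        semialgebraic_mem[OF semialgebraic_open_unit_cube[OF B(1)]])
  moreover have "{z. fst z \<in> open_unit_cube B \<and> z \<in> S'} = graph_on (open_unit_cube B) \<phi>"
    using \<phi> by auto
  ultimately have "semialgebraic_map_on (open_unit_cube B) \<phi>"
    unfolding semialgebraic_map_on_def using semialgebraic_open_unit_cube[OF B(1)] by simp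
  moreover have "inj_on \<phi> (open_unit_cube B)"
  proof
    fix s t assume st: "s \<in> open_unit_cube B" "t \<in> open_unit_cube B" "\<phi> s = \<phi> t"
    have "s \<bullet> b = t \<bullet> b" if "b \<in> Basis" for b
    proof (cases "b \<in> B")
      case True
      have "a \<bullet> b + d * (s \<bullet> b) = a \<bullet> b + d * (t \<bullet> b)"
        using \<phi>S[OF st(1)] \<phi>S[OF st(2)] st(3) True by (auto simp: S_def)
      then show ?thesis using d by simp
    next
      case False
      then show ?thesis using st that by (simp add: open_unit_cube_def)
    qed
    then show "s = t" by (simp add: euclidean_eq_iff[of s t])
  qed
  moreover have "\<phi> ` open_unit_cube B \<subseteq> X" using \<phi>S by (auto simp: S_def)
  ultimately have "int (card B) \<le> semialgebraic_dim X"
    by (intro card_le_semialgebraic_dim[OF B(1)])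
  then show False using B(2) by simp
qed

definition depends_only_on :: "'a::euclidean_space set \<Rightarrow> ('a \<Rightarrow> 'b) \<Rightarrow> bool" where
  "depends_only_on B f \<longleftrightarrow> (\<forall>x y. (\<forall>b\<in>B. x \<bullet> b = y \<bullet> b) \<longrightarrow> f x = f y)"

lemma vanishing_polynomial_in_coordinates:
  fixes X :: "'a::euclidean_space set"
  assumes X: "closed X" "semialgebraic X"
    and B: "B \<subseteq> Basis" "int (card B) > semialgebraic_dim X"
  shows "\<exists>P. real_polynomial_function P \<and> (\<exists>x. P x \<noteq> 0) \<and> (\<forall>x\<in>X. P x = 0) \<and> depends_only_on B P"
proof -
  let ?W = "{x. \<exists>y. y \<in> X \<and> (\<forall>b\<in>B. x \<bullet> b = y \<bullet> b)}"
  have finB: "finite B" using B(1) finite_Basis finite_subset by blast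
  have W: "semialgebraic ?W"
    by (intro semialgebraic_intros semialgebraic_mem[OF X(2)] finB)
  have "interior ?W = {}"
    using coordinate_projection_empty_interior[OF assms] by (simp add: Bex_def)
  from semialgebraic_empty_interior[OF W this]
  obtain P where "real_polynomial_function P \<and> (\<exists>x. P x \<noteq> 0) \<and> (\<forall>x\<in>?W. P x = 0)"
    by (rule exE)
  then have P: "real_polynomial_function P" "\<exists>x. P x \<noteq> 0" "\<forall>x\<in>?W. P x = 0" by simp_all
  from P(2) obtain a where a: "P a \<noteq> 0" ..
  \<comment> \<open>The coordinates outside \<open>B\<close> are frozen at their values in
    \<open>a\<close>. Then \<open>P \<circ> \<pi>\<close> depends only on \<open>B\<close>; it still
    vanishes on \<open>X\<close> because \<open>?W\<close> is a cylinder, and it is not zero because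
    \<open>\<pi>\<close> fixes \<open>a\<close>.\<close>
  define \<pi> where "\<pi> x = (\<Sum>b\<in>B. (x \<bullet> b) *\<^sub>R b) + (\<Sum>b\<in>Basis - B. (a \<bullet> b) *\<^sub>R b)" for x
  have pi_B: "\<pi> x \<bullet> b = x \<bullet> b" if "b \<in> B" for x b
  proof -
    have "\<pi> x \<bullet> b = (\<Sum>c\<in>B. (x \<bullet> c) * (c \<bullet> b)) + (\<Sum>c\<in>Basis - B. (a \<bullet> c) * (c \<bullet> b))"
      by (simp add: \<pi>_def inner_add_left inner_sum_left)
    also have "\<dots> = (\<Sum>c\<in>B. if c = b then x \<bullet> c else 0) + (\<Sum>c\<in>Basis - B. 0)"
      using that B(1) subsetD[OF B(1)]
      by (intro arg_cong2[of _ _ _ _ "(+)"] sum.cong) (auto simp: inner_Basis)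
    finally show ?thesis using that finB by simp
  qed
  have pi_a: "\<pi> a = a"
    using sum.subset_diff[OF B(1) finite_Basis, of "\<lambda>b. (a \<bullet> b) *\<^sub>R b"] euclidean_representation[of a]
    by (simp add: \<pi>_def add.commute)
  have "polynomial_function \<pi>" unfolding \<pi>_def
    by (intro polynomial_intros polynomial_function_sum finB finite_Diff finite_Basis)
  then have "real_polynomial_function (P \<circ> \<pi>)" using P(1) by (intro real_polynomial_function_compose)
  moreover have "(P \<circ> \<pi>) a \<noteq> 0" using pi_a a by simp
  moreover have "(P \<circ> \<pi>) x = 0" if "x \<in> X" for x
  proof -
    have "\<pi> x \<in> ?W" using that pi_B by (intro CollectI exI[of _ x]) auto
    then show ?thesis using P(3) by simp
  qed
  moreover have "depends_only_on B (P \<circ> \<pi>)" unfolding depends_only_on_def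
  proof (intro allI impI)
    fix x y assume "\<forall>b\<in>B. x \<bullet> b = y \<bullet> b"
    then have "\<pi> x = \<pi> y" unfolding \<pi>_def by simp
    then show "(P \<circ> \<pi>) x = (P \<circ> \<pi>) y" by simp
  qed
  ultimately show ?thesis by blast
qed

section \<open>Covering by Lipschitz graphs over coordinate subspaces\<close>

text \<open>An upper bound for the degree, serving as a measure that partial differentiation
  decreases; the exact degree is never computed.\<close>

inductive polynomial_degree_le :: "nat \<Rightarrow> ('a::euclidean_space \<Rightarrow> real) \<Rightarrow> bool" where
  linear: "bounded_linear f \<Longrightarrow> polynomial_degree_le 1 f"
| const: "polynomial_degree_le 0 (\<lambda>x. c)"
| add: "polynomial_degree_le m f \<Longrightarrow> polynomial_degree_le n g \<Longrightarrow>
    polynomial_degree_le (max m n) (\<lambda>x. f x + g x)"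
| mult: "polynomial_degree_le m f \<Longrightarrow> polynomial_degree_le n g \<Longrightarrow>
    polynomial_degree_le (m + n) (\<lambda>x. f x * g x)"
| weaken: "polynomial_degree_le m f \<Longrightarrow> m \<le> n \<Longrightarrow> polynomial_degree_le n f"

lemma real_polynomial_function_degree:
  "real_polynomial_function p \<Longrightarrow> \<exists>n. polynomial_degree_le n p"
  by (induction rule: real_polynomial_function.induct) (blast intro: polynomial_degree_le.intros)+

lemma polynomial_degree_le_imp_real_polynomial_function:
  "polynomial_degree_le n p \<Longrightarrow> real_polynomial_function p"
  by (induction rule: polynomial_degree_le.induct) (auto intro: real_polynomial_function.intros)

definition partial_derivatives :: "('a::euclidean_space \<Rightarrow> real) \<Rightarrow> ('a \<Rightarrow> 'a \<Rightarrow> real) \<Rightarrow> bool" where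
  "partial_derivatives p p' \<longleftrightarrow>
     (\<forall>x. (p has_derivative (\<lambda>h. \<Sum>b\<in>Basis. (h \<bullet> b) * p' b x)) (at x))"

text \<open>The clause for \<open>n = 0\<close> makes up for truncated subtraction: there
  \<open>n - 1\<close> is no smaller bound, but the derivatives are zero.\<close>

lemma polynomial_degree_le_derivatives:
  assumes "polynomial_degree_le n p"
  shows "\<exists>p'. partial_derivatives p p' \<and>
    (\<forall>b. (n = 0 \<longrightarrow> p' b = (\<lambda>x. 0)) \<and> polynomial_degree_le (n - 1) (p' b))"
  using assms
proof induction
  case (linear f)
  note lin = bounded_linear.linear[OF linear]
  have "f h = (\<Sum>b\<in>Basis. (h \<bullet> b) * f b)" for h
  proof -
    have "f h = f (\<Sum>b\<in>Basis. (h \<bullet> b) *\<^sub>R b)" by (simp add: euclidean_representation)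
    also have "\<dots> = (\<Sum>b\<in>Basis. (h \<bullet> b) * f b)"
      by (simp add: linear_sum[OF lin] linear_cmul[OF lin])
    finally show ?thesis .
  qed
  then have "f = (\<lambda>h. \<Sum>b\<in>Basis. (h \<bullet> b) * f b)" by blast
  then have "partial_derivatives f (\<lambda>b x. f b)"
    unfolding partial_derivatives_def using bounded_linear.has_derivative[OF linear has_derivative_ident]
    by simp
  then show ?case by (intro exI[of _ "\<lambda>b x. f b"]) (auto intro: polynomial_degree_le.const)
next
  case (const c)
  have "partial_derivatives (\<lambda>x. c) (\<lambda>b x. 0)" by (simp add: partial_derivatives_def)
  then show ?case by (intro exI[of _ "\<lambda>b x. 0"]) (auto intro: polynomial_degree_le.const)
next
  case (add m f n g)
  then obtain f' g' where *: "partial_derivatives f f'" "partial_derivatives g g'"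
    "\<And>b. m = 0 \<Longrightarrow> f' b = (\<lambda>x. 0)" "\<And>b. polynomial_degree_le (m - 1) (f' b)"
    "\<And>b. n = 0 \<Longrightarrow> g' b = (\<lambda>x. 0)" "\<And>b. polynomial_degree_le (n - 1) (g' b)" by blast
  have "partial_derivatives (\<lambda>x. f x + g x) (\<lambda>b x. f' b x + g' b x)"
    unfolding partial_derivatives_def
  proof
    fix x
    have "((\<lambda>x. f x + g x) has_derivative
      (\<lambda>h. (\<Sum>b\<in>Basis. (h \<bullet> b) * f' b x) + (\<Sum>b\<in>Basis. (h \<bullet> b) * g' b x))) (at x)"
      using * by (intro has_derivative_add) (auto simp: partial_derivatives_def)
    then show "((\<lambda>x. f x + g x) has_derivative (\<lambda>h. \<Sum>b\<in>Basis. (h \<bullet> b) * (f' b x + g' b x))) (at x)"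
      by (simp add: sum.distrib distrib_left)
  qed
  moreover have "polynomial_degree_le (max m n - 1) (\<lambda>x. f' b x + g' b x)" for b
    by (rule polynomial_degree_le.weaken[OF polynomial_degree_le.add[OF *(4)[of b] *(6)[of b]]]) linarith
  ultimately show ?case
    using *(3,5) by (intro exI[of _ "\<lambda>b x. f' b x + g' b x"]) auto
next
  case (mult m f n g)
  then obtain f' g' where *: "partial_derivatives f f'" "partial_derivatives g g'"
    "\<And>b. m = 0 \<Longrightarrow> f' b = (\<lambda>x. 0)" "\<And>b. polynomial_degree_le (m - 1) (f' b)"
    "\<And>b. n = 0 \<Longrightarrow> g' b = (\<lambda>x. 0)" "\<And>b. polynomial_degree_le (n - 1) (g' b)" by blast
  have "partial_derivatives (\<lambda>x. f x * g x) (\<lambda>b x. f' b x * g x + f x * g' b x)"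
    unfolding partial_derivatives_def
  proof
    fix x
    have "((\<lambda>x. f x * g x) has_derivative
      (\<lambda>h. f x * (\<Sum>b\<in>Basis. (h \<bullet> b) * g' b x) + (\<Sum>b\<in>Basis. (h \<bullet> b) * f' b x) * g x)) (at x)"
      using * by (intro has_derivative_mult) (auto simp: partial_derivatives_def)
    then show "((\<lambda>x. f x * g x) has_derivative
      (\<lambda>h. \<Sum>b\<in>Basis. (h \<bullet> b) * (f' b x * g x + f x * g' b x))) (at x)"
      by (simp add: sum.distrib distrib_left sum_distrib_left sum_distrib_right algebra_simps)
  qed
  moreover have "polynomial_degree_le (m + n - 1) (\<lambda>x. f' b x * g x)" for b
  proof (cases "m = 0")
    case True
    then show ?thesis using *(3) by (simp add: polynomial_degree_le.weaken[OF polynomial_degree_le.const])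
  next
    case False
    then show ?thesis using polynomial_degree_le.mult[OF *(4)[of b] mult.hyps(2)] by simp
  qed
  moreover have "polynomial_degree_le (m + n - 1) (\<lambda>x. f x * g' b x)" for b
  proof (cases "n = 0")
    case True
    then show ?thesis using *(5) by (simp add: polynomial_degree_le.weaken[OF polynomial_degree_le.const])
  next
    case False
    then show ?thesis using polynomial_degree_le.mult[OF mult.hyps(1) *(6)[of b]] by simp
  qed
  ultimately have "polynomial_degree_le (m + n - 1) (\<lambda>x. f' b x * g x + f x * g' b x)" for b
    using polynomial_degree_le.add[of "m + n - 1" _ "m + n - 1"] by fastforce
  with \<open>partial_derivatives (\<lambda>x. f x * g x) _\<close> show ?case
    using *(3,5) by (intro exI[of _ "\<lambda>b x. f' b x * g x + f x * g' b x"]) auto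
next
  case (weaken m f n)
  then obtain f' where *: "partial_derivatives f f'"
    "\<And>b. m = 0 \<Longrightarrow> f' b = (\<lambda>x. 0)" "\<And>b. polynomial_degree_le (m - 1) (f' b)" by blast
  then show ?case using weaken.hyps(2)
    by (intro exI[of _ f']) (auto intro: polynomial_degree_le.weaken[of "m - 1"])
qed

lemma partial_derivatives_on_line:
  assumes "partial_derivatives p p'"
  shows "((\<lambda>t. p (x + t *\<^sub>R v)) has_real_derivative (\<Sum>b\<in>Basis. (v \<bullet> b) * p' b (x + t *\<^sub>R v))) (at t)"
proof -
  have 1: "((\<lambda>t. x + t *\<^sub>R v) has_derivative (\<lambda>s. s *\<^sub>R v)) (at t)"
    by (auto intro!: derivative_eq_intros)
  have 2: "(p has_derivative (\<lambda>h. \<Sum>b\<in>Basis. (h \<bullet> b) * p' b (x + t *\<^sub>R v))) (at (x + t *\<^sub>R v))"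
    using assms by (simp add: partial_derivatives_def)
  have "((\<lambda>t. p (x + t *\<^sub>R v)) has_derivative
      (\<lambda>s. \<Sum>b\<in>Basis. (s *\<^sub>R v \<bullet> b) * p' b (x + t *\<^sub>R v))) (at t)"
    using has_derivative_compose[OF 1 2] by simp
  moreover have "(\<lambda>s. \<Sum>b\<in>Basis. (s *\<^sub>R v \<bullet> b) * p' b (x + t *\<^sub>R v)) =
      (*) (\<Sum>b\<in>Basis. (v \<bullet> b) * p' b (x + t *\<^sub>R v))"
    by (auto simp: sum_distrib_left sum_distrib_right algebra_simps intro!: sum.cong)
  ultimately show ?thesis by (simp add: has_field_derivative_def)
qed

lemma partial_derivatives_direction:
  assumes "partial_derivatives p p'" "b \<in> Basis"
  shows "((\<lambda>t. p (x + t *\<^sub>R b)) has_real_derivative p' b x) (at 0)"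
proof -
  have "(\<Sum>c\<in>Basis. (b \<bullet> c) * p' c (x + 0 *\<^sub>R b)) = (\<Sum>c\<in>Basis. if c = b then p' c x else 0)"
    using assms(2) by (intro sum.cong) (auto simp: inner_Basis)
  then show ?thesis
    using partial_derivatives_on_line[OF assms(1), of x b 0] assms(2) by simp
qed

lemma depends_only_on_derivatives:
  assumes p: "partial_derivatives p p'" "depends_only_on B p" and b: "b \<in> Basis" and B: "B \<subseteq> Basis"
  shows "depends_only_on B (p' b)" and "b \<notin> B \<Longrightarrow> p' b x = 0"
proof -
  show "depends_only_on B (p' b)"
    unfolding depends_only_on_def
  proof (intro allI impI)
    fix x y :: 'a assume xy: "\<forall>c\<in>B. x \<bullet> c = y \<bullet> c"
    have "p (x + t *\<^sub>R b) = p (y + t *\<^sub>R b)" for t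
      using p(2) xy unfolding depends_only_on_def by (auto simp: inner_add_left)
    then show "p' b x = p' b y"
      using partial_derivatives_direction[OF p(1) b, of x] partial_derivatives_direction[OF p(1) b, of y]
      by (auto intro: DERIV_unique)
  qed
  assume "b \<notin> B"
  have "p (x + t *\<^sub>R b) = p x" for t
  proof -
    have "b \<bullet> c = 0" if "c \<in> B" for c
      using that b B \<open>b \<notin> B\<close> by (metis inner_Basis subsetD)
    then show ?thesis
      using p(2) unfolding depends_only_on_def by (auto simp: inner_add_left)
  qed
  then show "p' b x = 0"
    using partial_derivatives_direction[OF p(1) b, of x] by (auto intro: DERIV_unique)
qed

text \<open>On \<open>Y\<close> the coordinates in \<open>B\<close> control all the others, that is,
  \<open>Y\<close> is the graph of a Lipschitz map over its projection. The inequality expresses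
  this without naming the map or its domain.\<close>

definition lipschitz_over :: "'a::euclidean_space set \<Rightarrow> 'a set \<Rightarrow> bool" where
  "lipschitz_over B Y \<longleftrightarrow> (\<exists>L. \<forall>y\<in>Y. \<forall>z\<in>Y. norm (y - z) \<le> L * (\<Sum>b\<in>B. \<bar>(y - z) \<bullet> b\<bar>))"

text \<open>A Lipschitz form of the implicit function theorem that works for an arbitrary subset of
  the zero set: by the mean value theorem along the segment between two zeros, the difference in
  coordinate \<open>c\<close> is bounded by the differences in the other coordinates of
  \<open>B\<close>.\<close>

lemma lipschitz_over_local:
  fixes P :: "'a::euclidean_space \<Rightarrow> real"
  assumes B: "B \<subseteq> Basis" "c \<in> B" and Y: "\<And>y. y \<in> Y \<Longrightarrow> P y = 0" "lipschitz_over B Y"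
    and P: "partial_derivatives P P'" "depends_only_on B P"
    and cont: "\<And>b x. b \<in> Basis \<Longrightarrow> isCont (P' b) x"
    and x: "P' c x \<noteq> 0"
  shows "\<exists>U. open U \<and> x \<in> U \<and> lipschitz_over (B - {c}) (Y \<inter> U)"
proof -
  have finB: "finite B" using B(1) finite_Basis finite_subset by blast
  have c: "c \<in> Basis" using B by blast
  define \<delta> where "\<delta> = \<bar>P' c x\<bar> / 2"
  define M where "M = (\<Sum>b\<in>B. \<bar>P' b x\<bar> + 1)"
  have \<delta>: "\<delta> > 0" "\<delta> < \<bar>P' c x\<bar>" using x by (auto simp: \<delta>_def)
  have M: "\<bar>P' b x\<bar> + 1 \<le> M" if "b \<in> B" for b
    unfolding M_def using finB that by (intro member_le_sum) auto
  have tend: "((\<lambda>y. \<bar>P' b y\<bar>) \<longlongrightarrow> \<bar>P' b x\<bar>) (nhds x)" if "b \<in> Basis" for b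
    using cont[OF that] by (intro tendsto_rabs) (simp add: continuous_at tendsto_nhds_iff)
  have "\<forall>\<^sub>F y in nhds x. \<delta> < \<bar>P' c y\<bar> \<and> (\<forall>b\<in>B. \<bar>P' b y\<bar> < \<bar>P' b x\<bar> + 1)"
    using finB B
    by (intro eventually_conj eventually_ball_finite ballI order_tendstoD(1)[OF tend[OF c] \<delta>(2)]
        order_tendstoD(2)[OF tend]) auto
  then obtain r where r: "r > 0" "\<And>y. dist y x < r \<Longrightarrow> \<delta> < \<bar>P' c y\<bar>"
    "\<And>y b. dist y x < r \<Longrightarrow> b \<in> B \<Longrightarrow> \<bar>P' b y\<bar> < \<bar>P' b x\<bar> + 1"
    unfolding eventually_nhds_metric by blast
  obtain L where L: "\<And>y z. y \<in> Y \<Longrightarrow> z \<in> Y \<Longrightarrow> norm (y - z) \<le> L * (\<Sum>b\<in>B. \<bar>(y - z) \<bullet> b\<bar>)"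
    using Y(2) unfolding lipschitz_over_def by blast
  have "norm (y - z) \<le> (\<bar>L\<bar> * (M / \<delta> + 1)) * (\<Sum>b\<in>B - {c}. \<bar>(y - z) \<bullet> b\<bar>)"
    if yz: "y \<in> Y \<inter> ball x r" "z \<in> Y \<inter> ball x r" for y z
  proof -
    let ?v = "y - z" and ?S = "\<Sum>b\<in>B - {c}. \<bar>(y - z) \<bullet> b\<bar>"
    \<comment> \<open>The intermediate point need not lie in \<open>Y\<close>. It lies in the ball
      by convexity, and the bounds on the partial derivatives hold on the whole ball.\<close>
    obtain t where t: "0 < t" "t < 1"
      "P (z + 1 *\<^sub>R ?v) - P (z + 0 *\<^sub>R ?v) = (1 - 0) * (\<Sum>b\<in>Basis. (?v \<bullet> b) * P' b (z + t *\<^sub>R ?v))"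
      using MVT2[of 0 1 "\<lambda>t. P (z + t *\<^sub>R ?v)", OF zero_less_one partial_derivatives_on_line[OF P(1)]]
      by blast
    define w where "w = z + t *\<^sub>R ?v"
    have "w = (1 - t) *\<^sub>R z + t *\<^sub>R y" by (simp add: w_def algebra_simps)
    then have "w \<in> ball x r"
      using yz t convexD[OF convex_ball[of x r], of z y "1 - t" t] by simp
    then have w: "dist w x < r" by (simp add: dist_commute)
    have "P (z + 1 *\<^sub>R ?v) - P (z + 0 *\<^sub>R ?v) = 0" using Y(1) yz by simp
    then have "0 = (\<Sum>b\<in>Basis. (?v \<bullet> b) * P' b w)" using t(3) w_def by simp
    also have "\<dots> = (\<Sum>b\<in>B. (?v \<bullet> b) * P' b w)"
      using B(1) depends_only_on_derivatives(2)[OF P _ B(1)]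
      by (intro sum.mono_neutral_right) auto
    also have "\<dots> = (?v \<bullet> c) * P' c w + (\<Sum>b\<in>B - {c}. (?v \<bullet> b) * P' b w)"
      using B(2) finB by (simp add: sum.remove)
    finally have "\<bar>?v \<bullet> c\<bar> * \<bar>P' c w\<bar> = \<bar>\<Sum>b\<in>B - {c}. (?v \<bullet> b) * P' b w\<bar>"
      by (simp add: abs_mult[symmetric] add_eq_0_iff)
    also have "\<dots> \<le> (\<Sum>b\<in>B - {c}. M * \<bar>?v \<bullet> b\<bar>)"
    proof (intro order_trans[OF sum_abs] sum_mono)
      fix b assume b: "b \<in> B - {c}"
      have "\<bar>P' b w\<bar> \<le> M" using r(3)[OF w, of b] M[of b] b by simp
      then show "\<bar>(?v \<bullet> b) * P' b w\<bar> \<le> M * \<bar>?v \<bullet> b\<bar>"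
        by (simp add: abs_mult mult.commute mult_right_mono)
    qed
    finally have "\<bar>?v \<bullet> c\<bar> * \<bar>P' c w\<bar> \<le> M * ?S" by (simp add: sum_distrib_left)
    moreover have "\<bar>?v \<bullet> c\<bar> * \<delta> \<le> \<bar>?v \<bullet> c\<bar> * \<bar>P' c w\<bar>"
      using r(2)[OF w] by (intro mult_left_mono) auto
    ultimately have "\<bar>?v \<bullet> c\<bar> * \<delta> \<le> M * ?S" by linarith
    then have vc: "\<bar>?v \<bullet> c\<bar> \<le> M / \<delta> * ?S" using \<delta>(1) by (simp add: field_simps)
    have "norm ?v \<le> L * (\<Sum>b\<in>B. \<bar>?v \<bullet> b\<bar>)" using L yz by blast
    also have "\<dots> \<le> \<bar>L\<bar> * (\<Sum>b\<in>B. \<bar>?v \<bullet> b\<bar>)" by (intro mult_right_mono sum_nonneg) auto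
    also have "(\<Sum>b\<in>B. \<bar>?v \<bullet> b\<bar>) = \<bar>?v \<bullet> c\<bar> + ?S" using B(2) finB by (simp add: sum.remove)
    also have "\<bar>L\<bar> * (\<bar>?v \<bullet> c\<bar> + ?S) \<le> \<bar>L\<bar> * (M / \<delta> * ?S + ?S)"
      using vc by (intro mult_left_mono) auto
    finally show ?thesis by (simp add: algebra_simps)
  qed
  then have "lipschitz_over (B - {c}) (Y \<inter> ball x r)" unfolding lipschitz_over_def by blast
  then show ?thesis using r(1) by (intro exI[of _ "ball x r"]) auto
qed

text \<open>Choose \<open>b\<close> in \<open>B\<close> with \<open>P' b\<close> not identically
  zero. Where it is nonzero the local statement applies, and Lindelof's theorem reduces the
  neighbourhoods to countably many. The rest of \<open>Y\<close> lies in the zero set of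
  \<open>P' b\<close>, whose degree bound is smaller. If there is no such \<open>b\<close>, then
  \<open>P\<close> is a nonzero constant and \<open>Y\<close> is empty.\<close>

lemma lipschitz_over_drop_coordinate:
  fixes P :: "'a::euclidean_space \<Rightarrow> real"
  assumes "polynomial_degree_le n P" "\<exists>x. P x \<noteq> 0" "depends_only_on B P" "B \<subseteq> Basis"
    and "\<And>y. y \<in> Y \<Longrightarrow> P y = 0" "lipschitz_over B Y"
  shows "\<exists>\<Y>. countable \<Y> \<and> Y \<subseteq> \<Union>\<Y> \<and> (\<forall>Z\<in>\<Y>. Z \<subseteq> Y \<and> (\<exists>c\<in>B. lipschitz_over (B - {c}) Z))"
  using assms
proof (induction n arbitrary: P Y rule: less_induct)
  case (less n)
  obtain P' where P': "partial_derivatives P P'" "\<And>b. n = 0 \<Longrightarrow> P' b = (\<lambda>x. 0)"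
    "\<And>b. polynomial_degree_le (n - 1) (P' b)"
    using polynomial_degree_le_derivatives[OF less.prems(1)] by blast
  have finB: "finite B" using less.prems(4) finite_Basis finite_subset by blast
  have cont: "isCont (P' b) x" for b x
    using P'(3) polynomial_degree_le_imp_real_polynomial_function continuous_real_polymonial_function
    by blast
  have dep: "depends_only_on B (P' b)" if "b \<in> B" for b
    using depends_only_on_derivatives(1)[OF P'(1) less.prems(3) _ less.prems(4)] that less.prems(4) by blast
  have "\<exists>\<Y>. countable \<Y> \<and> {y\<in>Y. P' c y \<noteq> 0} \<subseteq> \<Union>\<Y> \<and>
      (\<forall>Z\<in>\<Y>. Z \<subseteq> Y \<and> lipschitz_over (B - {c}) Z)" if "c \<in> B" for c
  proof -
    define \<F> where "\<F> = {U. open U \<and> lipschitz_over (B - {c}) (Y \<inter> U)}"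
    obtain \<F>' where F': "\<F>' \<subseteq> \<F>" "countable \<F>'" "\<Union>\<F>' = \<Union>\<F>"
      using Lindelof[of \<F>] unfolding \<F>_def by blast
    have "{y\<in>Y. P' c y \<noteq> 0} \<subseteq> \<Union>\<F>"
      using lipschitz_over_local[OF less.prems(4) that less.prems(5,6) P'(1) less.prems(3) cont]
      unfolding \<F>_def by blast
    then have "{y\<in>Y. P' c y \<noteq> 0} \<subseteq> \<Union>((\<inter>) Y ` \<F>')" using F'(3) by blast
    then show ?thesis using F'(1,2)
      by (intro exI[of _ "(\<inter>) Y ` \<F>'"]) (auto simp: \<F>_def)
  qed
  then obtain \<G> where G: "\<And>c. c \<in> B \<Longrightarrow> countable (\<G> c)" "\<And>c. c \<in> B \<Longrightarrow> {y\<in>Y. P' c y \<noteq> 0} \<subseteq> \<Union>(\<G> c)"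
    "\<And>c Z. c \<in> B \<Longrightarrow> Z \<in> \<G> c \<Longrightarrow> Z \<subseteq> Y \<and> lipschitz_over (B - {c}) Z" by metis
  show ?case
  proof (cases "\<exists>b\<in>B. \<exists>x. P' b x \<noteq> 0")
    case False
    have zero: "(\<Sum>b\<in>Basis. (h \<bullet> b) * P' b x) = 0" for h x
      using False depends_only_on_derivatives(2)[OF P'(1) less.prems(3) _ less.prems(4)]
      by (intro sum.neutral) auto
    then have "(P has_derivative (\<lambda>h. 0)) (at x within UNIV)" for x
      using P'(1) unfolding partial_derivatives_def by simp
    then obtain c where "\<And>x. P x = c"
      using has_derivative_zero_constant[of UNIV P] by auto
    then have "Y = {}" using less.prems(2,5) by auto
    then show ?thesis by (intro exI[of _ "{}"]) auto
  next
    case True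
    then obtain b where b: "b \<in> B" "\<exists>x. P' b x \<noteq> 0" by blast
    then have "n - 1 < n" using P'(2) by (cases n) auto
    define Y0 where "Y0 = {y\<in>Y. P' b y = 0}"
    have "lipschitz_over B Y0" using less.prems(6) unfolding lipschitz_over_def Y0_def by blast
    then obtain \<H> where H: "countable \<H>" "Y0 \<subseteq> \<Union>\<H>"
      "\<And>Z. Z \<in> \<H> \<Longrightarrow> Z \<subseteq> Y0 \<and> (\<exists>c\<in>B. lipschitz_over (B - {c}) Z)"
      using less.IH[OF \<open>n - 1 < n\<close> P'(3) b(2) dep[OF b(1)] less.prems(4), of Y0]
      by (auto simp: Y0_def)
    show ?thesis
    proof (intro exI[of _ "\<H> \<union> \<G> b"] conjI ballI)
      show "Y \<subseteq> \<Union>(\<H> \<union> \<G> b)" using H(2) G(2)[OF b(1)] by (auto simp: Y0_def)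
    next
      fix Z assume "Z \<in> \<H> \<union> \<G> b"
      then show "Z \<subseteq> Y" "\<exists>c\<in>B. lipschitz_over (B - {c}) Z"
        using H(3) G(3)[OF b(1)] b(1) unfolding Y0_def by blast+
    qed (use H(1) G(1) b(1) in auto)
  qed
qed

text \<open>Starting from \<open>Basis\<close>, over which every set is Lipschitz, coordinates are
  dropped as long as there are more of them than the dimension; each drop splits a piece into
  countably many. The \<open>max 0\<close> accounts for the empty set, whose dimension is
  -1.\<close>

lemma semialgebraic_lipschitz_cover:
  fixes X :: "'a::euclidean_space set"
  assumes X: "closed X" "semialgebraic X"
  shows "\<exists>\<Y>. countable \<Y> \<and> X \<subseteq> \<Union>\<Y> \<and>
    (\<forall>Z\<in>\<Y>. Z \<subseteq> X \<and> (\<exists>B\<subseteq>Basis. int (card B) \<le> max 0 (semialgebraic_dim X) \<and> lipschitz_over B Z))"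
proof -
  have "\<exists>\<Y>. countable \<Y> \<and> Y \<subseteq> \<Union>\<Y> \<and>
    (\<forall>Z\<in>\<Y>. Z \<subseteq> X \<and> (\<exists>B\<subseteq>Basis. int (card B) \<le> max 0 (semialgebraic_dim X) \<and> lipschitz_over B Z))"
    if "Y \<subseteq> X" "B \<subseteq> Basis" "card B = j" "lipschitz_over B Y" for j B Y
    using that
  proof (induction j arbitrary: B Y)
    case 0
    then show ?case by (intro exI[of _ "{Y}"]) auto
  next
    case (Suc j)
    show ?case
    proof (cases "int (card B) \<le> max 0 (semialgebraic_dim X)")
      case True
      then show ?thesis using Suc.prems by (intro exI[of _ "{Y}"]) auto
    next
      case False
      then have "int (card B) > semialgebraic_dim X" by simp
      then obtain P where P: "real_polynomial_function P" "\<exists>x. P x \<noteq> 0" "\<forall>x\<in>X. P x = 0" "depends_only_on B P"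
        using vanishing_polynomial_in_coordinates[OF X Suc.prems(2)] by blast
      obtain n where n: "polynomial_degree_le n P" using real_polynomial_function_degree[OF P(1)] by blast
      have "\<exists>\<Y>. countable \<Y> \<and> Y \<subseteq> \<Union>\<Y> \<and> (\<forall>Z\<in>\<Y>. Z \<subseteq> Y \<and> (\<exists>c\<in>B. lipschitz_over (B - {c}) Z))"
        using lipschitz_over_drop_coordinate[OF n P(2,4) Suc.prems(2) _ Suc.prems(4)] P(3) Suc.prems(1)
        by blast
      then obtain \<Y> where Y: "countable \<Y>" "Y \<subseteq> \<Union>\<Y>"
        "\<And>Z. Z \<in> \<Y> \<Longrightarrow> Z \<subseteq> Y \<and> (\<exists>c\<in>B. lipschitz_over (B - {c}) Z)" by blast
      have "\<exists>\<Z>. countable \<Z> \<and> Z \<subseteq> \<Union>\<Z> \<and> (\<forall>W\<in>\<Z>. W \<subseteq> X \<and> (\<exists>B\<subseteq>Basis.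
          int (card B) \<le> max 0 (semialgebraic_dim X) \<and> lipschitz_over B W))" if "Z \<in> \<Y>" for Z
      proof -
        obtain c where c: "c \<in> B" "lipschitz_over (B - {c}) Z"
          using Y(3)[OF \<open>Z \<in> \<Y>\<close>] by blast
        have "card (B - {c}) = j" using c(1) Suc.prems(3) by (simp add: card_Diff_singleton)
        then show ?thesis
          using Suc.IH[of Z "B - {c}"] c(2) Y(3)[OF that] Suc.prems(1,2) by blast
      qed
      then obtain \<Z> where Z: "\<And>Z. Z \<in> \<Y> \<Longrightarrow> countable (\<Z> Z)" "\<And>Z. Z \<in> \<Y> \<Longrightarrow> Z \<subseteq> \<Union>(\<Z> Z)"
        "\<And>Z W. Z \<in> \<Y> \<Longrightarrow> W \<in> \<Z> Z \<Longrightarrow> W \<subseteq> X \<and> (\<exists>B\<subseteq>Basis.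
          int (card B) \<le> max 0 (semialgebraic_dim X) \<and> lipschitz_over B W)" by metis
      show ?thesis
      proof (intro exI[of _ "\<Union>Z\<in>\<Y>. \<Z> Z"] conjI)
        show "countable (\<Union>Z\<in>\<Y>. \<Z> Z)" using Y(1) Z(1) by blast
        show "Y \<subseteq> \<Union>(\<Union>Z\<in>\<Y>. \<Z> Z)" using Y(2) Z(2) by blast
      qed (use Z(3) in blast)
    qed
  qed
  moreover have "lipschitz_over Basis X"
    unfolding lipschitz_over_def by (intro exI[of _ 1]) (auto intro: norm_le_l1)
  ultimately show ?thesis by blast
qed

section \<open>Generic linear forms\<close>

text \<open>Only increments from the fixed point \<open>x\<close> are bounded, with a constant that
  may depend on \<open>x\<close>. This is all that is required for images of null sets to be null,
  and unlike a global bound it survives products of unbounded maps.\<close>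

definition lipschitz_at :: "'a::real_normed_vector set \<Rightarrow> ('a \<Rightarrow> 'b::real_normed_vector) \<Rightarrow> 'a \<Rightarrow> bool" where
  "lipschitz_at S f x \<longleftrightarrow> (\<exists>K. \<forall>y\<in>S. norm (y - x) < 1 \<longrightarrow> norm (f y - f x) \<le> K * norm (y - x))"

lemma lipschitz_atE:
  assumes "lipschitz_at S f x"
  obtains K where "K \<ge> 0" "\<And>y. y \<in> S \<Longrightarrow> norm (y - x) < 1 \<Longrightarrow> norm (f y - f x) \<le> K * norm (y - x)"
proof -
  obtain K where K: "\<And>y. y \<in> S \<Longrightarrow> norm (y - x) < 1 \<Longrightarrow> norm (f y - f x) \<le> K * norm (y - x)"
    using assms unfolding lipschitz_at_def by blast
  have "norm (f y - f x) \<le> \<bar>K\<bar> * norm (y - x)" if "y \<in> S" "norm (y - x) < 1" for y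
    using K[OF that] by (meson abs_ge_self mult_right_mono norm_ge_zero order_trans)
  then show thesis using that[of "\<bar>K\<bar>"] by simp
qed

lemma lipschitz_atI:
  "(\<And>y. y \<in> S \<Longrightarrow> norm (y - x) < 1 \<Longrightarrow> norm (f y - f x) \<le> K * norm (y - x)) \<Longrightarrow> lipschitz_at S f x"
  unfolding lipschitz_at_def by blast

lemma lipschitz_at_bounded_linear:
  assumes "bounded_linear f"
  shows "lipschitz_at S f x"
proof -
  interpret bounded_linear f by fact
  obtain K where "\<And>x. norm (f x) \<le> norm x * K" using bounded by blast
  then show ?thesis by (intro lipschitz_atI[of _ _ _ K]) (simp add: diff[symmetric] mult.commute)
qed

lemma lipschitz_at_const: "lipschitz_at S (\<lambda>x. c) x"
  by (intro lipschitz_atI[of _ _ _ 0]) simp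

lemma lipschitz_at_diff:
  assumes "lipschitz_at S f x" "lipschitz_at S g x"
  shows "lipschitz_at S (\<lambda>x. f x - g x) x"
proof -
  obtain K M where K: "\<And>y. y \<in> S \<Longrightarrow> norm (y - x) < 1 \<Longrightarrow> norm (f y - f x) \<le> K * norm (y - x)"
    "\<And>y. y \<in> S \<Longrightarrow> norm (y - x) < 1 \<Longrightarrow> norm (g y - g x) \<le> M * norm (y - x)"
    using assms unfolding lipschitz_at_def by blast
  show ?thesis
  proof (rule lipschitz_atI[of _ _ _ "K + M"])
    fix y assume y: "y \<in> S" "norm (y - x) < 1"
    have "norm (f y - g y - (f x - g x)) \<le> norm (f y - f x) + norm (g y - g x)"
      using norm_triangle_ineq4[of "f y - f x" "g y - g x"] by (simp add: algebra_simps)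
    then show "norm (f y - g y - (f x - g x)) \<le> (K + M) * norm (y - x)"
      using K(1)[OF y] K(2)[OF y] by (simp add: distrib_right)
  qed
qed

lemma (in bounded_bilinear) lipschitz_at:
  assumes "lipschitz_at S f x" "lipschitz_at S g x"
  shows "lipschitz_at S (\<lambda>x. prod (f x) (g x)) x"
proof -
  obtain K where K: "K \<ge> 0" "\<And>y. y \<in> S \<Longrightarrow> norm (y - x) < 1 \<Longrightarrow> norm (f y - f x) \<le> K * norm (y - x)"
    using lipschitz_atE[OF assms(1)] by blast
  obtain M where M: "M \<ge> 0" "\<And>y. y \<in> S \<Longrightarrow> norm (y - x) < 1 \<Longrightarrow> norm (g y - g x) \<le> M * norm (y - x)"
    using lipschitz_atE[OF assms(2)] by blast
  obtain C where C: "C \<ge> 0" "\<And>a b. norm (prod a b) \<le> norm a * norm b * C"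
    using nonneg_bounded by blast
  show ?thesis
  proof (rule lipschitz_atI[of _ _ _ "K * (norm (g x) + M) * C + norm (f x) * M * C"])
    fix y assume y: "y \<in> S" "norm (y - x) < 1"
    have "M * norm (y - x) \<le> M * 1" using y(2) M(1) by (intro mult_left_mono) auto
    then have gy: "norm (g y) \<le> norm (g x) + M"
      using M(2)[OF y] norm_triangle_sub[of "g y" "g x"] by simp
    have "prod (f y) (g y) - prod (f x) (g x) = prod (f y - f x) (g y) + prod (f x) (g y - g x)"
      by (simp add: diff_left diff_right)
    also have "norm \<dots> \<le> norm (f y - f x) * norm (g y) * C + norm (f x) * norm (g y - g x) * C"
      by (intro norm_triangle_le add_mono C)
    also have "\<dots> \<le> (K * norm (y - x)) * (norm (g x) + M) * C + norm (f x) * (M * norm (y - x)) * C"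
      using K(2)[OF y] M(2)[OF y] gy K(1) C(1)
      by (intro add_mono mult_right_mono mult_mono mult_left_mono) auto
    finally show "norm (prod (f y) (g y) - prod (f x) (g x)) \<le>
        (K * (norm (g x) + M) * C + norm (f x) * M * C) * norm (y - x)"
      by (simp add: algebra_simps)
  qed
qed

lemma lipschitz_at_vec:
  fixes f :: "'a::real_normed_vector \<Rightarrow> 'b::euclidean_space ^ 'n"
  assumes "\<And>i. lipschitz_at S (\<lambda>x. f x $ i) x"
  shows "lipschitz_at S f x"
proof -
  obtain K where K: "\<And>i y. y \<in> S \<Longrightarrow> norm (y - x) < 1 \<Longrightarrow> norm (f y $ i - f x $ i) \<le> K i * norm (y - x)"
    using assms unfolding lipschitz_at_def by metis
  show ?thesis
  proof (rule lipschitz_atI[of _ _ _ "\<Sum>i\<in>UNIV. K i"])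
    fix y assume y: "y \<in> S" "norm (y - x) < 1"
    have "norm (f y - f x) \<le> (\<Sum>i\<in>UNIV. norm ((f y - f x) $ i))"
      by (simp add: norm_vec_def L2_set_le_sum)
    also have "\<dots> \<le> (\<Sum>i\<in>UNIV. K i * norm (y - x))" using K[OF y] by (intro sum_mono) simp
    finally show "norm (f y - f x) \<le> (\<Sum>i\<in>UNIV. K i) * norm (y - x)" by (simp add: sum_distrib_right)
  qed
qed

text \<open>The indices in \<open>I\<close> are slots for real parameters: those of the first point
  go to \<open>\<iota>\<close> B\<open>, those of the second to\<close>\<kappa> \<open>C\<close>.
  The strict inequality leaves an empty slot \<open>j\<close>, which is what will produce a null
  set.\<close>

lemma disjoint_injections:
  assumes "finite B" "finite C" "finite I" "card B + card C < card I"
  shows "\<exists>\<iota> \<kappa> j. inj_on \<iota> B \<and> inj_on \<kappa> C \<and> \<iota> ` B \<subseteq> I \<and> \<kappa> ` C \<subseteq> I \<and> \<iota> ` B \<inter> \<kappa> ` C = {} \<and>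
    j \<in> I \<and> j \<notin> \<iota> ` B \<and> j \<notin> \<kappa> ` C"
proof -
  obtain \<iota> where i: "\<iota> ` B \<subseteq> I" "inj_on \<iota> B"
    using card_le_inj[OF assms(1,3)] assms(4) by auto
  have c: "card (I - \<iota> ` B) = card I - card B"
    using i assms by (simp add: card_Diff_subset card_image)
  obtain \<kappa> where k: "\<kappa> ` C \<subseteq> I - \<iota> ` B" "inj_on \<kappa> C"
  proof -
    have "card C \<le> card (I - \<iota> ` B)" using c assms(4) by linarith
    then show thesis using card_le_inj[of C "I - \<iota> ` B"] assms(2,3) that by auto
  qed
  have "card (I - \<iota> ` B - \<kappa> ` C) = card I - card B - card C"
    using c k assms by (simp add: card_Diff_subset card_image)
  then have "I - \<iota> ` B - \<kappa> ` C \<noteq> {}" using assms(4) by force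
  then show ?thesis using i k by blast
qed

lemma lipschitz_over_eqI:
  assumes "lipschitz_over B Y" "p \<in> Y" "q \<in> Y" "\<And>b. b \<in> B \<Longrightarrow> p \<bullet> b = q \<bullet> b"
  shows "p = q"
proof -
  obtain L where "norm (p - q) \<le> L * (\<Sum>b\<in>B. \<bar>(p - q) \<bullet> b\<bar>)"
    using assms(1-3) unfolding lipschitz_over_def by blast
  then show ?thesis using assms(4) by (simp add: inner_diff_left)
qed

text \<open>Here \<open>x \<gamma>\<close> is the point of \<open>Y\<close> whose
  \<open>B\<close>-coordinates are stored in the components of \<open>\<gamma>\<close> along
  \<open>e\<close>. It varies in a Lipschitz way with them because \<open>Y\<close> is Lipschitz
  over \<open>B\<close>.\<close>

lemma lipschitz_at_parametrized:
  fixes \<iota> :: "'a::euclidean_space \<Rightarrow> 'n::finite" and e :: "'n \<Rightarrow> 'e::euclidean_space"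
  assumes Y: "lipschitz_over B Y" and v: "M-lipschitz_on Y v" and e: "\<And>j. e j \<in> Basis"
    and x: "\<And>\<gamma>. \<gamma> \<in> S \<Longrightarrow> x \<gamma> \<in> Y \<and> (\<forall>b\<in>B. x \<gamma> \<bullet> b = \<gamma> $ \<iota> b \<bullet> e (\<iota> b))" and \<beta>: "\<beta> \<in> S"
  shows "lipschitz_at S (\<lambda>\<gamma>. v (x \<gamma>)) \<beta>"
proof -
  obtain L where L: "\<And>p q. p \<in> Y \<Longrightarrow> q \<in> Y \<Longrightarrow> norm (p - q) \<le> L * (\<Sum>b\<in>B. \<bar>(p - q) \<bullet> b\<bar>)"
    using Y unfolding lipschitz_over_def by blast
  show ?thesis
  proof (rule lipschitz_atI[of _ _ _ "M * (\<bar>L\<bar> * card B)"])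
    fix \<gamma> assume \<gamma>: "\<gamma> \<in> S"
    have comp: "\<bar>(x \<gamma> - x \<beta>) \<bullet> b\<bar> \<le> norm (\<gamma> - \<beta>)" if "b \<in> B" for b
    proof -
      have "\<bar>(\<gamma> - \<beta>) $ \<iota> b \<bullet> e (\<iota> b)\<bar> \<le> norm ((\<gamma> - \<beta>) $ \<iota> b) * norm (e (\<iota> b))"
        by (rule Cauchy_Schwarz_ineq2)
      also have "\<dots> \<le> norm (\<gamma> - \<beta>)"
        using e Finite_Cartesian_Product.norm_nth_le[of "\<gamma> - \<beta>" "\<iota> b"] by simp
      finally show ?thesis using x[OF \<gamma>] x[OF \<beta>] that by (simp add: inner_diff_left)
    qed
    have "norm (v (x \<gamma>) - v (x \<beta>)) \<le> M * norm (x \<gamma> - x \<beta>)"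
      using lipschitz_onD[OF v] x[OF \<gamma>] x[OF \<beta>] by (simp add: dist_norm)
    also have "norm (x \<gamma> - x \<beta>) \<le> L * (\<Sum>b\<in>B. \<bar>(x \<gamma> - x \<beta>) \<bullet> b\<bar>)"
      using L x[OF \<gamma>] x[OF \<beta>] by blast
    also have "\<dots> \<le> \<bar>L\<bar> * (\<Sum>b\<in>B. \<bar>(x \<gamma> - x \<beta>) \<bullet> b\<bar>)" by (intro mult_right_mono sum_nonneg) auto
    also have "\<dots> \<le> \<bar>L\<bar> * (\<Sum>b\<in>B. norm (\<gamma> - \<beta>))" by (intro mult_left_mono sum_mono comp) auto
    finally show "norm (v (x \<gamma>) - v (x \<beta>)) \<le> M * (\<bar>L\<bar> * card B) * norm (\<gamma> - \<beta>)"
      using lipschitz_on_nonneg[OF v] by (simp add: mult_left_mono mult.assoc)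
  qed
qed

text \<open>A vector \<open>a\<close> orthogonal to \<open>w\<close> with \<open>w \<bullet> e \<noteq> 0\<close> is \<open>(w \<bullet> e) b - (b \<bullet> w) e\<close> for some \<open>b\<close>
  orthogonal to \<open>e\<close>. This leaves the \<open>e\<close>-coordinate of \<open>b\<close> free, and the fewer than \<open>card I\<close>
  parameters of the pair \<open>(x, y)\<close> are stored in those free coordinates.\<close>

lemma negligible_orthogonal_tuples:
  fixes u :: "'n::finite \<Rightarrow> 'a::euclidean_space \<Rightarrow> 'e::euclidean_space"
  assumes Y: "lipschitz_over B Y" "B \<subseteq> Basis" and Z: "lipschitz_over C Z" "C \<subseteq> Basis"
    and card: "card B + card C < card I"
    and uY: "\<And>j. j \<in> I \<Longrightarrow> \<exists>L. L-lipschitz_on Y (u j)" and uZ: "\<And>j. j \<in> I \<Longrightarrow> \<exists>L. L-lipschitz_on Z (u j)"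
    and e: "\<And>j. e j \<in> Basis"
  shows "negligible {a :: 'e ^ 'n. \<exists>x\<in>Y. \<exists>y\<in>Z. \<forall>j\<in>I.
    a $ j \<bullet> (u j x - u j y) = 0 \<and> (u j x - u j y) \<bullet> e j \<noteq> 0}" (is "negligible ?A")
proof -
  have fin: "finite B" "finite C" using Y(2) Z(2) finite_Basis finite_subset by blast+
  obtain \<iota> \<kappa> j0 where inj: "inj_on \<iota> B" "inj_on \<kappa> C" "\<iota> ` B \<subseteq> I" "\<kappa> ` C \<subseteq> I" "\<iota> ` B \<inter> \<kappa> ` C = {}"
    and j0: "j0 \<in> I" "j0 \<notin> \<iota> ` B" "j0 \<notin> \<kappa> ` C"
    using disjoint_injections[OF fin _ card] by (metis finite_class.finite_UNIV finite_subset subset_UNIV)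
  define isx where "isx \<beta> x \<longleftrightarrow> x \<in> Y \<and> (\<forall>b\<in>B. x \<bullet> b = \<beta> $ \<iota> b \<bullet> e (\<iota> b))" for \<beta> :: "'e ^ 'n" and x
  define isy where "isy \<beta> y \<longleftrightarrow> y \<in> Z \<and> (\<forall>b\<in>C. y \<bullet> b = \<beta> $ \<kappa> b \<bullet> e (\<kappa> b))" for \<beta> :: "'e ^ 'n" and y
  \<comment> \<open>Slot \<open>j0\<close> stores no parameter, so its free coordinate is set to 0.
    This confines the codes to a hyperplane, which is null, and the locally Lipschitz map
    \<open>\<Psi>\<close> carries null sets to null sets.\<close>
  define S where "S = {\<beta>. \<beta> $ j0 \<bullet> e j0 = 0 \<and> (\<exists>x. isx \<beta> x) \<and> (\<exists>y. isy \<beta> y)}"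
  define x where "x \<beta> = (SOME x. isx \<beta> x)" for \<beta>
  define y where "y \<beta> = (SOME y. isy \<beta> y)" for \<beta>
  have x: "isx \<beta> (x \<beta>)" and y: "isy \<beta> (y \<beta>)" if "\<beta> \<in> S" for \<beta>
    using that unfolding S_def x_def y_def by (auto intro: someI_ex)
  define w where "w j \<beta> = u j (x \<beta>) - u j (y \<beta>)" for j \<beta>
  define proj where "proj j \<beta> = \<beta> $ j - (\<beta> $ j \<bullet> e j) *\<^sub>R e j" for j and \<beta> :: "'e ^ 'n"
  \<comment> \<open>Decoding: the stored parameters give the points, hence the secants
    \<open>w j\<close>. Removing the free coordinate from slot j leaves \<open>b\<close>, from which
    the vector orthogonal to \<open>w j\<close> is rebuilt. Slots outside \<open>I\<close> are
    copied.\<close>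
  define \<Psi> :: "'e ^ 'n \<Rightarrow> 'e ^ 'n" where
    "\<Psi> \<beta> = (\<chi> j. if j \<in> I then (w j \<beta> \<bullet> e j) *\<^sub>R proj j \<beta> - (proj j \<beta> \<bullet> w j \<beta>) *\<^sub>R e j else \<beta> $ j)" for \<beta>
  have lipu: "lipschitz_at S (w j) \<beta>" if j: "j \<in> I" and \<beta>: "\<beta> \<in> S" for j \<beta>
  proof -
    obtain M N where M: "M-lipschitz_on Y (u j)" "N-lipschitz_on Z (u j)" using uY[OF j] uZ[OF j] by blast
    show ?thesis unfolding w_def
      using x y unfolding isx_def isy_def
      by (intro lipschitz_at_diff lipschitz_at_parametrized[OF Y(1) M(1) e _ \<beta>]
          lipschitz_at_parametrized[OF Z(1) M(2) e _ \<beta>]) auto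
  qed
  have nth: "lipschitz_at S (\<lambda>\<beta>. \<beta> $ j) \<beta>" for j and \<beta> :: "'e ^ 'n"
    by (rule lipschitz_at_bounded_linear[OF bounded_linear_vec_nth])
  have lipproj: "lipschitz_at S (proj j) \<beta>" for j \<beta> unfolding proj_def
    by (intro lipschitz_at_diff nth bounded_bilinear.lipschitz_at[OF bounded_bilinear_scaleR]
        bounded_bilinear.lipschitz_at[OF bounded_bilinear_inner] lipschitz_at_const)
  have lip: "lipschitz_at S \<Psi> \<beta>" if \<beta>: "\<beta> \<in> S" for \<beta>
  proof (rule lipschitz_at_vec)
    fix j
    show "lipschitz_at S (\<lambda>\<beta>. \<Psi> \<beta> $ j) \<beta>"
    proof (cases "j \<in> I")
      case True
      then show ?thesis unfolding \<Psi>_def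
        by (simp, intro lipschitz_at_diff bounded_bilinear.lipschitz_at[OF bounded_bilinear_scaleR]
          bounded_bilinear.lipschitz_at[OF bounded_bilinear_inner] lipschitz_at_const lipu[OF True \<beta>] lipproj)
    next
      case False
      then show ?thesis using nth by (simp add: \<Psi>_def)
    qed
  qed
  have "negligible {\<beta> :: 'e ^ 'n. axis j0 (e j0) \<bullet> \<beta> = 0}"
    using e[of j0] nonzero_Basis by (intro negligible_hyperplane) (auto simp: axis_eq_0_iff)
  then have negS: "negligible S"
    by (rule negligible_subset) (auto simp: S_def inner_axis inner_commute)
  have "negligible (\<Psi> ` S)"
  proof (rule negligible_locally_Lipschitz_image[OF _ negS])
    fix \<beta> assume "\<beta> \<in> S"
    then obtain K where "\<And>\<gamma>. \<gamma> \<in> S \<Longrightarrow> norm (\<gamma> - \<beta>) < 1 \<Longrightarrow> norm (\<Psi> \<gamma> - \<Psi> \<beta>) \<le> K * norm (\<gamma> - \<beta>)"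
      using lip unfolding lipschitz_at_def by blast
    then show "\<exists>T K. open T \<and> \<beta> \<in> T \<and> (\<forall>\<gamma>\<in>S \<inter> T. norm (\<Psi> \<gamma> - \<Psi> \<beta>) \<le> K * norm (\<gamma> - \<beta>))"
      by (intro exI[of _ "ball \<beta> 1"] exI[of _ K]) (auto simp: dist_norm norm_minus_commute)
  qed simp
  moreover have "?A \<subseteq> \<Psi> ` S"
  proof
    fix a assume "a \<in> ?A"
    then obtain p q where pq: "p \<in> Y" "q \<in> Z" "\<And>j. j \<in> I \<Longrightarrow> a $ j \<bullet> (u j p - u j q) = 0"
      "\<And>j. j \<in> I \<Longrightarrow> (u j p - u j q) \<bullet> e j \<noteq> 0" by blast
    \<comment> \<open>Encoding of a given tuple \<open>a\<close> with its pair of points: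
      \<open>c\<close> lists the parameters to be stored, with 0 in the empty slots, and
      \<open>b\<close> solves the equation for the vectors \<open>a $ j\<close>.\<close>
    define c where "c j = (if j \<in> \<iota> ` B then p \<bullet> inv_into B \<iota> j
      else if j \<in> \<kappa> ` C then q \<bullet> inv_into C \<kappa> j else 0)" for j
    define b where "b j = (a $ j - (a $ j \<bullet> e j) *\<^sub>R e j) /\<^sub>R ((u j p - u j q) \<bullet> e j)" for j
    define \<beta> :: "'e ^ 'n" where "\<beta> = (\<chi> j. if j \<in> I then b j + c j *\<^sub>R e j else a $ j)"
    have ee: "e j \<bullet> e j = 1" for j using e by (simp add: inner_same_Basis)
    have b0: "b j \<bullet> e j = 0" for j by (simp add: b_def inner_diff_left ee)
    have be: "\<beta> $ j \<bullet> e j = c j" if "j \<in> I" for j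
      using that b0 by (simp add: \<beta>_def inner_add_left ee)
    have p: "isx \<beta> p"
      unfolding isx_def
    proof (intro conjI ballI pq)
      fix b assume "b \<in> B"
      then show "p \<bullet> b = \<beta> $ \<iota> b \<bullet> e (\<iota> b)"
        using be[of "\<iota> b"] inj by (auto simp: c_def)
    qed
    have q: "isy \<beta> q"
      unfolding isy_def
    proof (intro conjI ballI pq)
      fix b assume "b \<in> C"
      moreover from this have "\<kappa> b \<notin> \<iota> ` B" using inj(5) by blast
      ultimately show "q \<bullet> b = \<beta> $ \<kappa> b \<bullet> e (\<kappa> b)"
        using be[of "\<kappa> b"] inj by (auto simp: c_def)
    qed
    have \<beta>: "\<beta> \<in> S" using be[OF j0(1)] j0 p q by (auto simp: S_def c_def)
    \<comment> \<open>Decoding returns the original point: within a Lipschitz graph the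
      \<open>B\<close>-coordinates determine it, so the choice in \<open>x\<close> has only one
      candidate.\<close>
    have "x \<beta> = p" using x[OF \<beta>] p by (intro lipschitz_over_eqI[OF Y(1)]) (auto simp: isx_def)
    moreover have "y \<beta> = q" using y[OF \<beta>] q by (intro lipschitz_over_eqI[OF Z(1)]) (auto simp: isy_def)
    ultimately have w: "w j \<beta> = u j p - u j q" for j by (simp add: w_def)
    have "\<Psi> \<beta> $ j = a $ j" for j
    proof (cases "j \<in> I")
      case True
      define v where "v = u j p - u j q"
      have v: "v \<bullet> e j \<noteq> 0" "a $ j \<bullet> v = 0" using pq(3,4)[OF True] by (auto simp: v_def)
      have "proj j \<beta> = b j" using True be[OF True] by (simp add: proj_def \<beta>_def)
      then have "\<Psi> \<beta> $ j = (v \<bullet> e j) *\<^sub>R b j - (b j \<bullet> v) *\<^sub>R e j"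
        using True by (simp add: \<Psi>_def w v_def)
      moreover have "(v \<bullet> e j) *\<^sub>R b j = a $ j - (a $ j \<bullet> e j) *\<^sub>R e j"
        using v by (simp add: b_def v_def[symmetric])
      moreover have "b j \<bullet> v = - (a $ j \<bullet> e j)"
        using v by (simp add: b_def v_def[symmetric] inner_diff_left inner_commute[of "e j"])
      ultimately show ?thesis by simp
    next
      case False
      then show ?thesis by (simp add: \<Psi>_def \<beta>_def)
    qed
    then have "a = \<Psi> \<beta>" by (simp add: vec_eq_iff)
    then show "a \<in> \<Psi> ` S" using \<beta> by blast
  qed
  ultimately show ?thesis by (rule negligible_subset)
qed

text \<open>Injectivity of \<open>u j\<close> makes each secant vector nonzero for distinct points,
  so some basis vector \<open>e j\<close> is not orthogonal to it. The bad tuples thus split over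
  countably many pairs of pieces and finitely many choices of \<open>e\<close>. A pair may use the
  same piece twice.\<close>

lemma negligible_kernel_tuples:
  fixes u :: "'n::finite \<Rightarrow> 'a::euclidean_space \<Rightarrow> 'e::euclidean_space"
  assumes X: "closed X" "semialgebraic X"
    and u: "\<And>j. j \<in> I \<Longrightarrow> \<exists>L. L-lipschitz_on X (u j)" "\<And>j. j \<in> I \<Longrightarrow> inj_on (u j) X"
    and card: "2 * max 0 (semialgebraic_dim X) < int (card I)"
  shows "negligible {a :: 'e ^ 'n. \<exists>x\<in>X. \<exists>y\<in>X. x \<noteq> y \<and> (\<forall>j\<in>I. a $ j \<bullet> (u j x - u j y) = 0)}"
    (is "negligible ?A")
proof -
  obtain \<Y> where \<Y>: "countable \<Y>" "X \<subseteq> \<Union>\<Y>" "\<And>Z. Z \<in> \<Y> \<Longrightarrow> Z \<subseteq> X"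
    "\<And>Z. Z \<in> \<Y> \<Longrightarrow> \<exists>B\<subseteq>Basis. int (card B) \<le> max 0 (semialgebraic_dim X) \<and> lipschitz_over B Z"
    using semialgebraic_lipschitz_cover[OF X] by metis
  define E where "E = (UNIV :: 'n set) \<rightarrow>\<^sub>E (Basis :: 'e set)"
  have "finite E" unfolding E_def by (intro finite_PiE) auto
  define A where "A Y Z e = {a :: 'e ^ 'n. \<exists>x\<in>Y. \<exists>y\<in>Z. \<forall>j\<in>I.
    a $ j \<bullet> (u j x - u j y) = 0 \<and> (u j x - u j y) \<bullet> e j \<noteq> 0}" for Y Z e
  have neg: "negligible (A Y Z e)" if YZ: "Y \<in> \<Y>" "Z \<in> \<Y>" and e: "e \<in> E" for Y Z e
  proof -
    obtain B where B: "B \<subseteq> Basis" "int (card B) \<le> max 0 (semialgebraic_dim X)" "lipschitz_over B Y"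
      using \<Y>(4)[OF YZ(1)] by blast
    obtain C where C: "C \<subseteq> Basis" "int (card C) \<le> max 0 (semialgebraic_dim X)" "lipschitz_over C Z"
      using \<Y>(4)[OF YZ(2)] by blast
    have "int (card B) + int (card C) < int (card I)" using B(2) C(2) card by linarith
    then have "card B + card C < card I" by linarith
    moreover have "\<exists>L. L-lipschitz_on W (u j)" if "j \<in> I" "W \<in> \<Y>" for j W
      using u(1)[OF that(1)] \<Y>(3)[OF that(2)] lipschitz_on_subset by blast
    ultimately show ?thesis
      using YZ e unfolding A_def
      by (intro negligible_orthogonal_tuples[OF B(3,1) C(3,1)]) (auto simp: E_def)
  qed
  have "countable ((\<lambda>(Y, Z, e). A Y Z e) ` (\<Y> \<times> \<Y> \<times> E))"
    using \<Y>(1) countable_finite[OF \<open>finite E\<close>] by (intro countable_image countable_SIGMA) auto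
  then have "negligible (\<Union>((\<lambda>(Y, Z, e). A Y Z e) ` (\<Y> \<times> \<Y> \<times> E)))"
    by (rule negligible_countable_Union) (auto intro: neg)
  moreover have "?A \<subseteq> \<Union>((\<lambda>(Y, Z, e). A Y Z e) ` (\<Y> \<times> \<Y> \<times> E))"
  proof
    fix a assume "a \<in> ?A"
    then obtain x y where xy: "x \<in> X" "y \<in> X" "x \<noteq> y" "\<And>j. j \<in> I \<Longrightarrow> a $ j \<bullet> (u j x - u j y) = 0"
      by blast
    have "\<exists>b\<in>Basis. j \<in> I \<longrightarrow> (u j x - u j y) \<bullet> b \<noteq> 0" for j
    proof (cases "j \<in> I")
      case True
      then have "u j x - u j y \<noteq> 0" using u(2)[OF True] xy by (auto dest: inj_onD)
      then show ?thesis by (metis euclidean_all_zero_iff)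
    qed (auto intro: SOME_Basis)
    then obtain e where e: "\<And>j. e j \<in> Basis" "\<And>j. j \<in> I \<Longrightarrow> (u j x - u j y) \<bullet> e j \<noteq> 0" by metis
    obtain Y Z where YZ: "Y \<in> \<Y>" "x \<in> Y" "Z \<in> \<Y>" "y \<in> Z" using \<Y>(2) xy by blast
    have "a \<in> A Y Z e" using YZ e(2) xy(4) unfolding A_def by blast
    moreover have "e \<in> E" using e(1) by (auto simp: E_def)
    ultimately show "a \<in> \<Union>((\<lambda>(Y, Z, e). A Y Z e) ` (\<Y> \<times> \<Y> \<times> E))"
      using YZ by (intro UnionI[of "A Y Z e"] image_eqI[of _ _ "(Y, Z, e)"]) auto
  qed
  ultimately show ?thesis by (rule negligible_subset)
qed

text \<open>The maps \<open>u j\<close> may differ so that mixed tuples of two embeddings are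
  covered; they share the lower bound \<open>c\<close>. Failure of injectivity of the forms is a
  first-order condition on the tuple, so the null set of such tuples is semialgebraic and lies in a
  hypersurface.\<close>

theorem generic_linear_forms_bilipschitz:
  fixes u :: "'n::finite \<Rightarrow> 'a::euclidean_space \<Rightarrow> 'e::euclidean_space"
  assumes X: "closed X" "semialgebraic X"
    and u: "\<And>j. j \<in> I \<Longrightarrow> semialgebraic_map_on X (u j)" "\<And>j. j \<in> I \<Longrightarrow> \<exists>L. L-lipschitz_on X (u j)"
    and low: "c > 0" "\<And>j x y. j \<in> I \<Longrightarrow> x \<in> X \<Longrightarrow> y \<in> X \<Longrightarrow> c * norm (x - y) \<le> norm (u j x - u j y)"
    and card: "2 * max 0 (semialgebraic_dim X) < int (card I)"
  shows "\<exists>P :: 'e ^ 'n \<Rightarrow> real. real_polynomial_function P \<and> (\<exists>a. P a \<noteq> 0) \<and>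
    (\<forall>a. P a \<noteq> 0 \<longrightarrow> (\<exists>K. \<forall>x\<in>X. \<forall>y\<in>X. norm (x - y) \<le> K * (\<Sum>j\<in>I. \<bar>a $ j \<bullet> (u j x - u j y)\<bar>)))"
proof -
  let ?A = "{a :: 'e ^ 'n. \<exists>x\<in>X. \<exists>y\<in>X. x \<noteq> y \<and> (\<forall>j\<in>I. a $ j \<bullet> (u j x - u j y) = 0)}"
  have inj: "inj_on (u j) X" if "j \<in> I" for j
  proof
    fix x y assume xy: "x \<in> X" "y \<in> X" "u j x = u j y"
    have "c * norm (x - y) \<le> norm (u j x - u j y)" by (rule low(2)[OF that xy(1,2)])
    also have "\<dots> = c * 0" using xy(3) by simp
    finally have "norm (x - y) \<le> 0" using mult_le_cancel_left_pos[OF low(1)] by blast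
    then show "x = y" by simp
  qed
  have neg: "negligible ?A" by (rule negligible_kernel_tuples[OF X u(2) inj card])
  have "interior ?A = {}"
  proof (rule ccontr)
    assume "interior ?A \<noteq> {}"
    then have "\<not> negligible (interior ?A)" by (intro open_not_negligible) auto
    then show False using negligible_subset[OF neg interior_subset] by blast
  qed
  have G: "semialgebraic (graph_on X (u j))" if "j \<in> I" for j
    using u(1)[OF that] by (simp add: semialgebraic_map_on_def)
  have "semialgebraic {a :: 'e ^ 'n. \<exists>x y. x \<in> X \<and> y \<in> X \<and> \<not> x = y \<and>
      (\<forall>j\<in>I. \<exists>v w. (x, v) \<in> graph_on X (u j) \<and> (y, w) \<in> graph_on X (u j) \<and> a $ j \<bullet> (v - w) = 0)}"
    by (intro semialgebraic_intros semialgebraic_mem[OF X(2)] semialgebraic_mem[OF G]) auto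
  moreover have "{a :: 'e ^ 'n. \<exists>x y. x \<in> X \<and> y \<in> X \<and> \<not> x = y \<and>
      (\<forall>j\<in>I. \<exists>v w. (x, v) \<in> graph_on X (u j) \<and> (y, w) \<in> graph_on X (u j) \<and> a $ j \<bullet> (v - w) = 0)} = ?A"
    by (intro Collect_cong) auto
  ultimately have sa: "semialgebraic ?A" by simp
  obtain P where P: "real_polynomial_function P \<and> (\<exists>a. P a \<noteq> 0) \<and> (\<forall>a\<in>?A. P a = 0)"
    using semialgebraic_empty_interior[OF sa \<open>interior ?A = {}\<close>] by (rule exE)
  have "\<exists>K. \<forall>x\<in>X. \<forall>y\<in>X. norm (x - y) \<le> K * (\<Sum>j\<in>I. \<bar>a $ j \<bullet> (u j x - u j y)\<bar>)" if a: "P a \<noteq> 0" for a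
  proof -
    obtain \<epsilon> where \<epsilon>: "\<epsilon> > 0" "ball a \<epsilon> \<subseteq> {a. P a \<noteq> 0}"
      by (rule openE[OF open_real_polynomial_nonzero[OF conjunct1[OF P]], of a]) (use a in auto)
    have "norm (x - y) \<le> 2 / (c * \<epsilon>) * (\<Sum>j\<in>I. \<bar>a $ j \<bullet> (u j x - u j y)\<bar>)" if xy: "x \<in> X" "y \<in> X" for x y
    proof (rule ccontr)
      assume *: "\<not> norm (x - y) \<le> 2 / (c * \<epsilon>) * (\<Sum>j\<in>I. \<bar>a $ j \<bullet> (u j x - u j y)\<bar>)"
      define w where "w j = u j x - u j y" for j
      let ?S = "\<Sum>j\<in>I. \<bar>a $ j \<bullet> w j\<bar>"
      have S: "norm (x - y) > 2 / (c * \<epsilon>) * ?S" using * by (simp add: w_def)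
      moreover have "2 / (c * \<epsilon>) * ?S \<ge> 0" using low(1) \<epsilon>(1) by (intro mult_nonneg_nonneg sum_nonneg) auto
      ultimately have n: "norm (x - y) > 0" by linarith
      have w: "norm (w j) > 0" "c * norm (x - y) \<le> norm (w j)" if "j \<in> I" for j
      proof -
        show "c * norm (x - y) \<le> norm (w j)" using low(2)[OF that xy] by (simp add: w_def)
        with mult_pos_pos[OF low(1) n] show "norm (w j) > 0" by linarith
      qed
      \<comment> \<open>Each form is projected onto the orthogonal complement of its secant vector,
        which makes the tuple a bad one. The correction in slot j has norm |a_j . w_j| / norm(w_j),
        and the denominator is at least c norm(x - y). If the claimed bound failed, this bad tuple
        would lie within \<epsilon> of \<open>a\<close>, where \<open>P\<close> does not
        vanish.\<close>
      define a' :: "'e ^ 'n" where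
        "a' = (\<chi> j. if j \<in> I then a $ j - (a $ j \<bullet> w j / (w j \<bullet> w j)) *\<^sub>R w j else a $ j)"
      have "a' $ j \<bullet> w j = 0" if "j \<in> I" for j
        using that w(1)[OF that] by (simp add: a'_def inner_diff_left)
      then have "a' \<in> ?A" using xy n unfolding w_def by force
      then have "P a' = 0" using P by blast
      moreover have "norm (a' - a) < \<epsilon>"
      proof -
        have "norm (a' - a) \<le> (\<Sum>j\<in>UNIV. norm ((a' - a) $ j))"
          by (simp add: norm_vec_def L2_set_le_sum)
        also have "\<dots> = (\<Sum>j\<in>I. norm ((a' - a) $ j))"
          by (intro sum.mono_neutral_right) (auto simp: a'_def)
        also have "\<dots> \<le> (\<Sum>j\<in>I. \<bar>a $ j \<bullet> w j\<bar> / (c * norm (x - y)))"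
        proof (intro sum_mono)
          fix j assume j: "j \<in> I"
          have "norm ((a' - a) $ j) = \<bar>a $ j \<bullet> w j\<bar> / norm (w j)"
            using j w(1)[OF j] by (simp add: a'_def dot_square_norm power2_eq_square)
          also have "\<dots> \<le> \<bar>a $ j \<bullet> w j\<bar> / (c * norm (x - y))"
            using w[OF j] low(1) n by (intro divide_left_mono) auto
          finally show "norm ((a' - a) $ j) \<le> \<bar>a $ j \<bullet> w j\<bar> / (c * norm (x - y))" .
        qed
        also have "\<dots> = ?S / (c * norm (x - y))" by (simp add: sum_divide_distrib)
        also have "\<dots> < \<epsilon>"
        proof -
          have "2 * ?S < c * \<epsilon> * norm (x - y)"
            using S low(1) \<epsilon>(1) by (simp add: field_simps)
          moreover have "?S \<ge> 0" by (intro sum_nonneg) auto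
          ultimately have "?S < c * \<epsilon> * norm (x - y)" by linarith
          then show ?thesis using low(1) n by (simp add: field_simps)
        qed
        finally show ?thesis .
      qed
      moreover from this have "a' \<in> ball a \<epsilon>" by (simp add: dist_norm norm_minus_commute)
      ultimately show False using \<epsilon>(2) by blast
    qed
    then show ?thesis by blast
  qed
  then show ?thesis using P by blast
qed

section \<open>Embeddings by linear maps\<close>

lemma polynomial_function_vec_lambda:
  fixes f :: "'a::real_normed_vector \<Rightarrow> 'n::finite \<Rightarrow> 'b::euclidean_space"
  assumes "\<And>i. polynomial_function (\<lambda>x. f x i)"
  shows "polynomial_function (\<lambda>x. \<chi> i. f x i)"
  unfolding polynomial_function_iff_Basis_inner
proof
  fix b :: "'b ^ 'n" assume "b \<in> Basis"
  then obtain i c where "b = axis i c" unfolding Basis_vec_def by blast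
  then show "real_polynomial_function (\<lambda>x. (\<chi> i. f x i) \<bullet> b)"
    using polynomial_function_inner[OF assms[of i], of c] by (simp add: inner_axis real_polynomial_function_eq)
qed

lemma semialgebraic_bilipschitz_embeddingI:
  fixes f :: "'a::euclidean_space \<Rightarrow> 'b::euclidean_space"
  assumes X: "closed X" and f: "semialgebraic_map_on X f" "L-lipschitz_on X f"
    and K: "\<And>x y. x \<in> X \<Longrightarrow> y \<in> X \<Longrightarrow> norm (x - y) \<le> K * norm (f x - f y)"
  shows "semialgebraic_bilipschitz_embedding X f"
proof -
  have inj: "inj_on f X" using K by (intro inj_onI) fastforce
  have "(max K 0)-lipschitz_on (f ` X) (inv_into X f)"
  proof (rule lipschitz_onI)
    fix u v assume "u \<in> f ` X" "v \<in> f ` X"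
    then obtain x y where xy: "x \<in> X" "u = f x" "y \<in> X" "v = f y" by blast
    have "norm (x - y) \<le> K * norm (f x - f y)" by (rule K) fact+
    also have "\<dots> \<le> max K 0 * norm (f x - f y)" by (intro mult_right_mono) auto
    finally show "dist (inv_into X f u) (inv_into X f v) \<le> max K 0 * dist u v"
      using xy inj by (simp add: dist_norm)
  qed simp
  \<comment> \<open>The lower Lipschitz bound pulls a Cauchy sequence in the image back to one in
    \<open>X\<close>, which converges in the closed set \<open>X\<close>. Continuity of
    \<open>f\<close> then gives the limit in the image.\<close>
  moreover have "closed (f ` X)"
  proof (rule complete_imp_closed, rule completeI)
    fix s assume s: "\<forall>n. s n \<in> f ` X" "Cauchy s"
    then have "\<forall>n. \<exists>x. x \<in> X \<and> s n = f x" by blast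
    then obtain t where t: "\<And>n. t n \<in> X" "\<And>n. s n = f (t n)" by metis
    have "Cauchy t"
      unfolding Cauchy_def
    proof (intro allI impI)
      fix e :: real assume "e > 0"
      then have "e / (max K 0 + 1) > 0" by (simp add: add_nonneg_pos)
      then obtain M where M: "\<forall>m\<ge>M. \<forall>n\<ge>M. dist (s m) (s n) < e / (max K 0 + 1)"
        using s(2) unfolding Cauchy_def by blast
      have "dist (t m) (t n) < e" if "m \<ge> M" "n \<ge> M" for m n
      proof -
        have "dist (t m) (t n) \<le> K * dist (s m) (s n)" using K[OF t(1) t(1)] by (simp add: dist_norm t(2))
        also have "\<dots> \<le> (max K 0 + 1) * dist (s m) (s n)" by (intro mult_right_mono) auto
        also have "\<dots> < (max K 0 + 1) * (e / (max K 0 + 1))"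
          using M that by (intro mult_strict_left_mono) (auto simp: add_nonneg_pos)
        also have "\<dots> = e" by (simp add: max_def)
        finally show ?thesis .
      qed
      then show "\<exists>M. \<forall>m\<ge>M. \<forall>n\<ge>M. dist (t m) (t n) < e" by blast
    qed
    then obtain x where x: "x \<in> X" "t \<longlonglongrightarrow> x"
      using X t(1) by (metis Cauchy_convergent_iff closed_sequentially convergent_def)
    have "(\<lambda>n. f (t n)) \<longlonglongrightarrow> f x"
      using lipschitz_on_continuous_on[OF f(2)] x t(1) by (simp add: continuous_on_sequentially o_def)
    then show "\<exists>l\<in>f ` X. s \<longlonglongrightarrow> l" using x(1) t(2) by (metis ext image_eqI)
  qed
  ultimately show ?thesis
    unfolding semialgebraic_bilipschitz_embedding_def
    using f inj semialgebraic_map_on_inv_into[OF f(1) inj] by blast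
qed

lemma semialgebraic_bilipschitz_embeddingD:
  fixes f :: "'a::euclidean_space \<Rightarrow> 'b::euclidean_space"
  assumes "semialgebraic_bilipschitz_embedding X f"
  shows "\<exists>c>0. \<forall>x\<in>X. \<forall>y\<in>X. c * norm (x - y) \<le> norm (f x - f y)"
proof -
  obtain L where L: "L-lipschitz_on (f ` X) (inv_into X f)" and inj: "inj_on f X"
    using assms unfolding semialgebraic_bilipschitz_embedding_def by blast
  have L0: "L \<ge> 0" by (rule lipschitz_on_nonneg[OF L])
  \<comment> \<open>The denominator is \<open>L + 1\<close> because \<open>L\<close> may be 0, for
    instance when \<open>X\<close> is a single point.\<close>
  have "1 / (L + 1) * norm (x - y) \<le> norm (f x - f y)" if xy: "x \<in> X" "y \<in> X" for x y
  proof -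
    have "norm (x - y) \<le> L * norm (f x - f y)"
      using lipschitz_onD[OF L, of "f x" "f y"] xy inj by (simp add: dist_norm)
    also have "\<dots> \<le> (L + 1) * norm (f x - f y)" by (intro mult_right_mono) auto
    finally show ?thesis using L0 by (simp add: divide_le_eq mult.commute)
  qed
  then show ?thesis using L0 by (intro exI[of _ "1 / (L + 1)"]) auto
qed

text \<open>With every \<open>u j\<close> the identity, a generic linear projection of the ambient
  space restricts to an embedding of \<open>X\<close>. All n forms may be used here, so n > 2k is
  enough.\<close>

theorem semialgebraic_bilipschitz_embedding_exists:
  fixes X :: "'a::euclidean_space set"
  assumes X: "closed X" "semialgebraic X"
    and card: "2 * max 0 (semialgebraic_dim X) < int CARD('n::finite)"
  shows "\<exists>f :: 'a \<Rightarrow> real ^ 'n. semialgebraic_bilipschitz_embedding X f"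
proof -
  have "\<exists>P :: 'a ^ 'n \<Rightarrow> real. real_polynomial_function P \<and> (\<exists>a. P a \<noteq> 0) \<and>
    (\<forall>a. P a \<noteq> 0 \<longrightarrow> (\<exists>K. \<forall>x\<in>X. \<forall>y\<in>X. norm (x - y) \<le> K * (\<Sum>j\<in>UNIV. \<bar>a $ j \<bullet> (x - y)\<bar>)))"
  proof (rule generic_linear_forms_bilipschitz[OF X, where u = "\<lambda>j x. x" and c = 1])
    show "semialgebraic_map_on X (\<lambda>x. x)"
      by (rule semialgebraic_map_on_polynomial[OF X(2)]) simp
    show "\<exists>L. L-lipschitz_on X (\<lambda>x. x)"
      by (intro exI[of _ 1] lipschitz_onI) auto
  qed (use card in auto)
  then obtain a :: "'a ^ 'n" and K where
    K: "\<And>x y. x \<in> X \<Longrightarrow> y \<in> X \<Longrightarrow> norm (x - y) \<le> K * (\<Sum>j\<in>UNIV. \<bar>a $ j \<bullet> (x - y)\<bar>)" by blast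
  define f where "f x = (\<chi> j. a $ j \<bullet> x)" for x
  have pf: "polynomial_function f" unfolding f_def
    by (intro polynomial_function_vec_lambda polynomial_intros)
  have lin: "f x - f y = f (x - y)" for x y by (simp add: f_def vec_eq_iff inner_diff_right)
  show ?thesis
  proof (intro exI semialgebraic_bilipschitz_embeddingI[OF X(1)])
    show "semialgebraic_map_on X f" by (rule semialgebraic_map_on_polynomial[OF X(2) pf])
    show "(\<Sum>j\<in>UNIV. norm (a $ j))-lipschitz_on X f"
    proof (rule lipschitz_onI)
      fix x y
      have "norm (f (x - y)) \<le> (\<Sum>j\<in>UNIV. \<bar>a $ j \<bullet> (x - y)\<bar>)"
        using norm_le_l1_cart[of "f (x - y)"] by (simp add: f_def)
      also have "\<dots> \<le> (\<Sum>j\<in>UNIV. norm (a $ j) * norm (x - y))"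
        by (intro sum_mono Cauchy_Schwarz_ineq2)
      finally show "dist (f x) (f y) \<le> (\<Sum>j\<in>UNIV. norm (a $ j)) * dist x y"
        by (simp add: dist_norm lin sum_distrib_right)
    qed (auto intro: sum_nonneg)
    fix x y assume xy: "x \<in> X" "y \<in> X"
    have "(\<Sum>j\<in>UNIV. \<bar>a $ j \<bullet> (x - y)\<bar>) = (\<Sum>j\<in>UNIV. \<bar>f (x - y) $ j\<bar>)" by (simp add: f_def)
    also have "\<dots> \<le> (\<Sum>j\<in>(UNIV::'n set). norm (f (x - y)))"
      by (intro sum_mono component_le_norm_cart)
    finally have s: "(\<Sum>j\<in>UNIV. \<bar>a $ j \<bullet> (x - y)\<bar>) \<le> real CARD('n) * norm (f (x - y))" by simp
    have "norm (x - y) \<le> K * (\<Sum>j\<in>UNIV. \<bar>a $ j \<bullet> (x - y)\<bar>)" by (rule K[OF xy])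
    also have "\<dots> \<le> \<bar>K\<bar> * (\<Sum>j\<in>UNIV. \<bar>a $ j \<bullet> (x - y)\<bar>)" by (intro mult_right_mono sum_nonneg) auto
    also have "\<dots> \<le> \<bar>K\<bar> * (real CARD('n) * norm (f (x - y)))" by (intro mult_left_mono s) simp
    finally show "norm (x - y) \<le> (\<bar>K\<bar> * real CARD('n)) * norm (f x - f y)" by (simp add: lin mult.assoc)
  qed
qed

section \<open>Tame homeomorphisms\<close>

lemma bilipschitz_homeoI:
  assumes "\<And>x. \<Psi> (\<Phi> x) = x" "\<And>x. \<Phi> (\<Psi> x) = x" "L-lipschitz_on UNIV \<Phi>" "M-lipschitz_on UNIV \<Psi>"
  shows "bilipschitz_homeo \<Phi>"
proof -
  have "inv \<Phi> = \<Psi>" by (rule inv_unique_comp) (auto simp: fun_eq_iff assms)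
  moreover have "bij \<Phi>" by (rule o_bij[of \<Psi>]) (auto simp: fun_eq_iff assms)
  ultimately show ?thesis using assms(3,4) unfolding bilipschitz_homeo_def by auto
qed

lemma bilipschitz_homeo_compose:
  assumes "bilipschitz_homeo \<Phi>" "bilipschitz_homeo \<Psi>"
  shows "bilipschitz_homeo (\<Phi> \<circ> \<Psi>)"
proof -
  obtain K L M N where *: "bij \<Phi>" "bij \<Psi>" "K-lipschitz_on UNIV \<Phi>" "L-lipschitz_on UNIV (inv \<Phi>)"
    "M-lipschitz_on UNIV \<Psi>" "N-lipschitz_on UNIV (inv \<Psi>)"
    using assms unfolding bilipschitz_homeo_def by blast
  have "(K * M)-lipschitz_on UNIV (\<Phi> \<circ> \<Psi>)"
    by (rule lipschitz_on_compose[OF *(5)]) (rule lipschitz_on_subset[OF *(3)], simp)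
  moreover have "(N * L)-lipschitz_on UNIV (inv \<Psi> \<circ> inv \<Phi>)"
    by (rule lipschitz_on_compose[OF *(4)]) (rule lipschitz_on_subset[OF *(6)], simp)
  ultimately show ?thesis
    unfolding bilipschitz_homeo_def using * by (auto simp: o_inv_distrib intro: bij_comp)
qed

lemma linear_lipschitz:
  fixes f :: "'a::euclidean_space \<Rightarrow> 'b::real_normed_vector"
  assumes "linear f"
  shows "\<exists>L. L-lipschitz_on UNIV f"
proof -
  obtain B where B: "B > 0" "\<And>x. norm (f x) \<le> B * norm x" using linear_bounded_pos[OF assms] by blast
  show ?thesis
    using B(2)[of "x - y" for x y] B(1)
    by (intro exI[of _ B] lipschitz_onI) (auto simp: dist_norm linear_diff[OF assms])
qed

definition semialgebraic_tame_homeo :: "(real^'n::{finite,linorder} \<Rightarrow> real^'n::{finite,linorder}) \<Rightarrow> bool" where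
  "semialgebraic_tame_homeo \<Phi> \<longleftrightarrow> semialgebraic_map_on UNIV \<Phi> \<and> bilipschitz_homeo \<Phi> \<and> tame \<Phi>"

lemma semialgebraic_tame_homeo_compose: "semialgebraic_tame_homeo \<Phi> \<Longrightarrow> semialgebraic_tame_homeo \<Psi> \<Longrightarrow> semialgebraic_tame_homeo (\<Phi> \<circ> \<Psi>)"
  unfolding semialgebraic_tame_homeo_def
  by (auto intro: semialgebraic_map_on_compose bilipschitz_homeo_compose tame.comp)

lemma semialgebraic_tame_homeo_matrix:
  fixes A :: "real^'n::{finite,linorder}^'n::{finite,linorder}"
  assumes "det A = 1"
  shows "semialgebraic_tame_homeo (\<lambda>x. A *v x)" and "\<exists>B. det B = 1 \<and> (\<forall>x. B *v (A *v x) = x)"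
proof -
  obtain B where B: "A ** B = mat 1" "B ** A = mat 1"
    using assms invertible_det_nz[of A] unfolding invertible_def by auto
  have BA: "B *v (A *v x) = x" "A *v (B *v x) = x" for x
    by (simp_all add: matrix_vector_mul_assoc B)
  have "det (B ** A) = 1" by (simp add: B)
  then have "det B = 1" using assms by (simp add: det_mul)
  then show "\<exists>B. det B = 1 \<and> (\<forall>x. B *v (A *v x) = x)" using BA by blast
  obtain K L where "K-lipschitz_on UNIV (\<lambda>x. A *v x)" "L-lipschitz_on UNIV (\<lambda>x. B *v x)"
    using linear_lipschitz[OF matrix_vector_mul_linear] by metis
  then have "bilipschitz_homeo (\<lambda>x. A *v x)" by (intro bilipschitz_homeoI[of "\<lambda>x. B *v x"] BA)
  moreover have "tame (\<lambda>x. A *v x)" by (rule tame.linear) (simp_all add: assms)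
  moreover have "semialgebraic_map_on UNIV (\<lambda>x. A *v x)"
    by (intro semialgebraic_map_on_polynomial polynomial_function_bounded_linear
        linear_conv_bounded_linear[THEN iffD1]) auto
  ultimately show "semialgebraic_tame_homeo (\<lambda>x. A *v x)" by (simp add: semialgebraic_tame_homeo_def)
qed

lemma semialgebraic_tame_homeo_id: "semialgebraic_tame_homeo (\<lambda>x. x)"
  using semialgebraic_tame_homeo_matrix(1)[of "mat 1"] by simp

section \<open>Shears along an arbitrary coordinate\<close>

lemma tame_transvection:
  fixes b l :: "'n::{finite,linorder}"
  assumes "b \<noteq> l"
  shows "tame (\<lambda>z :: (real, 'n) vec. \<chi> j. if j = b then z $ b + c * z $ l else z $ j)"
proof -
  let ?A = "(\<chi> k. if k = b then row b (mat 1) + c *s row l (mat 1) else row k (mat 1)) :: ((real, 'n) vec, 'n) vec"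
  have "det ?A = 1" by (simp add: det_row_operation[OF assms])
  then have "tame (\<lambda>x. ?A *v x)" by (intro tame.linear) simp_all
  moreover have "?A *v z = (\<chi> j. if j = b then z $ b + c * z $ l else z $ j)" for z
  proof -
    have mz: "row i (mat 1) \<bullet> z = z $ i" for i
    proof -
      have "row i (mat 1 :: ((real, 'n) vec, 'n) vec) = axis i 1" by (simp add: row_def mat_def axis_def vec_eq_iff)
      then show ?thesis by (simp add: inner_axis')
    qed
    show ?thesis
      by (simp add: vec_eq_iff matrix_vector_mul_component inner_add_left mz
          scalar_mult_eq_scaleR)
  qed
  ultimately show ?thesis by simp
qed

text \<open>A quarter turn in a coordinate plane is a product of three transvections.\<close>

lemma tame_quarter_turn:
  fixes b l :: "'n::{finite,linorder}" and \<sigma> :: real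
  assumes "b \<noteq> l" "\<sigma> * \<sigma> = 1"
  shows "tame (\<lambda>z :: (real, 'n) vec. \<chi> j. if j = b then \<sigma> * z $ l else if j = l then - \<sigma> * z $ b else z $ j)"
proof -
  let ?E = "\<lambda>b l c (z :: (real, 'n) vec). \<chi> j. if j = b then z $ b + c * z $ l else z $ j"
  have "tame (?E b l \<sigma> \<circ> (?E l b (- \<sigma>) \<circ> ?E b l \<sigma>))"
    using assms(1) by (intro tame.comp tame_transvection) auto
  moreover have "?E b l \<sigma> \<circ> (?E l b (- \<sigma>) \<circ> ?E b l \<sigma>) =
      (\<lambda>z. \<chi> j. if j = b then \<sigma> * z $ l else if j = l then - \<sigma> * z $ b else z $ j)"
    using assms by (auto simp: fun_eq_iff vec_eq_iff algebra_simps mult.assoc[symmetric])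
  ultimately show ?thesis by simp
qed

definition coordinate_shear :: "'n \<Rightarrow> (real^'n \<Rightarrow> real) \<Rightarrow> real^'n \<Rightarrow> real^'n" where
  "coordinate_shear b p z = (\<chi> j. if j = b then z $ b + p z else z $ j)"

definition ignores_coordinate :: "'n \<Rightarrow> (real^'n \<Rightarrow> 'a) \<Rightarrow> bool" where
  "ignores_coordinate b p \<longleftrightarrow> (\<forall>x y. (\<forall>j. j \<noteq> b \<longrightarrow> x $ j = y $ j) \<longrightarrow> p x = p y)"

lemma lipschitz_coordinate_shear:
  fixes p :: "real^'n::finite \<Rightarrow> real"
  assumes "L-lipschitz_on UNIV p"
  shows "(real CARD('n) * (1 + L))-lipschitz_on UNIV (coordinate_shear b p)"
proof (rule lipschitz_onI)
  have L: "L \<ge> 0" by (rule lipschitz_on_nonneg[OF assms])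
  then show "0 \<le> real CARD('n) * (1 + L)" by simp
  fix x y :: "real^'n"
  have "norm (coordinate_shear b p x - coordinate_shear b p y) \<le>
      (\<Sum>j\<in>UNIV. \<bar>(coordinate_shear b p x - coordinate_shear b p y) $ j\<bar>)"
    by (rule norm_le_l1_cart)
  also have "\<dots> \<le> (\<Sum>j\<in>(UNIV::'n set). (1 + L) * norm (x - y))"
  proof (intro sum_mono)
    fix j
    have p: "\<bar>p x - p y\<bar> \<le> L * norm (x - y)"
      using lipschitz_onD[OF assms, of x y] by (simp add: dist_norm)
    have c: "\<bar>x $ j - y $ j\<bar> \<le> norm (x - y)" using component_le_norm_cart[of "x - y" j] by simp
    have "\<bar>(coordinate_shear b p x - coordinate_shear b p y) $ j\<bar> \<le> \<bar>x $ j - y $ j\<bar> + \<bar>p x - p y\<bar>"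
      by (auto simp: coordinate_shear_def)
    then show "\<bar>(coordinate_shear b p x - coordinate_shear b p y) $ j\<bar> \<le> (1 + L) * norm (x - y)"
      using p c by (simp add: distrib_right)
  qed
  finally show "dist (coordinate_shear b p x) (coordinate_shear b p y) \<le> real CARD('n) * (1 + L) * dist x y"
    by (simp add: dist_norm mult.assoc)
qed

lemma bilipschitz_coordinate_shear:
  fixes p :: "real^'n::finite \<Rightarrow> real"
  assumes "L-lipschitz_on UNIV p" "ignores_coordinate b p"
  shows "bilipschitz_homeo (coordinate_shear b p)"
proof (rule bilipschitz_homeoI)
  have p: "p (coordinate_shear b q z) = p z" for q z
    using assms(2) unfolding ignores_coordinate_def by (auto simp: coordinate_shear_def)
  show "coordinate_shear b (\<lambda>z. - p z) (coordinate_shear b p z) = z"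
    "coordinate_shear b p (coordinate_shear b (\<lambda>z. - p z) z) = z" for z
    by (subst coordinate_shear_def, simp add: p vec_eq_iff, simp add: coordinate_shear_def)+
  show "(real CARD('n) * (1 + L))-lipschitz_on UNIV (coordinate_shear b p)"
    by (rule lipschitz_coordinate_shear[OF assms(1)])
  have "L-lipschitz_on UNIV (\<lambda>z. - p z)" using assms(1) by (simp add: lipschitz_on_minus)
  then show "(real CARD('n) * (1 + L))-lipschitz_on UNIV (coordinate_shear b (\<lambda>z. - p z))"
    by (rule lipschitz_coordinate_shear)
qed

text \<open>Only the last coordinate may be sheared by definition, so another coordinate has to be
  rotated into its place and back. Exchanging the two coordinates would have determinant -1; a
  quarter turn has determinant 1 and costs only a sign.\<close>

lemma tame_coordinate_shear:
  fixes p :: "real^'n::{finite,linorder} \<Rightarrow> real"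
  assumes "L-lipschitz_on UNIV p" "ignores_coordinate b p"
  shows "tame (coordinate_shear b p)"
proof -
  have last: "tame (coordinate_shear last_index q)"
    if "M-lipschitz_on UNIV q" "ignores_coordinate last_index q" for M and q :: "(real, 'n) vec \<Rightarrow> real"
  proof (rule tame.shear[OF _ bilipschitz_coordinate_shear[OF that]])
    show "last_coordinate_shear (coordinate_shear last_index q)"
      unfolding last_coordinate_shear_def using that(2)
      by (intro exI[of _ q]) (auto simp: ignores_coordinate_def coordinate_shear_def vec_eq_iff)
  qed
  show ?thesis
  proof (cases "b = last_index")
    case True
    then show ?thesis using last[of L p] assms by simp
  next
    case False
    define l where "l = (last_index :: 'n)"
    define R where "R \<sigma> z = (\<chi> j. if j = b then \<sigma> * z $ l else if j = l then - \<sigma> * z $ b else z $ j)"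
      for \<sigma> and z :: "(real, 'n) vec"
    have bl: "b \<noteq> l" using False by (simp add: l_def)
    have tR: "tame (R 1)" "tame (R (-1))"
      unfolding R_def using tame_quarter_turn[OF bl, of 1] tame_quarter_turn[OF bl, of "-1"] by simp_all
    \<comment> \<open>The quarter turn \<open>R 1\<close> puts minus the coordinate \<open>b\<close>
      of \<open>z\<close> into the last place, so \<open>p\<close> must be subtracted there in order
      to be added to coordinate \<open>b\<close> after turning back.\<close>
    define q where "q y = - p (R (-1) y)" for y
    have "linear (R (-1))"
      by (rule linearI) (auto simp: R_def vec_eq_iff algebra_simps)
    then obtain M where M: "M-lipschitz_on UNIV (R (-1))" using linear_lipschitz by blast
    have "(L * M)-lipschitz_on UNIV (p \<circ> R (-1))"
      by (rule lipschitz_on_compose[OF M]) (rule lipschitz_on_subset[OF assms(1)], simp)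
    then have "(L * M)-lipschitz_on UNIV q"
      unfolding q_def by (simp add: lipschitz_on_minus o_def)
    moreover have "ignores_coordinate l q"
      unfolding ignores_coordinate_def q_def
    proof (intro allI impI arg_cong[of _ _ uminus])
      fix x y :: "(real, 'n) vec" assume "\<forall>j. j \<noteq> l \<longrightarrow> x $ j = y $ j"
      then have "\<forall>j. j \<noteq> b \<longrightarrow> R (-1) x $ j = R (-1) y $ j" using bl by (auto simp: R_def)
      then show "p (R (-1) x) = p (R (-1) y)" using assms(2) unfolding ignores_coordinate_def by blast
    qed
    ultimately have "tame (coordinate_shear l q)" using last unfolding l_def by blast
    then have "tame (R (-1) \<circ> (coordinate_shear l q \<circ> R 1))" by (intro tame.comp tR)
    moreover have "R (-1) \<circ> (coordinate_shear l q \<circ> R 1) = coordinate_shear b p"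
    proof
      fix z
      have "R (-1) (R 1 z) = z" using bl by (auto simp: R_def vec_eq_iff)
      then have "q (R 1 z) = - p z" by (simp add: q_def)
      then show "(R (-1) \<circ> (coordinate_shear l q \<circ> R 1)) z = coordinate_shear b p z"
        using bl by (auto simp: coordinate_shear_def vec_eq_iff R_def)
    qed
    ultimately show ?thesis by simp
  qed
qed

section \<open>Replacing one coordinate\<close>

text \<open>McShane's extension of a Lipschitz function, characterised as a greatest lower bound so that
  its graph is visibly semialgebraic.\<close>

lemma mcshane_extension:
  fixes q :: "'x \<Rightarrow> 'b::real_normed_vector" and d :: "'x \<Rightarrow> real"
  assumes X: "X \<noteq> {}" and C: "C \<ge> 0"
    and d: "\<And>x y. x \<in> X \<Longrightarrow> y \<in> X \<Longrightarrow> \<bar>d x - d y\<bar> \<le> C * norm (q x - q y)"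
  shows "\<exists>p. (\<forall>x\<in>X. p (q x) = d x) \<and> (\<forall>y z. \<bar>p y - p z\<bar> \<le> C * norm (y - z)) \<and>
    (\<forall>z r. r = p z \<longleftrightarrow> (\<forall>x\<in>X. r \<le> d x + C * norm (z - q x)) \<and>
      (\<forall>s. (\<forall>x\<in>X. s \<le> d x + C * norm (z - q x)) \<longrightarrow> s \<le> r))"
proof -
  define p where "p z = (INF x\<in>X. d x + C * norm (z - q x))" for z
  obtain a where a: "a \<in> X" using X by blast
  have bdd: "bdd_below ((\<lambda>x. d x + C * norm (z - q x)) ` X)" for z
  proof (rule bdd_belowI2)
    fix x assume x: "x \<in> X"
    have "norm (q a - q x) \<le> norm (q a - z) + norm (z - q x)"
      using norm_triangle_ineq[of "q a - z" "z - q x"] by simp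
    then have "C * norm (q a - q x) \<le> C * norm (q a - z) + C * norm (z - q x)"
      using C by (metis distrib_left mult_left_mono)
    then show "d a - C * norm (q a - z) \<le> d x + C * norm (z - q x)" using d[OF a x] by linarith
  qed
  have low: "p z \<le> d x + C * norm (z - q x)" if "x \<in> X" for x z
    unfolding p_def by (rule cINF_lower[OF bdd that])
  have great: "s \<le> p z" if "\<And>x. x \<in> X \<Longrightarrow> s \<le> d x + C * norm (z - q x)" for s z
    unfolding p_def by (rule cINF_greatest[OF X that])
  have "p (q x) = d x" if "x \<in> X" for x
  proof (rule antisym)
    show "p (q x) \<le> d x" using low[OF that, of "q x"] by simp
    show "d x \<le> p (q x)"
    proof (rule great)
      fix y assume "y \<in> X"
      then show "d x \<le> d y + C * norm (q x - q y)" using d[OF that] by fastforce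
    qed
  qed
  moreover have le: "p y - p z \<le> C * norm (y - z)" for y z
  proof -
    have "p y - C * norm (y - z) \<le> p z"
    proof (rule great)
      fix x assume "x \<in> X"
      have "norm (y - q x) \<le> norm (y - z) + norm (z - q x)"
        using norm_triangle_ineq[of "y - z" "z - q x"] by simp
      then have "C * norm (y - q x) \<le> C * norm (y - z) + C * norm (z - q x)"
        using C by (metis distrib_left mult_left_mono)
      then show "p y - C * norm (y - z) \<le> d x + C * norm (z - q x)" using low[OF \<open>x \<in> X\<close>, of y] by linarith
    qed
    then show ?thesis by simp
  qed
  moreover have "\<bar>p y - p z\<bar> \<le> C * norm (y - z)" for y z
    using le[of y z] le[of z y] by (simp add: norm_minus_commute abs_le_iff)
  moreover have "r = p z \<longleftrightarrow> (\<forall>x\<in>X. r \<le> d x + C * norm (z - q x)) \<and>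
      (\<forall>s. (\<forall>x\<in>X. s \<le> d x + C * norm (z - q x)) \<longrightarrow> s \<le> r)" for z r
  proof
    assume "r = p z"
    then show "(\<forall>x\<in>X. r \<le> d x + C * norm (z - q x)) \<and>
      (\<forall>s. (\<forall>x\<in>X. s \<le> d x + C * norm (z - q x)) \<longrightarrow> s \<le> r)" using low great by blast
  next
    assume "(\<forall>x\<in>X. r \<le> d x + C * norm (z - q x)) \<and>
      (\<forall>s. (\<forall>x\<in>X. s \<le> d x + C * norm (z - q x)) \<longrightarrow> s \<le> r)"
    then show "r = p z" using low great by (intro antisym) blast+
  qed
  ultimately show ?thesis by blast
qed

text \<open>The norm is not polynomial, so the inequality is squared. This is legitimate for
  positive \<open>r\<close>; for the other \<open>r\<close> it holds anyway.\<close>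

lemma semialgebraic_le_norm:
  fixes f :: "_ \<Rightarrow> 'b::euclidean_space" and g :: "_ \<Rightarrow> real"
  assumes "polynomial_function f" "polynomial_function g"
  shows "semialgebraic {x. g x \<le> norm (f x)}"
proof -
  have "r \<le> norm u \<longleftrightarrow> \<not> (0 < r \<and> u \<bullet> u < r * r)" for u :: 'b and r
    by (auto simp: norm_ge_square power2_eq_square)
  then show ?thesis
    by (simp only:) (intro semialgebraic_intros assms)
qed

text \<open>By the bound with \<open>K\<close>, the coordinates of \<open>T\<close> other than
  \<open>b\<close> recover the point of \<open>X\<close> in a Lipschitz way. The required change
  \<open>v - T $ b\<close> is therefore a Lipschitz function of these coordinates, and its extension
  to the whole space is the function of the shear.\<close>

lemma replace_coordinate:
  fixes T :: "'a::euclidean_space \<Rightarrow> real^'n::{finite,linorder}" and v :: "'a \<Rightarrow> real"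
  assumes X: "X \<noteq> {}" "semialgebraic X"
    and sa: "semialgebraic_map_on X T" "semialgebraic_map_on X v"
    and D: "D-lipschitz_on X (\<lambda>x. v x - T x $ b)"
    and K: "\<And>x y. x \<in> X \<Longrightarrow> y \<in> X \<Longrightarrow> norm (x - y) \<le> K * (\<Sum>j\<in>UNIV - {b}. \<bar>T x $ j - T y $ j\<bar>)"
  shows "\<exists>\<Phi>. semialgebraic_tame_homeo \<Phi> \<and> (\<forall>x\<in>X. \<Phi> (T x) = (\<chi> j. if j = b then v x else T x $ j))"
proof -
  \<comment> \<open>Setting coordinate \<open>b\<close> to 0 replaces projection to a space of one
    dimension less, so that precomposition with \<open>\<pi>\<close> yields a function on the full
    space that ignores \<open>b\<close>.\<close>
  define \<pi> where "\<pi> z = (\<chi> j. if j = b then 0 else z $ j)" for z :: "(real, 'n) vec"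
  define d where "d x = v x - T x $ b" for x
  define C where "C = D * (\<bar>K\<bar> * real CARD('n))"
  have D0: "D \<ge> 0" by (rule lipschitz_on_nonneg[OF D])
  have C0: "C \<ge> 0" using D0 by (simp add: C_def)
  have pi_diff: "\<pi> x - \<pi> y = \<pi> (x - y)" for x y by (auto simp: \<pi>_def vec_eq_iff)
  have "\<bar>d x - d y\<bar> \<le> C * norm (\<pi> (T x) - \<pi> (T y))" if xy: "x \<in> X" "y \<in> X" for x y
  proof -
    have "(\<Sum>j\<in>UNIV - {b}. \<bar>T x $ j - T y $ j\<bar>) = (\<Sum>j\<in>UNIV - {b}. \<bar>(\<pi> (T x) - \<pi> (T y)) $ j\<bar>)"
      by (intro sum.cong) (auto simp: \<pi>_def)
    also have "\<dots> \<le> (\<Sum>j\<in>UNIV. \<bar>(\<pi> (T x) - \<pi> (T y)) $ j\<bar>)" by (intro sum_mono2) auto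
    also have "\<dots> \<le> (\<Sum>j\<in>(UNIV::'n set). norm (\<pi> (T x) - \<pi> (T y)))"
      by (intro sum_mono component_le_norm_cart)
    finally have s: "(\<Sum>j\<in>UNIV - {b}. \<bar>T x $ j - T y $ j\<bar>) \<le> real CARD('n) * norm (\<pi> (T x) - \<pi> (T y))"
      by simp
    have "norm (x - y) \<le> K * (\<Sum>j\<in>UNIV - {b}. \<bar>T x $ j - T y $ j\<bar>)" by (rule K[OF xy])
    also have "\<dots> \<le> \<bar>K\<bar> * (\<Sum>j\<in>UNIV - {b}. \<bar>T x $ j - T y $ j\<bar>)" by (intro mult_right_mono sum_nonneg) auto
    also have "\<dots> \<le> \<bar>K\<bar> * (real CARD('n) * norm (\<pi> (T x) - \<pi> (T y)))" by (intro mult_left_mono s) simp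
    finally have n: "norm (x - y) \<le> \<bar>K\<bar> * real CARD('n) * norm (\<pi> (T x) - \<pi> (T y))" by (simp add: mult.assoc)
    have "\<bar>d x - d y\<bar> \<le> D * norm (x - y)"
      using lipschitz_onD[OF D xy] by (simp add: d_def dist_norm)
    also have "\<dots> \<le> D * (\<bar>K\<bar> * real CARD('n) * norm (\<pi> (T x) - \<pi> (T y)))" by (intro mult_left_mono n D0)
    finally show ?thesis by (simp add: C_def mult.assoc)
  qed
  from mcshane_extension[where q = "\<lambda>x. \<pi> (T x)" and d = d, OF X(1) C0 this] obtain p where
    P: "(\<forall>x\<in>X. p (\<pi> (T x)) = d x) \<and> (\<forall>y z. \<bar>p y - p z\<bar> \<le> C * norm (y - z)) \<and>
      (\<forall>z r. r = p z \<longleftrightarrow> (\<forall>x\<in>X. r \<le> d x + C * norm (z - \<pi> (T x))) \<and>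
        (\<forall>s. (\<forall>x\<in>X. s \<le> d x + C * norm (z - \<pi> (T x))) \<longrightarrow> s \<le> r))"
    by (rule exE)
  note p = P[THEN conjunct1, rule_format] P[THEN conjunct2, THEN conjunct1, rule_format]
    P[THEN conjunct2, THEN conjunct2, THEN spec, THEN spec]
  let ?p = "\<lambda>z. p (\<pi> z)"
  have pi_le: "norm (\<pi> z) \<le> norm z" for z
    unfolding norm_vec_def by (intro L2_set_mono) (auto simp: \<pi>_def)
  have lip: "C-lipschitz_on UNIV ?p"
  proof (rule lipschitz_onI)
    fix y z :: "(real, 'n) vec"
    have "\<bar>?p y - ?p z\<bar> \<le> C * norm (\<pi> y - \<pi> z)" by (rule p)
    also have "\<dots> \<le> C * norm (y - z)" using pi_le[of "y - z"] C0 by (intro mult_left_mono) (auto simp: pi_diff)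
    finally show "dist (?p y) (?p z) \<le> C * dist y z" by (simp add: dist_norm)
  qed (rule C0)
  have ign: "ignores_coordinate b ?p"
    unfolding ignores_coordinate_def by (auto intro!: arg_cong[of _ _ p] simp: \<pi>_def vec_eq_iff)
  have poly_pi: "polynomial_function (\<lambda>x. \<pi> (h x))" if "polynomial_function h" for h :: "'c::euclidean_space \<Rightarrow> (real, 'n) vec"
    unfolding \<pi>_def
  proof (rule polynomial_function_vec_lambda)
    show "polynomial_function (\<lambda>x. if j = b then 0 else h x $ j)" for j
      using that by (cases "j = b") (auto intro: polynomial_intros)
  qed
  have GT: "semialgebraic (graph_on X T)" and Gv: "semialgebraic (graph_on X v)"
    using sa by (simp_all add: semialgebraic_map_on_def)
  \<comment> \<open>The pairs of a point and a lower bound for the infimum in McShane's formula,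
    where \<open>c - t $ b\<close> is the value of \<open>d\<close> at \<open>x\<close>. The factor
    \<open>C\<close> is put inside the norm, as \<open>C\<close> is nonnegative, to give the
    inequality the form of a polynomial bounded by a norm.\<close>
  define LB where "LB = {w :: ((real, 'n) vec) \<times> real. \<forall>x t c. (x, t) \<in> graph_on X T \<and> (x, c) \<in> graph_on X v \<longrightarrow>
    snd w - (c - t $ b) \<le> norm (C *\<^sub>R (\<pi> (fst w) - \<pi> t))}"
  have LB: "(z, r) \<in> LB \<longleftrightarrow> (\<forall>x\<in>X. r \<le> d x + C * norm (\<pi> z - \<pi> (T x)))" for z r
    using C0 by (fastforce simp: LB_def d_def)
  have sLB: "semialgebraic LB" unfolding LB_def
    by (intro semialgebraic_intros semialgebraic_mem[OF GT] semialgebraic_mem[OF Gv]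
        semialgebraic_le_norm poly_pi)
  have "semialgebraic {w :: ((real, 'n) vec) \<times> real. w \<in> LB \<and> (\<forall>s. (fst w, s) \<in> LB \<longrightarrow> s \<le> snd w)}"
    by (intro semialgebraic_intros semialgebraic_mem[OF sLB])
  also have "{w :: ((real, 'n) vec) \<times> real. w \<in> LB \<and> (\<forall>s. (fst w, s) \<in> LB \<longrightarrow> s \<le> snd w)} = graph_on UNIV ?p"
  proof -
    have *: "(z, r) \<in> LB \<and> (\<forall>s. (z, s) \<in> LB \<longrightarrow> s \<le> r) \<longleftrightarrow> r = ?p z" for z r
      unfolding LB using p(3)[of r "\<pi> z"] by blast
    show ?thesis
    proof (rule set_eqI)
      fix w :: "((real, 'n) vec) \<times> real"
      obtain z r where w: "w = (z, r)" by fastforce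
      show "w \<in> {w. w \<in> LB \<and> (\<forall>s. (fst w, s) \<in> LB \<longrightarrow> s \<le> snd w)} \<longleftrightarrow> w \<in> graph_on UNIV ?p"
        unfolding w using *[of z r] by simp
    qed
  qed
  finally have Gp: "semialgebraic (graph_on UNIV ?p)" .
  have "semialgebraic_map_on UNIV (coordinate_shear b ?p)"
    unfolding semialgebraic_map_on_def
  proof
    have "semialgebraic {w :: ((real, 'n) vec) \<times> ((real, 'n) vec). \<exists>r. (fst w, r) \<in> graph_on UNIV ?p \<and>
        snd w = fst w + (\<chi> j. if j = b then r else 0)}"
    proof (intro semialgebraic_intros semialgebraic_mem[OF Gp] polynomial_function_vec_lambda)
      show "polynomial_function (\<lambda>x. if j = b then snd x else (0::real))"
        for j and x :: "(((real, 'n) vec) \<times> ((real, 'n) vec)) \<times> real"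
        by (cases "j = b") (auto intro: polynomial_intros)
    qed
    also have "{w :: ((real, 'n) vec) \<times> ((real, 'n) vec). \<exists>r. (fst w, r) \<in> graph_on UNIV ?p \<and>
        snd w = fst w + (\<chi> j. if j = b then r else 0)} = graph_on UNIV (coordinate_shear b ?p)"
      by (auto simp: coordinate_shear_def vec_eq_iff)
    finally show "semialgebraic (graph_on UNIV (coordinate_shear b ?p))" .
  qed simp
  then have "semialgebraic_tame_homeo (coordinate_shear b ?p)"
    unfolding semialgebraic_tame_homeo_def
    using bilipschitz_coordinate_shear[OF lip ign] tame_coordinate_shear[OF lip ign] by blast
  moreover have "coordinate_shear b ?p (T x) = (\<chi> j. if j = b then v x else T x $ j)" if "x \<in> X" for x
    using p(1)[OF that] by (auto simp: coordinate_shear_def vec_eq_iff d_def)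
  ultimately show ?thesis by blast
qed

section \<open>Uniqueness of embeddings\<close>

lemma polynomial_function_det:
  fixes h :: "'a::real_normed_vector \<Rightarrow> real^'n^'n"
  assumes "polynomial_function h"
  shows "polynomial_function (\<lambda>z. det (h z))"
  unfolding det_def
proof (intro polynomial_function_sum polynomial_function_times polynomial_function_const)
  fix p :: "'n \<Rightarrow> 'n"
  have "real_polynomial_function (\<lambda>z. \<Prod>i\<in>UNIV. h z $ i $ p i)"
    using assms by (intro real_polynomial_function_prod)
      (auto simp: real_polynomial_function_eq intro: polynomial_function_vec_nth)
  then show "polynomial_function (\<lambda>z. \<Prod>i\<in>UNIV. h z $ i $ p i)"
    by (simp add: real_polynomial_function_eq)
qed (simp add: finite_permutations)

lemma semialgebraic_map_on_Pair:
  assumes "semialgebraic_map_on X f" "semialgebraic_map_on X g"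
  shows "semialgebraic_map_on X (\<lambda>x. (f x, g x))"
  unfolding semialgebraic_map_on_def
proof
  have F: "semialgebraic (graph_on X f)" and G: "semialgebraic (graph_on X g)"
    using assms by (simp_all add: semialgebraic_map_on_def)
  have "semialgebraic {z. (fst z, fst (snd z)) \<in> graph_on X f \<and> (fst z, snd (snd z)) \<in> graph_on X g}"
    by (intro semialgebraic_intros semialgebraic_mem[OF F] semialgebraic_mem[OF G])
  then show "semialgebraic (graph_on X (\<lambda>x. (f x, g x)))"
    by (rule back_subst[of semialgebraic]) auto
qed (use assms in \<open>simp add: semialgebraic_map_on_def\<close>)

lemma semialgebraic_map_on_polynomial_combination:
  assumes "semialgebraic_map_on X f" "semialgebraic_map_on X g" "polynomial_function (\<lambda>z. h (fst z) (snd z))"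
  shows "semialgebraic_map_on X (\<lambda>x. h (f x) (g x))"
  using semialgebraic_map_on_compose[OF semialgebraic_map_on_Pair[OF assms(1,2)]
      semialgebraic_map_on_polynomial[OF semialgebraic_UNIV assms(3)]]
  by (simp add: o_def)

lemma det_scale_row_1:
  fixes A :: "real^'n^'n"
  assumes "det A \<noteq> 0"
  shows "det (\<chi> j. (if j = k then 1 / det A else 1) *\<^sub>R A $ j) = 1"
proof -
  have "(\<chi> j. (if j = k then 1 / det A else 1) *\<^sub>R A $ j) =
      (\<chi> j. if j = k then (1 / det A) *s A $ j else A $ j)"
    by (auto simp: vec_eq_iff)
  then have "det (\<chi> j. (if j = k then 1 / det A else 1) *\<^sub>R A $ j) = 1 / det A * det (\<chi> j. if j = k then A $ j else A $ j)"
    by (simp only: det_row_mul)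
  then show ?thesis using assms by (simp add: vec_nth_inverse)
qed

theorem semialgebraic_bilipschitz_embedding_unique:
  fixes f g :: "'a::euclidean_space \<Rightarrow> real^'n::{finite,linorder}"
  assumes X: "closed X" "semialgebraic X" "X \<noteq> {}"
    and f: "semialgebraic_bilipschitz_embedding X f" and g: "semialgebraic_bilipschitz_embedding X g"
    and card: "2 * semialgebraic_dim X + 2 \<le> int CARD('n)"
  shows "\<exists>\<Phi>. semialgebraic_tame_homeo \<Phi> \<and> (\<forall>x\<in>X. g x = \<Phi> (f x))"
proof -
  have k0: "semialgebraic_dim X \<ge> 0" by (rule semialgebraic_dim_nonneg[OF X(3)])
  obtain c1 c2 where c12: "c1 > 0" "\<And>x y. x \<in> X \<Longrightarrow> y \<in> X \<Longrightarrow> c1 * norm (x - y) \<le> norm (f x - f y)"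
    "c2 > 0" "\<And>x y. x \<in> X \<Longrightarrow> y \<in> X \<Longrightarrow> c2 * norm (x - y) \<le> norm (g x - g y)"
    using semialgebraic_bilipschitz_embeddingD[OF f] semialgebraic_bilipschitz_embeddingD[OF g] by metis
  obtain Lf Lg where L: "Lf-lipschitz_on X f" "Lg-lipschitz_on X g"
    using f g unfolding semialgebraic_bilipschitz_embedding_def by metis
  have sf: "semialgebraic_map_on X f" and sg: "semialgebraic_map_on X g"
    using f g unfolding semialgebraic_bilipschitz_embedding_def by blast+
  \<comment> \<open>When coordinate i is being replaced, those below i still come from
    \<open>f\<close> and those above i already come from \<open>g\<close>.\<close>
  define u where "u i j = (if j < i then f else g)" for i j :: 'n
  define gen where "gen i P \<longleftrightarrow> real_polynomial_function P \<and> (\<exists>a. P a \<noteq> 0) \<and>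
    (\<forall>a. P a \<noteq> 0 \<longrightarrow> (\<exists>K. \<forall>x\<in>X. \<forall>y\<in>X.
      norm (x - y) \<le> K * (\<Sum>j\<in>UNIV - {i}. \<bar>a $ j \<bullet> (u i j x - u i j y)\<bar>)))"
    for i and P :: "((real, 'n) vec, 'n) vec \<Rightarrow> real"
  have "\<exists>P. gen i P" for i
    unfolding gen_def
  proof (rule generic_linear_forms_bilipschitz[OF X(1,2), where c = "min c1 c2"])
    show "semialgebraic_map_on X (u i j)" for j using sf sg by (simp add: u_def)
    show "\<exists>L. L-lipschitz_on X (u i j)" for j using L by (auto simp: u_def)
    show "min c1 c2 > 0" using c12 by simp
    show "min c1 c2 * norm (x - y) \<le> norm (u i j x - u i j y)" if "x \<in> X" "y \<in> X" for j x y
    proof -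
      have "min c1 c2 * norm (x - y) \<le> c1 * norm (x - y)" "min c1 c2 * norm (x - y) \<le> c2 * norm (x - y)"
        by (intro mult_right_mono; simp)+
      then show ?thesis using c12(2,4)[OF that] by (auto simp: u_def)
    qed
    have "int (card (UNIV - {i})) = int CARD('n) - 1"
      by (simp add: card_Diff_singleton of_nat_diff Suc_leI)
    then show "2 * max 0 (semialgebraic_dim X) < int (card (UNIV - {i}))" using card k0 by simp
  qed
  then obtain P where gen: "\<And>i. gen i (P i)" by metis
  have P: "real_polynomial_function (P i)" "\<exists>a. P i a \<noteq> 0" for i
    using gen[of i] by (simp_all add: gen_def)
  have P3: "\<exists>K. \<forall>x\<in>X. \<forall>y\<in>X.
      norm (x - y) \<le> K * (\<Sum>j\<in>UNIV - {i}. \<bar>a $ j \<bullet> (u i j x - u i j y)\<bar>)" if "P i a \<noteq> 0" for i a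
    using gen[of i] that by (simp add: gen_def)
  define mix where "mix i z = (\<chi> j. if j < i then fst z $ j else snd z $ j)"
    for i and z :: "((real, 'n) vec, 'n) vec \<times> ((real, 'n) vec, 'n) vec"
  \<comment> \<open>All generic conditions on the pair of matrices in one finite family:
    \<open>Inl i\<close> for the tuple of step i, whose rows \<open>mix\<close> takes from the first
    or the second matrix as \<open>u\<close> prescribes, and \<open>Inr b\<close> for the two
    determinants.\<close>
  define Q where "Q s = (case s of Inl i \<Rightarrow> P i \<circ> mix i | Inr b \<Rightarrow> (\<lambda>z. det (if b then fst z else snd z)))"
    for s :: "'n + bool"
  have "\<exists>z. \<forall>s\<in>UNIV. Q s z \<noteq> 0"
  proof (rule real_polynomial_functions_nonzero_prod)
    fix s :: "'n + bool"
    have "polynomial_function (mix i)" for i unfolding mix_def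
    proof (rule polynomial_function_vec_lambda)
      show "polynomial_function (\<lambda>z. if j < i then fst z $ j else snd z $ j)" for j
        by (cases "j < i") (auto intro!: polynomial_intros)
    qed
    then have "real_polynomial_function (Q (Inl i))" for i
      using P(1) by (simp add: Q_def real_polynomial_function_compose)
    moreover have "real_polynomial_function (Q (Inr b))" for b
      by (cases b) (simp_all add: Q_def real_polynomial_function_eq polynomial_function_det polynomial_intros)
    ultimately show "real_polynomial_function (Q s)" by (cases s) auto
    \<comment> \<open>On the diagonal the mixture is the common matrix, so the condition at step i
      is not identically zero; the determinants are tested at the identity matrix.\<close>
    have "mix i (a, a) = a" for i a by (simp add: mix_def vec_eq_iff)
    then have "\<exists>z. Q (Inl i) z \<noteq> 0" for i using P(2)[of i] by (auto simp: Q_def) metis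
    moreover have "Q (Inr b) (mat 1, mat 1) \<noteq> 0" for b by (simp add: Q_def)
    ultimately show "\<exists>z. Q s z \<noteq> 0" by (cases s) blast+
  qed simp
  then obtain A B where AB: "\<And>s. Q s (A, B) \<noteq> 0" by (metis UNIV_I surj_pair)
  have detA: "det A \<noteq> 0" and detB: "det B \<noteq> 0" using AB[of "Inr True"] AB[of "Inr False"] by (simp_all add: Q_def)
  define k where "k = (last_index :: 'n)"
  \<comment> \<open>One row of each matrix is rescaled to make the determinant one. A single linear
    form changes by a nonzero factor, which alters the estimates only by a constant.\<close>
  define \<sigma> where "\<sigma> j = (if j = k then 1 / det A else 1)" for j
  define \<tau> where "\<tau> j = (if j = k then 1 / det B else 1)" for j
  define A0 where "A0 = (\<chi> j. \<sigma> j *\<^sub>R A $ j)"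
  define B0 where "B0 = (\<chi> j. \<tau> j *\<^sub>R B $ j)"
  have det0: "det A0 = 1" "det B0 = 1"
    unfolding A0_def B0_def \<sigma>_def \<tau>_def by (rule det_scale_row_1, fact)+
  define T where "T U x = (\<chi> j. if j \<in> U then B0 $ j \<bullet> g x else A0 $ j \<bullet> f x)" for U x
  have sT: "semialgebraic_map_on X (T U)" for U
    unfolding T_def
  proof (rule semialgebraic_map_on_polynomial_combination[OF sf sg,
        where h = "\<lambda>v w. \<chi> j. if j \<in> U then B0 $ j \<bullet> w else A0 $ j \<bullet> v"])
    show "polynomial_function (\<lambda>z. \<chi> j. if j \<in> U then B0 $ j \<bullet> snd z else A0 $ j \<bullet> fst z)"
    proof (rule polynomial_function_vec_lambda)
      show "polynomial_function (\<lambda>z. if j \<in> U then B0 $ j \<bullet> snd z else A0 $ j \<bullet> fst z)" for j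
        by (cases "j \<in> U") (auto intro!: polynomial_intros)
    qed
  qed
  have bil: "\<exists>K. \<forall>x\<in>X. \<forall>y\<in>X. norm (x - y) \<le>
      K * (\<Sum>j\<in>UNIV - {i}. \<bar>T {j. i < j} x $ j - T {j. i < j} y $ j\<bar>)" for i
  proof -
    have "P i (mix i (A, B)) \<noteq> 0" using AB[of "Inl i"] by (simp add: Q_def)
    then obtain K where K: "\<And>x y. x \<in> X \<Longrightarrow> y \<in> X \<Longrightarrow>
      norm (x - y) \<le> K * (\<Sum>j\<in>UNIV - {i}. \<bar>mix i (A, B) $ j \<bullet> (u i j x - u i j y)\<bar>)"
      using P3 by blast
    \<comment> \<open>The reciprocals of the factors \<open>\<sigma> j\<close> and
      \<open>\<tau> j\<close> are 1, \<open>det A\<close> or \<open>det B\<close>, so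
      \<open>M\<close> bounds their absolute values.\<close>
    define M where "M = 1 + \<bar>det A\<bar> + \<bar>det B\<bar>"
    have sc: "\<bar>s\<bar> \<le> M * \<bar>\<sigma> j * s\<bar>" "\<bar>s\<bar> \<le> M * \<bar>\<tau> j * s\<bar>" for j s
    proof -
      have "1 \<le> M * \<bar>\<sigma> j\<bar>" "1 \<le> M * \<bar>\<tau> j\<bar>"
        using detA detB by (auto simp: M_def \<sigma>_def \<tau>_def abs_divide field_simps)
      then show "\<bar>s\<bar> \<le> M * \<bar>\<sigma> j * s\<bar>" "\<bar>s\<bar> \<le> M * \<bar>\<tau> j * s\<bar>"
        using mult_right_mono[of 1 "M * \<bar>\<sigma> j\<bar>" "\<bar>s\<bar>"] mult_right_mono[of 1 "M * \<bar>\<tau> j\<bar>" "\<bar>s\<bar>"]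
        by (simp_all add: abs_mult mult.assoc)
    qed
    have "norm (x - y) \<le> (\<bar>K\<bar> * M) * (\<Sum>j\<in>UNIV - {i}. \<bar>T {j. i < j} x $ j - T {j. i < j} y $ j\<bar>)"
      if xy: "x \<in> X" "y \<in> X" for x y
    proof -
      have "norm (x - y) \<le> K * (\<Sum>j\<in>UNIV - {i}. \<bar>mix i (A, B) $ j \<bullet> (u i j x - u i j y)\<bar>)" by (rule K[OF xy])
      also have "\<dots> \<le> \<bar>K\<bar> * (\<Sum>j\<in>UNIV - {i}. \<bar>mix i (A, B) $ j \<bullet> (u i j x - u i j y)\<bar>)"
        by (intro mult_right_mono sum_nonneg) auto
      also have "\<dots> \<le> \<bar>K\<bar> * (\<Sum>j\<in>UNIV - {i}. M * \<bar>T {j. i < j} x $ j - T {j. i < j} y $ j\<bar>)"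
      proof (intro mult_left_mono sum_mono)
        fix j assume "j \<in> UNIV - {i}"
        then consider "j < i" "\<not> i < j" | "i < j" "\<not> j < i" by fastforce
        then show "\<bar>mix i (A, B) $ j \<bullet> (u i j x - u i j y)\<bar> \<le> M * \<bar>T {j. i < j} x $ j - T {j. i < j} y $ j\<bar>"
        proof cases
          case 1
          have "T {j. i < j} x $ j - T {j. i < j} y $ j = \<sigma> j * (A $ j \<bullet> (f x - f y))"
            using 1 by (simp add: T_def A0_def inner_diff_right right_diff_distrib)
          then show ?thesis using sc(1)[of "A $ j \<bullet> (f x - f y)" j] 1 by (simp add: mix_def u_def)
        next
          case 2
          have "T {j. i < j} x $ j - T {j. i < j} y $ j = \<tau> j * (B $ j \<bullet> (g x - g y))"
            using 2 by (simp add: T_def B0_def inner_diff_right right_diff_distrib)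
          then show ?thesis using sc(2)[of "B $ j \<bullet> (g x - g y)" j] 2 by (simp add: mix_def u_def)
        qed
      qed simp
      finally show ?thesis by (simp add: sum_distrib_left[symmetric] mult.assoc)
    qed
    then show ?thesis by blast
  qed
  \<comment> \<open>Coordinates are exchanged from the last one downwards. The set \<open>U\<close>
    of exchanged indices is upward closed, hence equal to the indices above the next one,
    \<open>b\<close>, and the remaining n - 1 coordinates are exactly those of a mixed
    tuple.\<close>
  have "(\<forall>i j. i \<in> U \<longrightarrow> i < j \<longrightarrow> j \<in> U) \<longrightarrow> (\<exists>\<Phi>. semialgebraic_tame_homeo \<Phi> \<and> (\<forall>x\<in>X. \<Phi> (T {} x) = T U x))" for U
    using finite[of U]
  proof (induction U rule: finite_linorder_min_induct)
    case empty
    show ?case using semialgebraic_tame_homeo_id by blast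
  next
    case (insert b U)
    show ?case
    proof
      assume up: "\<forall>i j. i \<in> insert b U \<longrightarrow> i < j \<longrightarrow> j \<in> insert b U"
      have U: "U = {j. b < j}" using insert.hyps(2) up by auto
      then have "\<forall>i j. i \<in> U \<longrightarrow> i < j \<longrightarrow> j \<in> U" by auto
      then obtain \<Phi> where \<Phi>: "semialgebraic_tame_homeo \<Phi>" "\<And>x. x \<in> X \<Longrightarrow> \<Phi> (T {} x) = T U x" using insert.IH by blast
      obtain K where K: "\<And>x y. x \<in> X \<Longrightarrow> y \<in> X \<Longrightarrow>
        norm (x - y) \<le> K * (\<Sum>j\<in>UNIV - {b}. \<bar>T U x $ j - T U y $ j\<bar>)"
        using bil[of b] unfolding U by blast
      have "semialgebraic_map_on X (\<lambda>x. B0 $ b \<bullet> g x)"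
        by (rule semialgebraic_map_on_polynomial_combination[OF sf sg, where h = "\<lambda>v w. B0 $ b \<bullet> w"])
          (intro polynomial_intros)
      moreover have "(norm (B0 $ b) * Lg + norm (A0 $ b) * Lf)-lipschitz_on X (\<lambda>x. B0 $ b \<bullet> g x - T U x $ b)"
      proof (rule lipschitz_onI)
        show "0 \<le> norm (B0 $ b) * Lg + norm (A0 $ b) * Lf"
          using L[THEN lipschitz_on_nonneg] by simp
        fix x y assume xy: "x \<in> X" "y \<in> X"
        have "\<bar>B0 $ b \<bullet> (g x - g y)\<bar> \<le> norm (B0 $ b) * (Lg * norm (x - y))"
          using lipschitz_onD[OF L(2) xy]
          by (intro order_trans[OF Cauchy_Schwarz_ineq2] mult_left_mono) (auto simp: dist_norm)
        moreover have "\<bar>A0 $ b \<bullet> (f x - f y)\<bar> \<le> norm (A0 $ b) * (Lf * norm (x - y))"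
          using lipschitz_onD[OF L(1) xy]
          by (intro order_trans[OF Cauchy_Schwarz_ineq2] mult_left_mono) (auto simp: dist_norm)
        moreover have "(B0 $ b \<bullet> g x - T U x $ b) - (B0 $ b \<bullet> g y - T U y $ b) =
            B0 $ b \<bullet> (g x - g y) - A0 $ b \<bullet> (f x - f y)"
          using U by (simp add: T_def inner_diff_right)
        ultimately show "dist (B0 $ b \<bullet> g x - T U x $ b) (B0 $ b \<bullet> g y - T U y $ b) \<le>
            (norm (B0 $ b) * Lg + norm (A0 $ b) * Lf) * dist x y"
          by (simp add: dist_norm algebra_simps)
      qed
      ultimately have "\<exists>\<Psi>. semialgebraic_tame_homeo \<Psi> \<and>
          (\<forall>x\<in>X. \<Psi> (T U x) = (\<chi> j. if j = b then B0 $ b \<bullet> g x else T U x $ j))"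
        by (rule replace_coordinate[OF X(3,2) sT _ _ K])
      then obtain \<Psi> where \<Psi>: "semialgebraic_tame_homeo \<Psi>"
        "\<And>x. x \<in> X \<Longrightarrow> \<Psi> (T U x) = (\<chi> j. if j = b then B0 $ b \<bullet> g x else T U x $ j)"
        by blast
      have "(\<Psi> \<circ> \<Phi>) (T {} x) = T (insert b U) x" if "x \<in> X" for x
      proof -
        have "(\<Psi> \<circ> \<Phi>) (T {} x) = (\<chi> j. if j = b then B0 $ b \<bullet> g x else T U x $ j)"
          using \<Phi>(2)[OF that] \<Psi>(2)[OF that] by simp
        also have "\<dots> = T (insert b U) x" by (auto simp: T_def vec_eq_iff)
        finally show ?thesis .
      qed
      then show "\<exists>\<Phi>. semialgebraic_tame_homeo \<Phi> \<and> (\<forall>x\<in>X. \<Phi> (T {} x) = T (insert b U) x)"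
        using semialgebraic_tame_homeo_compose[OF \<Psi>(1) \<Phi>(1)] by blast
    qed
  qed
  from this[of UNIV] obtain \<Phi> where \<Phi>: "semialgebraic_tame_homeo \<Phi>" "\<And>x. x \<in> X \<Longrightarrow> \<Phi> (T {} x) = T UNIV x" by auto
  \<comment> \<open>\<open>C\<close> inverts \<open>B0\<close>: the shears lead from
    \<open>A0 *v f x\<close> to \<open>B0 *v g x\<close>, and the last linear map returns to
    \<open>g x\<close>.\<close>
  obtain C where C: "det C = 1" "\<And>x. C *v (B0 *v x) = x" using semialgebraic_tame_homeo_matrix(2)[OF det0(2)] by blast
  have "semialgebraic_tame_homeo ((\<lambda>x. C *v x) \<circ> (\<Phi> \<circ> (\<lambda>x. A0 *v x)))"
    by (intro semialgebraic_tame_homeo_compose semialgebraic_tame_homeo_matrix(1) C det0 \<Phi>)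
  moreover have "g x = ((\<lambda>x. C *v x) \<circ> (\<Phi> \<circ> (\<lambda>x. A0 *v x))) (f x)" if "x \<in> X" for x
  proof -
    have "T {} x = A0 *v f x" "T UNIV x = B0 *v g x"
      by (simp_all add: T_def vec_eq_iff matrix_vector_mul_component)
    then show ?thesis using \<Phi>(2)[OF that] C(2) by simp
  qed
  ultimately show ?thesis by blast
qed

theorem corollary4p6:
  fixes X :: "(real^'m::finite) set" and k :: int
  assumes "closed X" and "semialgebraic X"
    and "semialgebraic_dim X = k"
    and "int CARD('n) \<ge> 2 * k + 2"
  shows "(\<exists>f :: real^'m \<Rightarrow> real^'n::{finite,linorder}. semialgebraic_bilipschitz_embedding X f) \<and>
    (\<forall>f g :: real^'m \<Rightarrow> real^'n::{finite,linorder}.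
       semialgebraic_bilipschitz_embedding X f \<longrightarrow> semialgebraic_bilipschitz_embedding X g \<longrightarrow>
       (\<exists>\<Phi> :: real^'n::{finite,linorder} \<Rightarrow> real^'n::{finite,linorder}.
          semialgebraic_map_on UNIV \<Phi> \<and> bilipschitz_homeo \<Phi> \<and> tame \<Phi> \<and>
          (\<forall>x\<in>X. g x = \<Phi> (f x))))"
proof (cases "X = {}")
  \<comment> \<open>The empty set is treated apart: its dimension is -1, and McShane's infimum is
    taken over the points of \<open>X\<close>.\<close>
  case True
  have "semialgebraic_bilipschitz_embedding X (\<lambda>x. 0 :: (real, 'n) vec)"
    using True by (intro semialgebraic_bilipschitz_embeddingI[of _ _ 0 0])
      (auto simp: semialgebraic_map_on_def lipschitz_on_def)
  then show ?thesis using True semialgebraic_tame_homeo_id unfolding semialgebraic_tame_homeo_def by auto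
next
  case False
  have "semialgebraic_dim X \<ge> 0" by (rule semialgebraic_dim_nonneg[OF False])
  then have "\<exists>f :: real^'m \<Rightarrow> (real, 'n) vec. semialgebraic_bilipschitz_embedding X f"
    using assms by (intro semialgebraic_bilipschitz_embedding_exists) auto
  then show ?thesis
    using semialgebraic_bilipschitz_embedding_unique[OF assms(1,2) False] assms(3,4)
    unfolding semialgebraic_tame_homeo_def by blast
qed

end
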